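(* Let $k,n\in\mathbb{N}$ with $k<n$. (a) The cells $C(\mathcal I)$, $\mathcal I\in\mathcal{GN}_{k,n}$, of $X(k,n)$ coincide with the ${\rm Aut}_{\Delta_n}(U_{[n]})$ orbits on $X(k,n)$. (b) $X(k,n)$ is equipped with an action of the $(n+1)$-dimensional torus $T=(\mathbb{C}^* )^{n+1}$ (described in the context) which preserves the cellular decomposition, i.e. every cell $C(\mathcal I)$ is $T$-stable. (c) The corresponding moment graph has the following description in terms of Grassmann necklaces. Its vertex set is $\mathcal{GN}_{k,n}$ ($\mathcal I$ corresponding to the fixed point $p(\mathcal I)$). There is an edge $\mathcal I\to\mathcal I'$ if and only if $\mathcal I'<\mathcal I$ and there exist $a,b\in[n]$ such that: $I_h\ne I'_h$ if and only if $h\in[a,b]_a$; and there exist $j,j'\in[n]$ such that $I_h=(I'_h\setminus\{j'\})\cup\{j\}$ for all $h\in[a,b]_a$. The label of such an edge is (up to sign) $\epsilon_j-\epsilon_{j'}-\#[j',j)_a\,\delta$.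
   Context: Notation: $[n]=\{1,\dots,n\}$; indices in $\mathbb{Z}_n$ are identified with elements of $[n]$ and taken modulo $n$. Let $W$ be an $n$-dimensional complex vector space with basis $e_1,\dots,e_n$, ${\rm pr}_i(e_j)=e_j$ for $j\ne i$, ${\rm pr}_i(e_i)=0$, and $$X(k,n)=\Big\{(V_i)_{i\in\mathbb{Z}_n}\in\prod_{i\in\mathbb{Z}_n}{\rm Gr}_k(W)\ :\ {\rm pr}_iV_i\subseteq V_{i+1}\ \forall i\in\mathbb{Z}_n\Big\}.$$ $\Delta_n$ is the cyclic quiver with vertices $\mathbb{Z}_n$ and arrows $\alpha_i:i\to i+1$; $U_{[n]}$ is its representation with space $W$ at each vertex and map ${\rm pr}_i$ along $\alpha_i$, so $X(k,n)={\rm Gr}_{(k,\dots,k)}(U_{[n]})$. The group ${\rm Aut}_{\Delta_n}(U_{[n]})$ consists of tuples $(E_i)_{i\in\mathbb{Z}_n}\in\prod_i GL(W)$ with $E_{i+1}{\rm pr}_i={\rm pr}_iE_i$ and acts on $X(k,n)$ by $(V_i)\mapsto(E_iV_i)$. $\mathcal{GN}_{k,n}$ is the set of $(k,n)$ Grassmann necklaces: tuples $\mathcal I=(I_1,\dots,I_n)$ of $k$-subsets of $[n]$ with $I_a\subset I_{a+1}\cup\{a\}$ for all $a$ (with $I_{n+1}=I_1$). $p(\mathcal I)\in X(k,n)$ has $a$-th component ${\rm span}(e_i:i\in I_a)$. For $a,j\in[n]$ let $h(a,j)\in[n]$ be congruent to $a-j$ mod $n$. $\lambda\in\mathbb{C}^*$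 acts on the copy of $W$ at index $a$ by $e_j\mapsto\lambda^{h(a,j)}e_j$, inducing an action on $X(k,n)$ with fixed points the $p(\mathcal I)$; the cells are $C(\mathcal I)=\{V:\lim_{\lambda\to0}\lambda.V=p(\mathcal I)\}$. Torus $T=(\mathbb{C}^* )^{n+1}$: $\gamma=(\gamma_0,\gamma_1,\dots,\gamma_n)$ acts on the copy of $W$ at index $a$ by $e_j\mapsto\gamma_0^{h(a,j)}\gamma_j e_j$, inducing an action on $X(k,n)$. Characters (written additively): $\delta(\gamma)=\gamma_0$, $\epsilon_i(\gamma)=\gamma_i$. Orders: for $a\in[n]$, $\le_a$ is the total order $a<_a a+1<_a\dots<_a n<_a 1<_a\dots<_a a-1$ on $[n]$. For $k$-subsets $I=\{i_1<_a\dots<_a i_k\}$, $J=\{j_1<_a\dots<_a j_k\}$, $I\le_aJ$ means $i_u\le_aj_u$ for all $u$. For necklaces, $\mathcal I\le\mathcal J$ iff $I_a\le_aJ_a$ for all $a$. Put $[x,y]_a=\{z\in[n]:x\le_az\le_ay\}$ and $[x,y)_a=[x,y]_a\setminus\{y\}$. Moment graph: for a torus $T$ acting on a complex projective variety with finitely many fixed points and one-dimensional orbits, with a $T$-stable cellular decomposition in which each cell contains exactly one fixed point: vertices are the fixed points; there is an edge $x\to y$ iff $x\neq y$ lie in the closure of the same one-dimensional $T$-orbit and $y$ lies in the closure of the cell containing $x$; the label is the character by which $T$ acts on that one-dimensional orbit (well defined up to sign). *)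

theory Defs
  imports "HOL-Analysis.Analysis" "HOL-Library.Function_Algebras"
begin

section \<open>Cyclic indices and Grassmann necklaces\<close>

text \<open>The representative in \<open>{1..n}\<close> of the residue class of \<open>x\<close> modulo \<open>n\<close>.\<close>

definition cyc :: "nat \<Rightarrow> int \<Rightarrow> nat" where
  "cyc n x = nat ((x - 1) mod int n) + 1"

lemma cyc_in_range: "n > 0 \<Longrightarrow> cyc n x \<in> {1..n}"
  unfolding cyc_def using pos_mod_bound[of "int n" "x - 1"] pos_mod_sign[of "int n" "x - 1"]
  by (simp add: nat_less_iff Suc_le_eq)

lemma cyc_cong: "n > 0 \<Longrightarrow> int (cyc n x) mod int n = x mod int n"
  unfolding cyc_def using mod_add_right_eq[of 1 "x - 1" "int n"] by simp

definition nxt :: "nat \<Rightarrow> nat \<Rightarrow> nat" where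
  "nxt n a = cyc n (int a + 1)"

definition hgt :: "nat \<Rightarrow> nat \<Rightarrow> nat \<Rightarrow> nat" where
  "hgt n a j = cyc n (int a - int j)"

text \<open>
  The number of steps from \<open>a\<close> to \<open>x\<close> in the cyclic direction. On \<open>{1..n}\<close> it is injective and
  \<open>x \<le>\<^sub>a y\<close> holds iff \<open>pos n a x \<le> pos n a y\<close>; so the increasing enumeration of a set \<open>S\<close> with
  respect to \<open>\<le>\<^sub>a\<close> corresponds to the sorted list of positions of the elements of \<open>S\<close>.
\<close>

definition pos :: "nat \<Rightarrow> nat \<Rightarrow> nat \<Rightarrow> nat" where
  "pos n a x = nat ((int x - int a) mod int n)"

definition cyc_closed :: "nat \<Rightarrow> nat \<Rightarrow> nat \<Rightarrow> nat \<Rightarrow> nat set" where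
  "cyc_closed n a x y = {z \<in> {1..n}. pos n a x \<le> pos n a z \<and> pos n a z \<le> pos n a y}"

definition cyc_halfopen :: "nat \<Rightarrow> nat \<Rightarrow> nat \<Rightarrow> nat \<Rightarrow> nat set" where
  "cyc_halfopen n a x y = cyc_closed n a x y - {y}"

definition subset_le :: "nat \<Rightarrow> nat \<Rightarrow> nat set \<Rightarrow> nat set \<Rightarrow> bool" where
  "subset_le n a S S' \<longleftrightarrow>
     list_all2 (\<le>) (sorted_list_of_set (pos n a ` S)) (sorted_list_of_set (pos n a ` S'))"

definition necklaces :: "nat \<Rightarrow> nat \<Rightarrow> (nat \<Rightarrow> nat set) set" where
  "necklaces k n = {I \<in> {1..n} \<rightarrow>\<^sub>E {S. S \<subseteq> {1..n} \<and> card S = k}.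
     \<forall>a\<in>{1..n}. I a \<subseteq> I (nxt n a) \<union> {a}}"

definition necklace_le :: "nat \<Rightarrow> (nat \<Rightarrow> nat set) \<Rightarrow> (nat \<Rightarrow> nat set) \<Rightarrow> bool" where
  "necklace_le n I J \<longleftrightarrow> (\<forall>a\<in>{1..n}. subset_le n a (I a) (J a))"

definition necklace_less :: "nat \<Rightarrow> (nat \<Rightarrow> nat set) \<Rightarrow> (nat \<Rightarrow> nat set) \<Rightarrow> bool" where
  "necklace_less n I J \<longleftrightarrow> necklace_le n I J \<and> I \<noteq> J"


section \<open>Grassmannians with their classical topology\<close>

text \<open>
  The Grassmannian carries the quotient topology from the space of linearly independent
  \<open>k\<close>-tuples. Closures are taken in the classical rather than the Zariski topology; for
  constructible sets, such as torus orbits and cells, the two closures coincide.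
\<close>

definition quotient_topology :: "'a topology \<Rightarrow> ('a \<Rightarrow> 'b) \<Rightarrow> 'b topology" where
  "quotient_topology X f =
     topology (\<lambda>U. U \<subseteq> f ` topspace X \<and> openin X {x \<in> topspace X. f x \<in> U})"

lemma openin_quotient_topology:
  "openin (quotient_topology X f) U \<longleftrightarrow>
     U \<subseteq> f ` topspace X \<and> openin X {x \<in> topspace X. f x \<in> U}"
proof -
  have "istopology (\<lambda>U. U \<subseteq> f ` topspace X \<and> openin X {x \<in> topspace X. f x \<in> U})"
    unfolding istopology_def
  proof (intro conjI allI impI; (elim conjE)?)
    fix S T
    assume "openin X {x \<in> topspace X. f x \<in> S}" "openin X {x \<in> topspace X. f x \<in> T}"
    then have "openin X ({x \<in> topspace X. f x \<in> S} \<inter> {x \<in> topspace X. f x \<in> T})"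
      by (rule openin_Int)
    moreover have "{x \<in> topspace X. f x \<in> S} \<inter> {x \<in> topspace X. f x \<in> T}
        = {x \<in> topspace X. f x \<in> S \<inter> T}" by auto
    ultimately show "openin X {x \<in> topspace X. f x \<in> S \<inter> T}" by simp
  next
    fix \<K>
    assume *: "\<forall>K\<in>\<K>. K \<subseteq> f ` topspace X \<and> openin X {x \<in> topspace X. f x \<in> K}"
    have "openin X (\<Union>K\<in>\<K>. {x \<in> topspace X. f x \<in> K})"
      using * by (intro openin_clauses(3)) auto
    moreover have "(\<Union>K\<in>\<K>. {x \<in> topspace X. f x \<in> K}) = {x \<in> topspace X. f x \<in> \<Union>\<K>}"
      by auto
    ultimately show "openin X {x \<in> topspace X. f x \<in> \<Union>\<K>}" by simp
  qed auto
  then show ?thesis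
    unfolding quotient_topology_def by (simp add: topology_inverse')
qed

lemma quotient_map_quotient_topology: "quotient_map X (quotient_topology X f) f"
proof -
  have "{x \<in> topspace X. f x \<in> f ` topspace X} = topspace X" by auto
  then have "openin (quotient_topology X f) (f ` topspace X)"
    by (simp add: openin_quotient_topology)
  then have "f ` topspace X \<subseteq> topspace (quotient_topology X f)"
    by (rule openin_subset)
  moreover have "topspace (quotient_topology X f) \<subseteq> f ` topspace X"
    using openin_topspace[of "quotient_topology X f"]
    unfolding openin_quotient_topology[of X f] by (rule conjunct1)
  ultimately have "topspace (quotient_topology X f) = f ` topspace X"
    by (rule equalityI[rotated])
  then show ?thesis
    unfolding quotient_map_def by (simp add: openin_quotient_topology)
qed

definition Gr :: "nat \<Rightarrow> (complex ^ 'n) set set" where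
  "Gr k = {V. vec.subspace V \<and> vec.dim V = k}"

definition frames :: "nat \<Rightarrow> (nat \<Rightarrow> complex ^ 'n) set" where
  "frames k = {f \<in> {..<k} \<rightarrow>\<^sub>E UNIV. inj_on f {..<k} \<and> vec.independent (f ` {..<k})}"

definition Gr_top :: "nat \<Rightarrow> (complex ^ 'n) set topology" where
  "Gr_top k = quotient_topology
     (subtopology (product_topology (\<lambda>_. euclidean) {..<k}) (frames k))
     (\<lambda>f. vec.span (f ` {..<k}))"

lemma topspace_Gr_top: "topspace (Gr_top k :: (complex ^ 'n) set topology) = Gr k"
proof -
  let ?X = "subtopology (product_topology (\<lambda>_. euclidean) {..<k})
              (frames k :: (nat \<Rightarrow> complex ^ 'n) set)"
  have top: "topspace ?X = frames k"
    by (simp add: frames_def Int_absorb1 subset_iff PiE_iff)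
  have "(\<lambda>f. vec.span (f ` {..<k})) ` frames k = (Gr k :: (complex ^ 'n) set set)"
  proof (intro equalityI subsetI)
    fix V :: "(complex ^ 'n) set"
    assume "V \<in> (\<lambda>f. vec.span (f ` {..<k})) ` frames k"
    then obtain f where f: "inj_on f {..<k}" "vec.independent (f ` {..<k})"
      "V = vec.span (f ` {..<k})"
      unfolding frames_def by blast
    then have "vec.dim V = k"
      using vec.dim_eq_card_independent[OF f(2)] card_image[OF f(1)] vec.dim_span
      by (metis card_lessThan)
    then show "V \<in> Gr k"
      using f(3) vec.subspace_span by (simp add: Gr_def)
  next
    fix V :: "(complex ^ 'n) set"
    assume V: "V \<in> Gr k"
    obtain B where B: "B \<subseteq> V" "vec.independent B" "V \<subseteq> vec.span B" "card B = vec.dim V"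
      using vec.basis_exists[of V] by auto
    have "finite B" using B(2) vec.finiteI_independent by blast
    then obtain g where g: "bij_betw g {..<card B} B"
      using ex_bij_betw_nat_finite[of B] by (auto simp: atLeast0LessThan)
    have k: "card B = k" using B V by (simp add: Gr_def)
    let ?f = "restrict g {..<k}"
    have im: "?f ` {..<k} = B" using g k by (simp add: bij_betw_def)
    have "?f \<in> frames k"
      unfolding frames_def mem_Collect_eq im using g k B(2)
      by (simp add: bij_betw_def inj_on_def)
    moreover have "vec.span (?f ` {..<k}) = V"
      unfolding im using B(1,3) V vec.span_minimal[of B V] unfolding Gr_def by blast
    ultimately show "V \<in> (\<lambda>f. vec.span (f ` {..<k})) ` frames k"
      by (intro image_eqI[where x = ?f]) (rule sym)
  qed
  moreover have "topspace (Gr_top k) = (\<lambda>f. vec.span (f ` {..<k})) ` topspace ?X"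
    unfolding Gr_top_def
    by (rule quotient_imp_surjective_map[OF quotient_map_quotient_topology, symmetric])
  ultimately show ?thesis unfolding top by simp
qed


section \<open>The quiver Grassmannian and its automorphism group\<close>

text \<open>The vector space \<open>W\<close> is \<open>complex ^ 'n\<close> with an arbitrary basis \<open>e 1, \<dots>, e n\<close>.\<close>

definition is_basis :: "nat \<Rightarrow> (nat \<Rightarrow> complex ^ 'n) \<Rightarrow> bool" where
  "is_basis n e \<longleftrightarrow>
     inj_on e {1..n} \<and> vec.independent (e ` {1..n}) \<and> vec.span (e ` {1..n}) = UNIV"

text \<open>The linear map \<open>e j \<mapsto> c j *s e j\<close>.\<close>

definition diag :: "nat \<Rightarrow> (nat \<Rightarrow> complex ^ 'n) \<Rightarrow> (nat \<Rightarrow> complex) \<Rightarrow> complex ^ 'n \<Rightarrow> complex ^ 'n"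
  where "diag n e c v =
    (\<Sum>j\<in>{1..n}. (c j * vec.representation (e ` {1..n}) v (e j)) *s e j)"

definition pr :: "nat \<Rightarrow> (nat \<Rightarrow> complex ^ 'n) \<Rightarrow> nat \<Rightarrow> complex ^ 'n \<Rightarrow> complex ^ 'n" where
  "pr n e i = diag n e (\<lambda>j. if j = i then 0 else 1)"

definition X_set :: "nat \<Rightarrow> nat \<Rightarrow> (nat \<Rightarrow> complex ^ 'n) \<Rightarrow> (nat \<Rightarrow> (complex ^ 'n) set) set" where
  "X_set k n e = {V \<in> {1..n} \<rightarrow>\<^sub>E Gr k. \<forall>i\<in>{1..n}. pr n e i ` V i \<subseteq> V (nxt n i)}"

definition X_top :: "nat \<Rightarrow> nat \<Rightarrow> (nat \<Rightarrow> complex ^ 'n) \<Rightarrow> (nat \<Rightarrow> (complex ^ 'n) set) topology" where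
  "X_top k n e = subtopology (product_topology (\<lambda>_. Gr_top k) {1..n}) (X_set k n e)"

definition Aut_U :: "nat \<Rightarrow> (nat \<Rightarrow> complex ^ 'n) \<Rightarrow> (nat \<Rightarrow> complex ^ 'n \<Rightarrow> complex ^ 'n) set" where
  "Aut_U n e =
     {E \<in> {1..n} \<rightarrow>\<^sub>E {F. Vector_Spaces.linear (*s) (*s) F \<and> bij F}.
        \<forall>i\<in>{1..n}. E (nxt n i) \<circ> pr n e i = pr n e i \<circ> E i}"

definition tuple_act ::
    "nat \<Rightarrow> (nat \<Rightarrow> complex ^ 'n \<Rightarrow> complex ^ 'n) \<Rightarrow> (nat \<Rightarrow> (complex ^ 'n) set) \<Rightarrow> nat \<Rightarrow> (complex ^ 'n) set"
  where "tuple_act n E V = (\<lambda>a\<in>{1..n}. E a ` V a)"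

definition act_orbit :: "'g set \<Rightarrow> ('g \<Rightarrow> 'x \<Rightarrow> 'x) \<Rightarrow> 'x \<Rightarrow> 'x set" where
  "act_orbit G act x = (\<lambda>g. act g x) ` G"

definition p_pt :: "nat \<Rightarrow> (nat \<Rightarrow> complex ^ 'n) \<Rightarrow> (nat \<Rightarrow> nat set) \<Rightarrow> nat \<Rightarrow> (complex ^ 'n) set" where
  "p_pt n e I = (\<lambda>a\<in>{1..n}. vec.span (e ` I a))"

definition cstar_act ::
    "nat \<Rightarrow> (nat \<Rightarrow> complex ^ 'n) \<Rightarrow> complex \<Rightarrow> (nat \<Rightarrow> (complex ^ 'n) set) \<Rightarrow> nat \<Rightarrow> (complex ^ 'n) set"
  where "cstar_act n e l = tuple_act n (\<lambda>a. diag n e (\<lambda>j. l ^ hgt n a j))"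

definition cell ::
    "nat \<Rightarrow> nat \<Rightarrow> (nat \<Rightarrow> complex ^ 'n) \<Rightarrow> (nat \<Rightarrow> nat set) \<Rightarrow> (nat \<Rightarrow> (complex ^ 'n) set) set" where
  "cell k n e I =
     {V \<in> X_set k n e. limitin (X_top k n e) (\<lambda>l. cstar_act n e l V) (p_pt n e I) (at 0)}"


section \<open>Torus actions and moment graphs\<close>

text \<open>
  \<open>torus n\<close> is \<open>(\<complex>\<^sup>*)\<^sup>n\<^sup>+\<^sup>1\<close>, with coordinates indexed by \<open>0, \<dots>, n\<close>. Its characters are identified
  with their exponent vectors, so that they are written additively.
\<close>

definition torus :: "nat \<Rightarrow> (nat \<Rightarrow> complex) set" where
  "torus n = {0..n} \<rightarrow>\<^sub>E (- {0})"

definition torus_one :: "nat \<Rightarrow> nat \<Rightarrow> complex" where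
  "torus_one n = (\<lambda>i\<in>{0..n}. 1)"

definition torus_mult :: "nat \<Rightarrow> (nat \<Rightarrow> complex) \<Rightarrow> (nat \<Rightarrow> complex) \<Rightarrow> nat \<Rightarrow> complex" where
  "torus_mult n g g' = (\<lambda>i\<in>{0..n}. g i * g' i)"

definition characters :: "nat \<Rightarrow> (nat \<Rightarrow> int) set" where
  "characters n = {m. \<forall>i>n. m i = 0}"

definition char_eval :: "nat \<Rightarrow> (nat \<Rightarrow> int) \<Rightarrow> (nat \<Rightarrow> complex) \<Rightarrow> complex" where
  "char_eval n m g = (\<Prod>i\<in>{0..n}. g i powi m i)"

definition eps :: "nat \<Rightarrow> nat \<Rightarrow> int" where
  "eps i = (\<lambda>l. if l = i then 1 else 0)"

definition delta :: "nat \<Rightarrow> int" where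
  "delta = eps 0"

definition torus_act ::
    "nat \<Rightarrow> (nat \<Rightarrow> complex ^ 'n) \<Rightarrow> (nat \<Rightarrow> complex) \<Rightarrow> (nat \<Rightarrow> (complex ^ 'n) set) \<Rightarrow> nat \<Rightarrow> (complex ^ 'n) set"
  where "torus_act n e g = tuple_act n (\<lambda>a. diag n e (\<lambda>j. g 0 ^ hgt n a j * g j))"

definition fixed_points ::
    "nat \<Rightarrow> 'x topology \<Rightarrow> ((nat \<Rightarrow> complex) \<Rightarrow> 'x \<Rightarrow> 'x) \<Rightarrow> 'x set" where
  "fixed_points n X act = {x \<in> topspace X. \<forall>g\<in>torus n. act g x = x}"

definition stabilizer :: "nat \<Rightarrow> ((nat \<Rightarrow> complex) \<Rightarrow> 'x \<Rightarrow> 'x) \<Rightarrow> 'x \<Rightarrow> (nat \<Rightarrow> complex) set" where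
  "stabilizer n act x = {g \<in> torus n. act g x = x}"

text \<open>
  The Lie algebra of a Zariski closed subgroup of the torus, inside \<open>\<complex>\<^sup>n\<^sup>+\<^sup>1\<close>. The dimension of an
  orbit is the dimension of the torus minus that of the stabilizer.
\<close>

definition lie :: "nat \<Rightarrow> (nat \<Rightarrow> complex) set \<Rightarrow> (nat \<Rightarrow> complex) set" where
  "lie n H = {\<xi>. (\<forall>i>n. \<xi> i = 0) \<and>
     (\<forall>t::real. (\<lambda>i\<in>{0..n}. exp (complex_of_real t * \<xi> i)) \<in> H)}"

interpretation cfun: vector_space "\<lambda>(c::complex) (f::nat \<Rightarrow> complex) i. c * f i"
  by unfold_locales (auto simp: fun_eq_iff algebra_simps)

definition orbit_dim :: "nat \<Rightarrow> ((nat \<Rightarrow> complex) \<Rightarrow> 'x \<Rightarrow> 'x) \<Rightarrow> 'x \<Rightarrow> nat" where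
  "orbit_dim n act x = (n + 1) - cfun.dim (lie n (stabilizer n act x))"

definition one_dim_orbits ::
    "nat \<Rightarrow> 'x topology \<Rightarrow> ((nat \<Rightarrow> complex) \<Rightarrow> 'x \<Rightarrow> 'x) \<Rightarrow> 'x set set" where
  "one_dim_orbits n X act =
     {act_orbit (torus n) act x |x. x \<in> topspace X \<and> orbit_dim n act x = 1}"

text \<open>
  The torus acts on a one-dimensional orbit \<open>Q\<close> by the character \<open>m\<close> if \<open>Q\<close> is equivariantly
  isomorphic to \<open>\<complex>\<^sup>*\<close> with the torus acting on it through \<open>m\<close>. Replacing the isomorphism \<open>\<phi>\<close> by
  \<open>\<lambda>z. \<phi> (1 / z)\<close> replaces \<open>m\<close> by \<open>- m\<close>.
\<close>

definition acts_by_character ::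
    "nat \<Rightarrow> 'x topology \<Rightarrow> ((nat \<Rightarrow> complex) \<Rightarrow> 'x \<Rightarrow> 'x) \<Rightarrow> 'x set \<Rightarrow> (nat \<Rightarrow> int) \<Rightarrow> bool" where
  "acts_by_character n X act Q m \<longleftrightarrow>
     m \<in> characters n \<and>
     (\<exists>\<phi>. homeomorphic_map (top_of_set (- {0})) (subtopology X Q) \<phi> \<and>
          (\<forall>g\<in>torus n. \<forall>z\<in>- {0}. act g (\<phi> z) = \<phi> (char_eval n m g * z)))"

definition connecting_orbits ::
    "nat \<Rightarrow> 'x topology \<Rightarrow> ((nat \<Rightarrow> complex) \<Rightarrow> 'x \<Rightarrow> 'x) \<Rightarrow> 'x \<Rightarrow> 'x \<Rightarrow> 'x set set" where
  "connecting_orbits n X act x y =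
     {Q \<in> one_dim_orbits n X act. x \<in> X closure_of Q \<and> y \<in> X closure_of Q}"

definition moment_edge ::
    "nat \<Rightarrow> 'x topology \<Rightarrow> ((nat \<Rightarrow> complex) \<Rightarrow> 'x \<Rightarrow> 'x) \<Rightarrow> 'x set set \<Rightarrow> 'x \<Rightarrow> 'x \<Rightarrow> bool" where
  "moment_edge n X act cells x y \<longleftrightarrow>
     x \<in> fixed_points n X act \<and> y \<in> fixed_points n X act \<and> x \<noteq> y \<and>
     connecting_orbits n X act x y \<noteq> {} \<and>
     (\<exists>C\<in>cells. x \<in> C \<and> y \<in> X closure_of C)"

text \<open>
  The combinatorial condition for an edge from \<open>I\<close> to \<open>I'\<close>, with the data \<open>a\<close>, \<open>b\<close>, \<open>j\<close>, \<open>j'\<close> exhibited.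
\<close>

definition necklace_move ::
    "nat \<Rightarrow> (nat \<Rightarrow> nat set) \<Rightarrow> (nat \<Rightarrow> nat set) \<Rightarrow> nat \<Rightarrow> nat \<Rightarrow> nat \<Rightarrow> nat \<Rightarrow> bool" where
  "necklace_move n I I' a b j j' \<longleftrightarrow>
     a \<in> {1..n} \<and> b \<in> {1..n} \<and> j \<in> {1..n} \<and> j' \<in> {1..n} \<and>
     (\<forall>h\<in>{1..n}. I h \<noteq> I' h \<longleftrightarrow> h \<in> cyc_closed n a a b) \<and>
     (\<forall>h\<in>cyc_closed n a a b. I h = (I' h - {j'}) \<union> {j})"

end

theory Submission
  imports Defs
begin

text \<open>
  The vector \<open>e j\<close> lives at the indices \<open>j + 1, \<dots>, j + n = j\<close> before it is killed, so an endomorphism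
  of \<open>U\<close> is determined by one vector \<open>w j\<close> for each \<open>j\<close>, the image of \<open>e j\<close> at index \<open>j + 1\<close>; at
  index \<open>a\<close> the image of \<open>e j\<close> is what the projections leave of \<open>w j\<close>, its truncation to the
  \<open>m \<le>\<^sub>a j\<close>. Thus automorphisms are triangular with respect to \<open>\<le>\<^sub>a\<close> at every \<open>a\<close> and preserve the set
  \<open>leads a (V a)\<close> of pivots of the echelon form of \<open>V a\<close> (\<open>Aut_X\<close>). Under the contracting action of
  \<open>\<complex>\<^sup>*\<close> the pivots dominate, so \<open>V\<close> flows to \<open>p(I)\<close> where \<open>I a = leads a (V a)\<close>, and the cells are the
  sets of points with given pivots (\<open>cell_eq\<close>). They are single orbits: for each \<open>j\<close> take the reduced
  echelon vector with pivot \<open>j\<close> at the first index, counted from \<open>j + 1\<close>, where \<open>j\<close> is a pivot. Its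
  truncations lie in the later \<open>V a\<close>, so these vectors define an automorphism that maps \<open>p(I)\<close> to
  \<open>V\<close> (\<open>generating_vectors\<close>, \<open>Aut_transitive\<close>).

  The torus acts on the reduced echelon entry of \<open>V a\<close> at position \<open>(i, j)\<close> by a character \<open>chi n i j\<close>
  which does not depend on \<open>a\<close>. The stabilizer of \<open>V\<close> is cut out by the characters of its non-zero
  entries (\<open>stabilizer_entries\<close>), and any two of these characters are linearly independent. So an
  orbit is one-dimensional iff a single pair \<open>(i, j)\<close> occurs. The generating vectors then are those of
  \<open>p(I)\<close>, except that \<open>e j\<close> becomes \<open>e j + x *s e i\<close> (\<open>entries_singleton\<close>); hence the orbit is the
  curve of these points for \<open>x \<noteq> 0\<close>, on which the torus multiplies \<open>x\<close> by \<open>chi n i j\<close>. Its closure adds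
  \<open>p(I)\<close> at \<open>x = 0\<close> and, at \<open>x = \<infinity>\<close>, the point \<open>p(I')\<close> of the necklace in which \<open>j\<close> is replaced by
  \<open>i <\<^sub>a j\<close> wherever possible (\<open>curve_closure_fixed\<close>). These exchanges are exactly the downward
  necklace moves (\<open>exch_necklace_move\<close>, \<open>necklace_move_exch\<close>), and the direction of the edge follows
  because \<open>p(I)\<close> is not in the closure of the lower cell (\<open>exch_cell_closure\<close>).

  The topology of the Grassmannian enters through two facts only: the subspaces that meet a given
  open set of vectors form an open set (\<open>openin_hits\<close>), and the span of a convergent family of frames
  converges (\<open>Gr_limit\<close>).
\<close>


section \<open>Cyclic positions\<close>

lemma pos_eq:
  assumes "a \<in> {1..n}" "x \<in> {1..n}"
  shows "pos n a x = (if a \<le> x then x - a else x + n - a)"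
proof (cases "a \<le> x")
  case True
  then have "(int x - int a) mod int n = int x - int a"
    using assms by (intro mod_pos_pos_trivial) auto
  then show ?thesis using True by (simp add: pos_def)
next
  case False
  have "(int x - int a) mod int n = (int x - int a + int n) mod int n" by simp
  also have "\<dots> = int x - int a + int n"
    using assms False by (intro mod_pos_pos_trivial) auto
  finally show ?thesis using False by (simp add: pos_def)
qed

lemma nxt_eq:
  assumes "a \<in> {1..n}"
  shows "nxt n a = (if a = n then 1 else a + 1)"
proof (cases "a = n")
  case True
  then show ?thesis by (simp add: nxt_def cyc_def)
next
  case False
  then have "int a mod int n = int a" using assms by (intro mod_pos_pos_trivial) auto
  then show ?thesis using False by (simp add: nxt_def cyc_def)
qed

lemma nxt_in [simp]: "a \<in> {1..n} \<Longrightarrow> nxt n a \<in> {1..n}"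
  by (auto simp: nxt_eq)

lemma ex_nxt: "a \<in> {1..n} \<Longrightarrow> \<exists>b\<in>{1..n}. nxt n b = a"
proof -
  assume a: "a \<in> {1..n}"
  show ?thesis
  proof (cases "a = 1")
    case True
    then show ?thesis using a by (intro bexI[of _ n]) (auto simp: nxt_eq)
  next
    case False
    then have "a - 1 \<in> {1..n}" "a - 1 \<noteq> n" "a - 1 + 1 = a" using a by auto
    then show ?thesis using nxt_eq[of "a - 1" n] by (intro bexI[of _ "a - 1"]) simp_all
  qed
qed

lemma pos_less: "a \<in> {1..n} \<Longrightarrow> x \<in> {1..n} \<Longrightarrow> pos n a x < n"
  by (auto simp: pos_eq)

lemma pos_self [simp]: "pos n a a = 0"
  by (simp add: pos_def)

lemma pos_inj: "a \<in> {1..n} \<Longrightarrow> inj_on (pos n a) {1..n}"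
  by (auto simp: pos_eq inj_on_def split: if_splits)

lemma pos_eq_iff:
  "a \<in> {1..n} \<Longrightarrow> x \<in> {1..n} \<Longrightarrow> y \<in> {1..n} \<Longrightarrow> pos n a x = pos n a y \<longleftrightarrow> x = y"
  using pos_inj[of a n] by (auto dest: inj_onD)

lemma pos_left_inj:
  "a \<in> {1..n} \<Longrightarrow> b \<in> {1..n} \<Longrightarrow> x \<in> {1..n} \<Longrightarrow> pos n a x = pos n b x \<Longrightarrow> a = b"
  by (auto simp: pos_eq split: if_splits)

text \<open>
  Moving the base point by one step moves every index one place forward, except for the old base
  point, which goes from the first place to the last. The lemmas on projections and on necklaces use
  the cyclic orders through this rule.
\<close>

lemma pos_nxt:
  "a \<in> {1..n} \<Longrightarrow> x \<in> {1..n} \<Longrightarrow> pos n (nxt n a) x = (if x = a then n - 1 else pos n a x - 1)"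
  using nxt_in[of a n] by (auto simp: pos_eq nxt_eq split: if_splits)

lemma pos_pos_iff: "a \<in> {1..n} \<Longrightarrow> x \<in> {1..n} \<Longrightarrow> 0 < pos n a x \<longleftrightarrow> x \<noteq> a"
  by (auto simp: pos_eq split: if_splits)

lemma pos_add:
  "a \<in> {1..n} \<Longrightarrow> x \<in> {1..n} \<Longrightarrow> y \<in> {1..n} \<Longrightarrow> pos n a x \<le> pos n a y \<Longrightarrow>
   pos n a y = pos n a x + pos n x y"
  by (auto simp: pos_eq split: if_splits)

lemma pos_swap: "x \<in> {1..n} \<Longrightarrow> y \<in> {1..n} \<Longrightarrow> x \<noteq> y \<Longrightarrow> pos n x y + pos n y x = n"
  by (auto simp: pos_eq split: if_splits)

lemma hgt_eq:
  assumes "a \<in> {1..n}" "j \<in> {1..n}"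
  shows "hgt n a j = n - pos n a j"
proof -
  have "(int a - int j - 1) mod int n = int n - 1 - int (pos n a j)"
  proof (cases "a \<le> j")
    case True
    have "(int a - int j - 1) mod int n = (int a - int j - 1 + int n) mod int n" by simp
    also have "\<dots> = int a - int j - 1 + int n"
      using assms True by (intro mod_pos_pos_trivial) auto
    finally show ?thesis using True assms by (simp add: pos_eq)
  next
    case False
    then have "(int a - int j - 1) mod int n = int a - int j - 1"
      using assms by (intro mod_pos_pos_trivial) auto
    then show ?thesis using False assms by (simp add: pos_eq)
  qed
  then show ?thesis using pos_less[OF assms] by (simp add: hgt_def cyc_def nat_diff_distrib)
qed

text \<open>
  Seen from \<open>a\<close>, \<open>x\<close> precedes \<open>y\<close> unless \<open>a\<close> lies behind \<open>x\<close> on the arc from \<open>x\<close> to \<open>y\<close>, and the indices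
  there are those that are closer to \<open>y\<close> than \<open>x\<close> is.
\<close>

lemma pos_less_iff:
  assumes "a \<in> {1..n}" "x \<in> {1..n}" "y \<in> {1..n}" "x \<noteq> y"
  shows "pos n a x < pos n a y \<longleftrightarrow> pos n x y \<le> pos n a y"
proof
  assume "pos n x y \<le> pos n a y"
  show "pos n a x < pos n a y"
  proof (rule ccontr)
    assume "\<not> pos n a x < pos n a y"
    then have "pos n a x = pos n a y + pos n y x" using pos_add assms by simp
    then show False
      using pos_swap[OF assms(2,3,4)] \<open>pos n x y \<le> pos n a y\<close> pos_less[OF assms(1,2)] by simp
  qed
qed (use pos_add[OF assms(1,2,3)] in simp)

lemma bij_betw_pos: "a \<in> {1..n} \<Longrightarrow> bij_betw (pos n a) {1..n} {..<n}"
proof -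
  assume a: "a \<in> {1..n}"
  have "pos n a ` {1..n} \<subseteq> {..<n}" using pos_less a by auto
  moreover have "card (pos n a ` {1..n}) = card {..<n}"
    using card_image[OF pos_inj[OF a]] by simp
  ultimately have "pos n a ` {1..n} = {..<n}" by (intro card_subset_eq) auto
  then show ?thesis using pos_inj[OF a] by (simp add: bij_betw_def)
qed

lemma card_cyc_halfopen:
  assumes "a \<in> {1..n}" "x \<in> {1..n}" "y \<in> {1..n}" "pos n a x \<le> pos n a y"
  shows "card (cyc_halfopen n a x y) = pos n x y"
proof -
  have eq: "cyc_halfopen n a x y = {z \<in> {1..n}. pos n a z \<in> {pos n a x..<pos n a y}}"
    using assms(1,3) pos_eq_iff[of a n _ y]
    by (fastforce simp: cyc_halfopen_def cyc_closed_def less_le)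
  have "pos n a ` cyc_halfopen n a x y = {pos n a x..<pos n a y}"
  proof (intro equalityI subsetI)
    fix t
    assume t: "t \<in> {pos n a x..<pos n a y}"
    then have "t \<in> pos n a ` {1..n}"
      using bij_betw_pos[OF assms(1)] pos_less[OF assms(1,3)] by (simp add: bij_betw_def)
    then show "t \<in> pos n a ` cyc_halfopen n a x y" using t unfolding eq by blast
  qed (auto simp: eq)
  moreover have "inj_on (pos n a) (cyc_halfopen n a x y)"
    using pos_inj[OF assms(1)] by (rule inj_on_subset) (auto simp: eq)
  ultimately have "card (cyc_halfopen n a x y) = card {pos n a x..<pos n a y}"
    using card_image by metis
  then show ?thesis using pos_add[OF assms] by simp
qed


section \<open>Necklaces and exchanges\<close>

lemma finite_necklaces: "finite (necklaces k n)"
proof (rule finite_subset)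
  have "({1..n} \<rightarrow>\<^sub>E {S. S \<subseteq> {1..n} \<and> card S = k}) \<subseteq> ({1..n} \<rightarrow>\<^sub>E Pow {1..n})"
    by (rule PiE_mono) blast
  then show "necklaces k n \<subseteq> {1..n} \<rightarrow>\<^sub>E Pow {1..n}" unfolding necklaces_def by blast
qed (intro finite_PiE, auto)

text \<open>
  An element \<open>l\<close> of a necklace can be lost only in the step from \<open>l\<close> to \<open>l + 1\<close>. So, going around from
  \<open>l + 1\<close> to \<open>l\<close>, the indices \<open>a\<close> with \<open>l \<in> I a\<close> form a final segment.
\<close>

lemma necklace_persist:
  assumes I: "I \<in> necklaces k n" and l: "l \<in> {1..n}" and z': "z' \<in> {1..n}"
  shows "z \<in> {1..n} \<Longrightarrow> l \<in> I z \<Longrightarrow> pos n z' l \<le> pos n z l \<Longrightarrow> l \<in> I z'"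
proof (induction "pos n z l" arbitrary: z rule: less_induct)
  case less
  show ?case
  proof (cases "pos n z' l = pos n z l")
    case True
    then show ?thesis using pos_left_inj[OF z' less.prems(1) l] less.prems(2) by simp
  next
    case False
    then have lt: "pos n z' l < pos n z l" using less.prems by simp
    then have "l \<noteq> z" by auto
    moreover have "I z \<subseteq> I (nxt n z) \<union> {z}" using I less.prems(1) by (simp add: necklaces_def)
    ultimately have "l \<in> I (nxt n z)" using less.prems(2) by auto
    moreover have "pos n (nxt n z) l = pos n z l - 1"
      using pos_nxt[OF less.prems(1) l] \<open>l \<noteq> z\<close> by simp
    ultimately show ?thesis
      using less.hyps[of "nxt n z"] lt nxt_in[OF less.prems(1)] by linarith
  qed
qed

text \<open>
  The indices at which the map \<open>e j \<mapsto> e j + x *s e i\<close> is triangular and moves the coordinate subspace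
  of \<open>I a\<close>.
\<close>

definition exch_range :: "nat \<Rightarrow> (nat \<Rightarrow> nat set) \<Rightarrow> nat \<Rightarrow> nat \<Rightarrow> nat set" where
  "exch_range n I i j = {a \<in> {1..n}. pos n a i < pos n a j \<and> j \<in> I a \<and> i \<notin> I a}"

definition exch :: "nat \<Rightarrow> (nat \<Rightarrow> nat set) \<Rightarrow> nat \<Rightarrow> nat \<Rightarrow> nat \<Rightarrow> nat set" where
  "exch n I i j = (\<lambda>a\<in>{1..n}. if a \<in> exch_range n I i j then insert i (I a - {j}) else I a)"

lemma list_all2_insort:
  fixes p q :: nat
  shows "sorted xs \<Longrightarrow> p \<le> q \<Longrightarrow> list_all2 (\<le>) (insort p xs) (insort q xs)"
proof (induction xs arbitrary: p q)
  case (Cons x xs)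
  have refl: "list_all2 (\<le>) ys ys" for ys :: "nat list" by (simp add: list_all2_same)
  have "list_all2 (\<le>) (x # xs) (insort q xs)" if "x \<le> q"
  proof -
    have "list_all2 (\<le>) (insort x xs) (insort q xs)" using Cons that by simp
    moreover have "insort x xs = x # xs" using Cons.prems(1) by (simp add: insort_is_Cons)
    ultimately show ?thesis by simp
  qed
  then show ?case using Cons refl by auto
qed auto

lemma subset_le_replace:
  assumes a: "a \<in> {1..n}" and S: "S \<subseteq> {1..n}" and ij: "i \<in> {1..n}" "j \<in> {1..n}"
    and notin: "i \<notin> S" "j \<notin> S" and le: "pos n a i \<le> pos n a j"
  shows "subset_le n a (insert i S) (insert j S)"
proof -
  have fin: "finite (pos n a ` S)" using S finite_subset by blast
  have "pos n a i \<notin> pos n a ` S" "pos n a j \<notin> pos n a ` S"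
    using notin S ij pos_eq_iff[OF a] by (auto simp: subset_iff)
  then show ?thesis
    using list_all2_insort[of "sorted_list_of_set (pos n a ` S)", OF _ le] fin
    by (simp add: subset_le_def)
qed

lemma subset_le_antisym:
  assumes a: "a \<in> {1..n}" and S: "S \<subseteq> {1..n}" "S' \<subseteq> {1..n}"
    and le: "subset_le n a S S'" "subset_le n a S' S"
  shows "S = S'"
proof -
  have "sorted_list_of_set (pos n a ` S) = sorted_list_of_set (pos n a ` S')"
    using le unfolding subset_le_def by (intro list_all2_antisym[of "(\<le>)" "(\<le>)"]) auto
  moreover have "finite (pos n a ` S)" "finite (pos n a ` S')" using S finite_subset by blast+
  ultimately have "pos n a ` S = pos n a ` S'" by (metis set_sorted_list_of_set)
  then show ?thesis using pos_inj[OF a] S by (simp add: inj_on_image_eq_iff)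
qed

lemma subset_le_refl: "subset_le n a S S"
  by (simp add: subset_le_def list_all2_same)

lemma necklace_comp:
  assumes "I \<in> necklaces k n" "a \<in> {1..n}"
  shows "I a \<subseteq> {1..n}" "card (I a) = k" "finite (I a)" "I a \<subseteq> I (nxt n a) \<union> {a}"
proof -
  show "I a \<subseteq> {1..n}" "card (I a) = k" "I a \<subseteq> I (nxt n a) \<union> {a}"
    using assms by (auto simp: necklaces_def PiE_iff)
  then show "finite (I a)" using finite_subset by blast
qed

lemma exch_less:
  assumes I: "I \<in> necklaces k n" and ij: "i \<in> {1..n}" "j \<in> {1..n}"
    and ne: "exch_range n I i j \<noteq> {}"
  shows "necklace_less n (exch n I i j) I"
proof -
  have "subset_le n a (exch n I i j a) (I a)" if a: "a \<in> {1..n}" for a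
  proof (cases "a \<in> exch_range n I i j")
    case True
    then have h: "pos n a i < pos n a j" "j \<in> I a" "i \<notin> I a" by (auto simp: exch_range_def)
    have "subset_le n a (insert i (I a - {j})) (insert j (I a - {j}))"
      using h necklace_comp[OF I a] ij by (intro subset_le_replace[OF a]) auto
    then show ?thesis using True a h by (simp add: exch_def insert_absorb)
  next
    case False
    then show ?thesis using a by (simp add: exch_def subset_le_refl)
  qed
  moreover have "exch n I i j \<noteq> I"
  proof -
    obtain a where a: "a \<in> exch_range n I i j" using ne by auto
    then have "exch n I i j a \<noteq> I a" by (auto simp: exch_def exch_range_def)
    then show ?thesis by auto
  qed
  ultimately show ?thesis by (simp add: necklace_less_def necklace_le_def)
qed

text \<open>
  Order the indices by \<open>pos n a j\<close>. The condition on \<open>j\<close> is closed downwards, the condition on \<open>i\<close> is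
  closed upwards within the arc where \<open>i\<close> precedes \<open>j\<close>, both by persistence; so the range is an
  interval, and its ends are the indices where \<open>pos n a j\<close> is largest and smallest.
\<close>

lemma exch_range_interval:
  assumes I: "I \<in> necklaces k n" and ij: "i \<in> {1..n}" "j \<in> {1..n}"
    and ne: "exch_range n I i j \<noteq> {}"
  obtains a b where "a \<in> {1..n}" "b \<in> {1..n}" "exch_range n I i j = cyc_closed n a a b"
proof -
  let ?A = "exch_range n I i j"
  have sub: "?A \<subseteq> {1..n}" by (auto simp: exch_range_def)
  then have fin: "finite ?A" using finite_subset by blast
  define f where "f z = pos n z j" for z
  obtain a where a: "a \<in> ?A" "\<And>z. z \<in> ?A \<Longrightarrow> f z \<le> f a"
    using Max_in[of "f ` ?A"] Max_ge[of "f ` ?A"] fin ne by fastforce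
  obtain b where b: "b \<in> ?A" "\<And>z. z \<in> ?A \<Longrightarrow> f b \<le> f z"
    using Min_in[of "f ` ?A"] Min_le[of "f ` ?A"] fin ne by fastforce
  have ab: "a \<in> {1..n}" "b \<in> {1..n}" using a b sub by auto
  have "i \<noteq> j" using a(1) by (auto simp: exch_range_def)
  have A_iff: "z \<in> ?A \<longleftrightarrow> f b \<le> f z \<and> f z \<le> f a" if z: "z \<in> {1..n}" for z
  proof
    assume "f b \<le> f z \<and> f z \<le> f a"
    then have z1: "pos n b j \<le> pos n z j" and z2: "pos n z j \<le> pos n a j" by (auto simp: f_def)
    have lt: "pos n b i < pos n b j" "pos n a i < pos n a j" using a(1) b(1)
      by (auto simp: exch_range_def)
    have "pos n z i < pos n z j"
      using z1 lt(1) pos_less_iff[OF ab(2) ij \<open>i \<noteq> j\<close>] pos_less_iff[OF z ij \<open>i \<noteq> j\<close>] by simp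
    moreover have "j \<in> I z"
      using necklace_persist[OF I ij(2) z ab(1)] a(1) z2 by (auto simp: exch_range_def)
    moreover have "i \<notin> I z"
    proof
      assume "i \<in> I z"
      moreover have "pos n b i \<le> pos n z i"
        using z1 lt \<open>pos n z i < pos n z j\<close> pos_add[OF ab(2) ij] pos_add[OF z ij] by simp
      ultimately have "i \<in> I b" using necklace_persist[OF I ij(1) ab(2) z] by simp
      then show False using b(1) by (auto simp: exch_range_def)
    qed
    ultimately show "z \<in> ?A" using z by (simp add: exch_range_def)
  qed (use a b in auto)
  have "f b \<le> f a" using a(1) b(2) by simp
  have f_le: "f z \<le> f a \<longleftrightarrow> pos n a z \<le> pos n a j" if z: "z \<in> {1..n}" for z
  proof (cases "pos n a z \<le> pos n a j")
    case True
    then show ?thesis using pos_add[OF ab(1) z ij(2)] by (simp add: f_def)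
  next
    case False
    then have "z \<noteq> j" "pos n a z = pos n a j + pos n j z"
      using pos_add[OF ab(1) ij(2) z] by auto
    then show ?thesis
      using pos_swap[OF z ij(2)] pos_less[OF ab(1) z] False by (simp add: f_def)
  qed
  have "f b \<le> f z \<and> f z \<le> f a \<longleftrightarrow> pos n a z \<le> pos n a b" if z: "z \<in> {1..n}" for z
    using f_le[OF z] f_le[OF ab(2)] \<open>f b \<le> f a\<close> pos_add[OF ab(1) z ij(2)]
      pos_add[OF ab(1,2) ij(2)] unfolding f_def by linarith
  then have "?A = cyc_closed n a a b"
    using A_iff sub unfolding cyc_closed_def by auto
  with that ab show ?thesis by blast
qed

lemma exch_necklace_move:
  assumes I: "I \<in> necklaces k n" and ij: "i \<in> {1..n}" "j \<in> {1..n}"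
    and ne: "exch_range n I i j \<noteq> {}"
  shows "\<exists>a b. necklace_move n I (exch n I i j) a b j i"
proof -
  obtain a b where ab: "a \<in> {1..n}" "b \<in> {1..n}" and A: "exch_range n I i j = cyc_closed n a a b"
    using exch_range_interval[OF I ij ne] by blast
  have "I h \<noteq> exch n I i j h \<longleftrightarrow> h \<in> exch_range n I i j" if "h \<in> {1..n}" for h
    using that by (auto simp: exch_def exch_range_def)
  moreover have "I h = (exch n I i j h - {i}) \<union> {j}" if "h \<in> exch_range n I i j" for h
    using that by (auto simp: exch_def exch_range_def)
  ultimately have "necklace_move n I (exch n I i j) a b j i"
    using ab ij unfolding necklace_move_def A by blast
  then show ?thesis by blast
qed

text \<open>
  A move prescribes the exchange only on the interval it names. If the exchange were possible at a
  further index, then persistence in \<open>I'\<close> from there to the interval (for \<open>j\<close>) or from the interval to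
  there (for \<open>j'\<close>) would contradict the values of \<open>I'\<close>.
\<close>

lemma necklace_move_exch:
  assumes I: "I \<in> necklaces k n" and I': "I' \<in> necklaces k n"
    and less: "necklace_less n I' I" and move: "necklace_move n I I' a b j j'"
  shows "I' = exch n I j' j" "a \<in> exch_range n I j' j" "j \<in> {1..n}" "j' \<in> {1..n}"
proof -
  let ?A = "exch_range n I j' j" and ?B = "cyc_closed n a a b"
  have a: "a \<in> {1..n}" and jj: "j \<in> {1..n}" "j' \<in> {1..n}"
    and neq: "\<And>h. h \<in> {1..n} \<Longrightarrow> I h \<noteq> I' h \<longleftrightarrow> h \<in> ?B"
    and eq: "\<And>h. h \<in> ?B \<Longrightarrow> I h = (I' h - {j'}) \<union> {j}"
    using move unfolding necklace_move_def by blast+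
  have B: "h \<in> ?A \<and> j' \<in> I' h \<and> j \<notin> I' h \<and> I' h = insert j' (I h - {j})" if h: "h \<in> ?B" for h
  proof -
    have hn: "h \<in> {1..n}" using h by (simp add: cyc_closed_def)
    note c = necklace_comp[OF I hn] and c' = necklace_comp[OF I' hn]
    have ne: "I h \<noteq> I' h" using neq hn h by blast
    have e: "I h = (I' h - {j'}) \<union> {j}" using eq h .
    have j': "j' \<in> I' h"
    proof (rule ccontr)
      assume "j' \<notin> I' h"
      then have "I' h \<subseteq> I h" using e by auto
      then show False using ne c c' card_subset_eq[of "I h" "I' h"] by simp
    qed
    have j: "j \<notin> I' h"
    proof
      assume "j \<in> I' h"
      then have "I h \<subseteq> I' h" using e by auto
      then show False using ne c c' card_subset_eq[of "I' h" "I h"] by simp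
    qed
    have "j \<noteq> j'" using j j' by auto
    have "subset_le n h (I' h) (I h)" using less hn by (simp add: necklace_less_def necklace_le_def)
    moreover have "subset_le n h (I h) (I' h)" if "pos n h j \<le> pos n h j'"
      using subset_le_replace[OF hn, of "I' h - {j'}" j j'] that j j' e c' jj
      by (auto simp: insert_absorb)
    ultimately have "pos n h j' < pos n h j"
      using ne subset_le_antisym[OF hn c(1) c'(1)] by (meson not_le)
    then have "h \<in> ?A" using hn e \<open>j \<noteq> j'\<close> by (auto simp: exch_range_def)
    then show ?thesis using j j' e \<open>j \<noteq> j'\<close> by auto
  qed
  have aB: "a \<in> ?B" using a by (simp add: cyc_closed_def)
  have A: "h \<in> ?B" if h: "h \<in> ?A" for h
  proof (rule ccontr)
    assume nB: "h \<notin> ?B"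
    have hn: "h \<in> {1..n}" "pos n h j' < pos n h j" "j \<in> I h" "j' \<notin> I h"
      using h by (auto simp: exch_range_def)
    then have I'h: "j \<in> I' h" "j' \<notin> I' h" using neq nB by auto
    have aA: "pos n a j' < pos n a j" using B[OF aB] by (simp add: exch_range_def)
    then have "j \<noteq> j'" by auto
    show False
    proof (cases "pos n a j \<le> pos n h j")
      case True
      then show False using necklace_persist[OF I' jj(1) a hn(1) I'h(1)] B[OF aB] by blast
    next
      case False
      then have "pos n h j' \<le> pos n a j'"
        using pos_add[OF a jj(2,1)] pos_add[OF hn(1) jj(2,1)] aA hn(2) by simp
      then show False using necklace_persist[OF I' jj(2) hn(1) a] B[OF aB] I'h(2) by blast
    qed
  qed
  show "I' = exch n I j' j"
  proof
    fix h
    show "I' h = exch n I j' j h"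
    proof (cases "h \<in> {1..n}")
      case True
      then show ?thesis using A B neq by (auto simp: exch_def)
    next
      case False
      then show ?thesis using I' by (auto simp: exch_def necklaces_def PiE_iff extensional_def)
    qed
  qed
  show "a \<in> ?A" "j \<in> {1..n}" "j' \<in> {1..n}" using B aB jj by auto
qed


section \<open>Coordinates, echelon forms and leading indices\<close>

text \<open>
  This keeps the index set in the form \<open>{1..n}\<close> during simplification.
\<close>

declare One_nat_def [simp del]

locale based_space =
  fixes n :: nat and e :: "nat \<Rightarrow> complex ^ 'n"
  assumes basis: "is_basis n e"
begin

definition coord :: "complex ^ 'n \<Rightarrow> nat \<Rightarrow> complex" where
  "coord v j = vec.representation (e ` {1..n}) v (e j)"

lemma inj_e: "inj_on e {1..n}" and indep_e: "vec.independent (e ` {1..n})"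
  and span_e_UNIV: "vec.span (e ` {1..n}) = UNIV"
  using basis by (auto simp: is_basis_def)

lemma coord_add [simp]: "coord (v + w) j = coord v j + coord w j"
  by (simp add: coord_def vec.representation_add[OF indep_e] span_e_UNIV)

lemma coord_scale [simp]: "coord (c *s v) j = c * coord v j"
  by (simp add: coord_def vec.representation_scale[OF indep_e] span_e_UNIV)

lemma coord_diff [simp]: "coord (v - w) j = coord v j - coord w j"
  by (simp add: coord_def vec.representation_diff[OF indep_e] span_e_UNIV)

lemma coord_0 [simp]: "coord 0 j = 0"
  by (simp add: coord_def vec.representation_zero)

lemma coord_sum: "coord (sum f S) j = (\<Sum>i\<in>S. coord (f i) j)"
  by (simp add: coord_def vec.representation_sum[OF indep_e] span_e_UNIV)

lemma coord_e [simp]: "i \<in> {1..n} \<Longrightarrow> j \<in> {1..n} \<Longrightarrow> coord (e i) j = (if i = j then 1 else 0)"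
  using inj_e by (simp add: coord_def vec.representation_basis[OF indep_e] inj_on_eq_iff del: atLeastAtMost_iff)

lemma expand_e: "(\<Sum>j\<in>{1..n}. coord v j *s e j) = v"
  using vec.sum_representation_eq[OF indep_e, of v "e ` {1..n}"]
  by (simp add: span_e_UNIV sum.reindex[OF inj_e] coord_def)

lemma coord_eqI: "(\<And>j. j \<in> {1..n} \<Longrightarrow> coord v j = coord w j) \<Longrightarrow> v = w"
  using expand_e[of v] expand_e[of w] by (metis (no_types, lifting) sum.cong)

lemma coord_lincomb: "coord (\<Sum>i\<in>S. c i *s f i) j = (\<Sum>i\<in>S. c i * coord (f i) j)"
  by (simp add: coord_sum)

lemma coord_sum_e:
  assumes "S \<subseteq> {1..n}" "j \<in> {1..n}"
  shows "coord (\<Sum>i\<in>S. c i *s e i) j = (if j \<in> S then c j else 0)"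
proof -
  have "finite S" using assms finite_subset by blast
  have "coord (\<Sum>i\<in>S. c i *s e i) j = (\<Sum>i\<in>S. if i = j then c i else 0)"
    unfolding coord_lincomb using assms by (intro sum.cong) auto
  then show ?thesis using \<open>finite S\<close> by simp
qed

lemma coord_diag [simp]: "j \<in> {1..n} \<Longrightarrow> coord (diag n e c v) j = c j * coord v j"
  unfolding diag_def coord_def[symmetric] by (subst coord_sum_e) auto

lemma coord_pr [simp]: "j \<in> {1..n} \<Longrightarrow> coord (pr n e i v) j = (if j = i then 0 else coord v j)"
  by (simp add: pr_def)

lemma linearI:
  assumes "\<And>v w j. j \<in> {1..n} \<Longrightarrow> coord (f (v + w)) j = coord (f v) j + coord (f w) j"
    and "\<And>c v j. j \<in> {1..n} \<Longrightarrow> coord (f (c *s v)) j = c * coord (f v) j"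
  shows "Vector_Spaces.linear (*s) (*s) f"
  by unfold_locales (auto intro!: coord_eqI simp: assms vec.scale_right_distrib vec.scale_left_distrib simp del: atLeastAtMost_iff)

lemma linear_diag: "Vector_Spaces.linear (*s) (*s) (diag n e c)"
  by (rule linearI) (simp_all add: algebra_simps)

lemma linear_pr: "Vector_Spaces.linear (*s) (*s) (pr n e i)"
  unfolding pr_def by (rule linear_diag)

lemma independent_family:
  fixes f :: "nat \<Rightarrow> complex ^ 'n"
  assumes fin: "finite S" and ind: "\<And>c. (\<Sum>j\<in>S. c j *s f j) = 0 \<Longrightarrow> \<forall>j\<in>S. c j = 0"
  shows "inj_on f S" "vec.independent (f ` S)"
proof -
  show inj: "inj_on f S"
  proof (rule inj_onI, rule ccontr)
    fix i j assume ij: "i \<in> S" "j \<in> S" "f i = f j" "i \<noteq> j"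
    let ?c = "\<lambda>l. if l = i then 1 else if l = j then - 1 else (0::complex)"
    have "(\<Sum>l\<in>S. ?c l *s f l) = (\<Sum>l\<in>{i,j}. ?c l *s f l)"
      using ij fin by (intro sum.mono_neutral_right) auto
    also have "\<dots> = 0" using ij by simp
    finally have "\<forall>l\<in>S. ?c l = 0" by (rule ind)
    then have "?c i = 0" using ij(1) by (rule bspec)
    then show False by simp
  qed
  show "vec.independent (f ` S)"
  proof
    assume "vec.dependent (f ` S)"
    then obtain u where u: "\<exists>v\<in>f ` S. u v \<noteq> 0" "(\<Sum>v\<in>f ` S. u v *s v) = 0"
      using vec.dependent_finite[of "f ` S"] fin by auto
    have "(\<Sum>j\<in>S. u (f j) *s f j) = 0" using u(2) by (simp add: sum.reindex[OF inj])
    then have "\<forall>j\<in>S. u (f j) = 0" by (rule ind)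
    then show False using u(1) by auto
  qed
qed

lemma dual_lincomb:
  assumes fin: "finite S" and m: "m \<in> S"
    and dual: "\<And>i j. i \<in> S \<Longrightarrow> j \<in> S \<Longrightarrow> coord (f i) j = (if i = j then 1 else 0)"
  shows "coord (\<Sum>j\<in>S. c j *s f j) m = c m"
proof -
  have "coord (\<Sum>j\<in>S. c j *s f j) m = (\<Sum>j\<in>S. if j = m then c j else 0)"
    unfolding coord_lincomb using m dual by (intro sum.cong) auto
  then show ?thesis using m fin by simp
qed

lemma dual_family:
  assumes fin: "finite S"
    and dual: "\<And>i j. i \<in> S \<Longrightarrow> j \<in> S \<Longrightarrow> coord (f i) j = (if i = j then 1 else 0)"
  shows "inj_on f S" "vec.independent (f ` S)" "vec.span (f ` S) \<in> Gr (card S)"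
proof -
  have ind: "\<forall>j\<in>S. c j = 0" if "(\<Sum>j\<in>S. c j *s f j) = 0" for c
    using dual_lincomb[OF fin _ dual, of _ c] that by (metis coord_0)
  show i: "inj_on f S" "vec.independent (f ` S)"
    using independent_family[OF fin ind] by blast+
  then show "vec.span (f ` S) \<in> Gr (card S)"
    by (simp add: Gr_def vec.subspace_span vec.dim_eq_card_independent card_image)
qed

lemma Gr_eqI: "U \<subseteq> U' \<Longrightarrow> U \<in> Gr k \<Longrightarrow> U' \<in> Gr k \<Longrightarrow> U = U'"
  by (simp add: Gr_def vec.subspace_dim_equal)

lemma span_family:
  fixes f :: "nat \<Rightarrow> complex ^ 'n"
  assumes "finite S" "v \<in> vec.span (f ` S)"
  obtains c where "v = (\<Sum>j\<in>S. c j *s f j)"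
proof -
  have "\<exists>c. v = (\<Sum>j\<in>S. c j *s f j)"
    using assms(2)
  proof (induction rule: vec.span_induct_alt)
    case base
    show ?case by (rule exI[of _ "\<lambda>_. 0"]) simp
  next
    case (step c x y)
    then obtain d i where d: "y = (\<Sum>j\<in>S. d j *s f j)" "i \<in> S" "x = f i" by auto
    have "(\<Sum>j\<in>S. (d j + (if j = i then c else 0)) *s f j)
        = (\<Sum>j\<in>S. d j *s f j + (if j = i then c *s f j else 0))"
      by (intro sum.cong) (auto simp: vec.scale_left_distrib)
    also have "\<dots> = y + c *s x" using d assms(1) by (simp add: sum.distrib)
    finally show ?case by (metis add.commute)
  qed
  with that show thesis by blast
qed

lemma lincomb_in_subspace:
  assumes "vec.subspace U" "\<And>j. j \<in> S \<Longrightarrow> f j \<in> U"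
  shows "(\<Sum>j\<in>S. c j *s f j) \<in> U"
  using assms by (intro vec.subspace_sum vec.subspace_scale)

lemma in_span_e:
  assumes "S \<subseteq> {1..n}" "\<And>j. j \<in> {1..n} \<Longrightarrow> j \<notin> S \<Longrightarrow> coord v j = 0"
  shows "v \<in> vec.span (e ` S)"
proof -
  have "v = (\<Sum>j\<in>S. coord v j *s e j)"
    using assms by (intro coord_eqI) (auto simp: coord_sum_e simp del: atLeastAtMost_iff)
  then show ?thesis
    using lincomb_in_subspace[OF vec.subspace_span, of S e "e ` S" "coord v"]
    by (simp add: vec.span_base)
qed

lemma span_e_Gr:
  assumes "S \<subseteq> {1..n}"
  shows "vec.span (e ` S) \<in> Gr (card S)"
  using assms finite_subset[OF assms] by (intro dual_family(3) coord_e) auto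

text \<open>
  The pivots of the echelon form of \<open>U\<close> with respect to \<open>\<le>\<^sub>a\<close>, where the pivot of a vector is the last
  index at which it has a non-zero coordinate.
\<close>

definition leads :: "nat \<Rightarrow> (complex ^ 'n) set \<Rightarrow> nat set" where
  "leads a U = {j \<in> {1..n}. \<exists>v\<in>U. coord v j \<noteq> 0 \<and>
     (\<forall>m\<in>{1..n}. pos n a j < pos n a m \<longrightarrow> coord v m = 0)}"

lemma leads_sub: "leads a U \<subseteq> {1..n}" and finite_leads [simp]: "finite (leads a U)"
  by (auto simp: leads_def)

lemma lead_exists:
  assumes "v \<noteq> 0"
  obtains j where "j \<in> {1..n}" "coord v j \<noteq> 0"
    "\<And>m. m \<in> {1..n} \<Longrightarrow> pos n a j < pos n a m \<Longrightarrow> coord v m = 0"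
proof -
  let ?S = "{j \<in> {1..n}. coord v j \<noteq> 0}"
  have fin: "finite (pos n a ` ?S)" by simp
  have "?S \<noteq> {}" using assms coord_eqI[of v 0] by force
  then have "Max (pos n a ` ?S) \<in> pos n a ` ?S" by (intro Max_in[OF fin]) blast
  then obtain j where "Max (pos n a ` ?S) = pos n a j" and j: "j \<in> ?S" by (rule imageE)
  then have j: "j \<in> ?S" "pos n a j = Max (pos n a ` ?S)" by simp_all
  have "coord v m = 0" if "m \<in> {1..n}" "pos n a j < pos n a m" for m
  proof (rule ccontr)
    assume "coord v m \<noteq> 0"
    then have "pos n a m \<le> Max (pos n a ` ?S)" using that by (intro Max_ge) auto
    then show False using that(2) j(2) by linarith
  qed
  moreover have "j \<in> {1..n}" "coord v j \<noteq> 0" using j(1) by blast+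
  ultimately show thesis using that by blast
qed

lemma leads_inj:
  assumes "v \<in> U" "\<And>m. m \<in> leads a U \<Longrightarrow> coord v m = 0"
  shows "v = 0"
proof (rule ccontr)
  assume "v \<noteq> 0"
  then obtain j where "j \<in> {1..n}" "coord v j \<noteq> 0"
    "\<And>m. m \<in> {1..n} \<Longrightarrow> pos n a j < pos n a m \<Longrightarrow> coord v m = 0"
    using lead_exists[of v a] by blast
  then have "j \<in> leads a U" using assms(1) by (auto simp: leads_def)
  then show False using assms(2) \<open>coord v j \<noteq> 0\<close> by blast
qed

text \<open>
  Gaussian elimination: the prescribed values are reached pivot by pivot, from the last one down, since
  a vector with pivot \<open>j\<close> does not change the coordinates beyond \<open>j\<close>.
\<close>

lemma leads_interpolate:
  assumes U: "vec.subspace U" and a: "a \<in> {1..n}"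
  shows "\<exists>v\<in>U. \<forall>m\<in>leads a U. coord v m = c m"
proof -
  have "\<exists>v\<in>U. \<forall>m\<in>leads a U. n \<le> pos n a m + t \<longrightarrow> coord v m = c m" for t
  proof (induction t)
    case 0
    have "pos n a m < n" if "m \<in> leads a U" for m using that leads_sub pos_less[OF a] by blast
    then show ?case using vec.subspace_0[OF U] by (intro bexI[of _ 0]) fastforce+
  next
    case (Suc t)
    then obtain v where v: "v \<in> U" "\<And>m. m \<in> leads a U \<Longrightarrow> n \<le> pos n a m + t \<Longrightarrow> coord v m = c m"
      by blast
    show ?case
    proof (cases "\<exists>j\<in>leads a U. n = pos n a j + Suc t")
      case False
      then have "n \<le> pos n a m + t" if "m \<in> leads a U" "n \<le> pos n a m + Suc t" for m
        using that by (metis add_Suc_right le_SucE)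
      then show ?thesis using v by blast
    next
      case True
      then obtain j where j: "j \<in> leads a U" "n = pos n a j + Suc t" by blast
      then obtain w where w: "w \<in> U" "coord w j \<noteq> 0"
        "\<And>m. m \<in> {1..n} \<Longrightarrow> pos n a j < pos n a m \<Longrightarrow> coord w m = 0"
        by (auto simp: leads_def simp del: atLeastAtMost_iff)
      let ?v = "v + ((c j - coord v j) / coord w j) *s w"
      have "?v \<in> U" using v(1) w(1) U by (simp add: vec.subspace_add vec.subspace_scale)
      moreover have "coord ?v m = c m" if m: "m \<in> leads a U" "n \<le> pos n a m + Suc t" for m
      proof (cases "m = j")
        case True
        then show ?thesis using w(2) by simp
      next
        case False
        have mj: "m \<in> {1..n}" "j \<in> {1..n}" using m j leads_sub by blast+
        then have "pos n a m \<noteq> pos n a j" using False pos_eq_iff[OF a] by blast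
        then show ?thesis using w(3) v(2)[of m] m j(2) mj by simp
      qed
      ultimately show ?thesis by blast
    qed
  qed
  from this[of n] show ?thesis by simp
qed

text \<open>
  The row with pivot \<open>j\<close> of the reduced echelon form.
\<close>

definition rvec :: "nat \<Rightarrow> (complex ^ 'n) set \<Rightarrow> nat \<Rightarrow> complex ^ 'n" where
  "rvec a U j = (SOME v. v \<in> U \<and> (\<forall>m\<in>leads a U. coord v m = (if j = m then 1 else 0)))"

lemma
  assumes "vec.subspace U" "a \<in> {1..n}"
  shows rvec_in: "rvec a U j \<in> U"
    and rvec_dual: "\<And>m. m \<in> leads a U \<Longrightarrow> coord (rvec a U j) m = (if j = m then 1 else 0)"
  using someI_ex[OF leads_interpolate[OF assms, of "\<lambda>m. if j = m then 1 else 0", unfolded Bex_def]]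
  unfolding rvec_def by blast+

text \<open>
  The last non-zero coordinate of this vector is itself a pivot, and \<open>j\<close> is the only pivot at which it
  does not vanish.
\<close>

lemma rvec_lead:
  assumes U: "vec.subspace U" "a \<in> {1..n}" and j: "j \<in> leads a U"
    and m: "m \<in> {1..n}" "pos n a j < pos n a m"
  shows "coord (rvec a U j) m = 0"
proof -
  have "rvec a U j \<noteq> 0" using rvec_dual[OF U j, of j] by auto
  then obtain l where l: "l \<in> {1..n}" "coord (rvec a U j) l \<noteq> 0"
    "\<And>m. m \<in> {1..n} \<Longrightarrow> pos n a l < pos n a m \<Longrightarrow> coord (rvec a U j) m = 0"
    using lead_exists[of _ a] by blast
  then have "l \<in> leads a U" using rvec_in[OF U] by (auto simp: leads_def)
  then have "l = j" using rvec_dual[OF U] l(2) by (metis (full_types))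
  then show ?thesis using l(3) m by blast
qed

lemma rvec_unique:
  assumes U: "vec.subspace U" "a \<in> {1..n}" and v: "v \<in> U"
    "\<And>m. m \<in> leads a U \<Longrightarrow> coord v m = (if j = m then 1 else 0)"
  shows "rvec a U j = v"
proof -
  have "rvec a U j - v \<in> U" using rvec_in[OF U] v(1) U(1) by (simp add: vec.subspace_diff)
  then have "rvec a U j - v = 0"
    using rvec_dual[OF U] v(2) by (intro leads_inj[of _ U a]) auto
  then show ?thesis by simp
qed

lemma span_rvec:
  assumes U: "vec.subspace U" "a \<in> {1..n}"
  shows "vec.span (rvec a U ` leads a U) = U"
proof
  show "vec.span (rvec a U ` leads a U) \<subseteq> U"
    using rvec_in[OF U] U(1) by (intro vec.span_minimal) auto
  show "U \<subseteq> vec.span (rvec a U ` leads a U)"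
  proof
    fix v assume v: "v \<in> U"
    let ?w = "\<Sum>j\<in>leads a U. coord v j *s rvec a U j"
    have "v - ?w \<in> U"
      using v U(1) rvec_in[OF U] by (intro vec.subspace_diff lincomb_in_subspace) auto
    then have "v - ?w = 0"
      using dual_lincomb[OF finite_leads _ rvec_dual[OF U]] by (intro leads_inj[of _ U a]) auto
    then have "v = ?w" by simp
    moreover have "?w \<in> vec.span (rvec a U ` leads a U)"
      by (intro lincomb_in_subspace vec.subspace_span) (auto intro: vec.span_base)
    ultimately show "v \<in> vec.span (rvec a U ` leads a U)" by simp
  qed
qed

lemma card_leads:
  assumes "U \<in> Gr k" "a \<in> {1..n}"
  shows "card (leads a U) = k"
proof -
  have U: "vec.subspace U" "vec.dim U = k" using assms by (auto simp: Gr_def)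
  have "vec.span (rvec a U ` leads a U) \<in> Gr (card (leads a U))"
    using rvec_dual[OF U(1) assms(2)] by (intro dual_family(3)) auto
  then show ?thesis using U span_rvec[OF U(1) assms(2)] by (simp add: Gr_def)
qed

lemma leads_eqI:
  assumes "U \<in> Gr k" "a \<in> {1..n}" "card S = k" "S \<subseteq> leads a U"
  shows "leads a U = S"
  using card_subset_eq[of "leads a U" S] card_leads[OF assms(1,2)] assms by simp

lemma in_leadsI:
  assumes "j \<in> {1..n}" "v \<in> U" "coord v j \<noteq> 0"
    "\<And>m. m \<in> {1..n} \<Longrightarrow> pos n a j < pos n a m \<Longrightarrow> coord v m = 0"
  shows "j \<in> leads a U"
  using assms by (auto simp: leads_def)

subsection \<open>Diagonal maps\<close>

definition nonzero :: "(nat \<Rightarrow> complex) \<Rightarrow> bool" where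
  "nonzero w \<longleftrightarrow> (\<forall>j\<in>{1..n}. w j \<noteq> 0)"

lemma diag_cong: "(\<And>j. j \<in> {1..n} \<Longrightarrow> w j = w' j) \<Longrightarrow> diag n e w = diag n e w'"
  unfolding diag_def by (intro ext sum.cong) auto

lemma diag_diag: "diag n e w (diag n e w' v) = diag n e (\<lambda>j. w j * w' j) v"
  by (rule coord_eqI) simp

lemma diag_one: "(\<And>j. j \<in> {1..n} \<Longrightarrow> w j = 1) \<Longrightarrow> diag n e w v = v"
  by (rule coord_eqI) simp

lemma diag_inverse: "nonzero w \<Longrightarrow> diag n e (\<lambda>j. inverse (w j)) (diag n e w v) = v"
  unfolding diag_diag nonzero_def by (rule diag_one) auto

lemma inj_diag: "nonzero w \<Longrightarrow> inj (diag n e w)"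
  by (metis diag_inverse injI)

lemma Gr_image:
  assumes f: "Vector_Spaces.linear (*s) (*s) f" "inj f" and U: "U \<in> Gr k"
  shows "f ` U \<in> Gr k"
proof -
  have "vec.subspace (f ` U)" using U vec.linear_subspace_image[OF f(1)] by (simp add: Gr_def)
  moreover have "vec.dim (f ` U) = vec.dim U"
    using inj_on_subset[OF f(2) subset_UNIV] by (intro vec.dim_image_eq[OF f(1)]) auto
  ultimately show ?thesis using U by (simp add: Gr_def)
qed

lemma diag_Gr: "nonzero w \<Longrightarrow> U \<in> Gr k \<Longrightarrow> diag n e w ` U \<in> Gr k"
  by (intro Gr_image linear_diag inj_diag)

lemma leads_diag:
  assumes w: "nonzero w"
  shows "leads a (diag n e w ` U) = leads a U"
proof -
  have sub: "leads a U' \<subseteq> leads a (diag n e w' ` U')" if w': "nonzero w'" for w' U'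
    using w' unfolding leads_def nonzero_def by fastforce
  have "diag n e (\<lambda>j. inverse (w j)) ` diag n e w ` U = U"
    using diag_inverse[OF w] by (simp add: image_image)
  moreover have "nonzero (\<lambda>j. inverse (w j))" using w by (simp add: nonzero_def)
  ultimately show ?thesis using sub[of w U] sub[of "\<lambda>j. inverse (w j)" "diag n e w ` U"] w by auto
qed

lemma rvec_diag:
  assumes w: "nonzero w" and U: "vec.subspace U" "a \<in> {1..n}" and j: "j \<in> leads a U"
  shows "rvec a (diag n e w ` U) j = inverse (w j) *s diag n e w (rvec a U j)"
proof (rule rvec_unique)
  show sub: "vec.subspace (diag n e w ` U)" using U(1) vec.linear_subspace_image[OF linear_diag] by blast
  show "inverse (w j) *s diag n e w (rvec a U j) \<in> diag n e w ` U"
    using rvec_in[OF U] sub by (intro vec.subspace_scale) auto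
  fix m assume "m \<in> leads a (diag n e w ` U)"
  then have m: "m \<in> leads a U" "m \<in> {1..n}" using leads_diag[OF w] leads_sub by blast+
  have "w j \<noteq> 0" using w j leads_sub by (auto simp: nonzero_def)
  then show "coord (inverse (w j) *s diag n e w (rvec a U j)) m = (if j = m then 1 else 0)"
    using m rvec_dual[OF U m(1)] by auto
qed (rule U)

text \<open>
  By uniqueness of reduced echelon forms a diagonal map acts on the entries: the entry in row \<open>j\<close> and
  column \<open>m\<close> is multiplied by \<open>w m / w j\<close>.
\<close>

lemma diag_fixes_iff:
  assumes w: "nonzero w" and U: "vec.subspace U" "a \<in> {1..n}"
  shows "diag n e w ` U = U \<longleftrightarrow>
    (\<forall>j\<in>leads a U. \<forall>m\<in>{1..n}. coord (rvec a U j) m \<noteq> 0 \<longrightarrow> w m = w j)"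
proof
  assume eq: "diag n e w ` U = U"
  show "\<forall>j\<in>leads a U. \<forall>m\<in>{1..n}. coord (rvec a U j) m \<noteq> 0 \<longrightarrow> w m = w j"
  proof (intro ballI impI)
    fix j m assume j: "j \<in> leads a U" and m: "m \<in> {1..n}" "coord (rvec a U j) m \<noteq> 0"
    have "w j \<noteq> 0" using w j leads_sub by (auto simp: nonzero_def)
    moreover have "coord (rvec a U j) m = inverse (w j) * (w m * coord (rvec a U j) m)"
      using rvec_diag[OF w U j] m(1) unfolding eq by (metis coord_diag coord_scale)
    ultimately show "w m = w j" using m(2) by (simp add: field_simps)
  qed
next
  assume h: "\<forall>j\<in>leads a U. \<forall>m\<in>{1..n}. coord (rvec a U j) m \<noteq> 0 \<longrightarrow> w m = w j"
  have "rvec a (diag n e w ` U) j = rvec a U j" if j: "j \<in> leads a U" for j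
  proof -
    have wj: "w j \<noteq> 0" using w j leads_sub by (auto simp: nonzero_def)
    show ?thesis unfolding rvec_diag[OF w U j]
    proof (rule coord_eqI)
      fix m assume m: "m \<in> {1..n}"
      show "coord (inverse (w j) *s diag n e w (rvec a U j)) m = coord (rvec a U j) m"
        using h j m wj by (cases "coord (rvec a U j) m = 0") auto
    qed
  qed
  then have "rvec a (diag n e w ` U) ` leads a (diag n e w ` U) = rvec a U ` leads a U"
    using leads_diag[OF w] by (intro image_cong) auto
  moreover have "vec.subspace (diag n e w ` U)"
    using U(1) vec.linear_subspace_image[OF linear_diag] by blast
  ultimately show "diag n e w ` U = U" using span_rvec U by metis
qed

end


section \<open>The topology of Grassmannians\<close>

context based_space begin

lemma tendsto_scale_vec:
  fixes v :: "complex ^ 'n"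
  assumes "(c \<longlongrightarrow> l) F"
  shows "((\<lambda>x. c x *s v) \<longlongrightarrow> l *s v) F"
  by (rule vec_tendstoI) (simp add: tendsto_mult_right assms)

lemma tendsto_coI:
  assumes "\<And>j. j \<in> {1..n} \<Longrightarrow> ((\<lambda>x. coord (f x) j) \<longlongrightarrow> coord l j) F"
  shows "(f \<longlongrightarrow> l) F"
proof -
  have "((\<lambda>x. \<Sum>j\<in>{1..n}. coord (f x) j *s e j) \<longlongrightarrow> (\<Sum>j\<in>{1..n}. coord l j *s e j)) F"
    using assms by (intro tendsto_sum tendsto_scale_vec) blast
  then show ?thesis by (simp only: expand_e)
qed

lemma continuous_coord [continuous_intros]: "continuous_on S (\<lambda>v. coord v j)"
proof -
  have "linear (\<lambda>v. coord v j)"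
  proof (rule Real_Vector_Spaces.linearI)
    fix r v
    have "r *\<^sub>R v = complex_of_real r *s v" for v :: "complex ^ 'n"
      by (simp add: vec_eq_iff scaleR_conv_of_real[where 'a = complex])
    then show "coord (r *\<^sub>R v) j = r *\<^sub>R coord v j" by (simp add: scaleR_conv_of_real)
  qed simp
  then show ?thesis
    by (simp add: linear_continuous_on linear_conv_bounded_linear)
qed

definition hits :: "nat \<Rightarrow> (complex ^ 'n) set \<Rightarrow> (complex ^ 'n) set set" where
  "hits k B = {V \<in> Gr k. V \<inter> B \<noteq> {}}"

text \<open>
  In terms of frames \<open>f\<close>, the span meets \<open>B\<close> iff some linear combination of \<open>f\<close> lies in \<open>B\<close>, and for
  fixed coefficients this is an open condition.
\<close>

lemma openin_hits:
  assumes "open B"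
  shows "openin (Gr_top k) (hits k B)"
proof -
  let ?X = "subtopology (product_topology (\<lambda>_. euclidean) {..<k})
              (frames k :: (nat \<Rightarrow> complex ^ 'n) set)"
  let ?f = "\<lambda>f. vec.span (f ` {..<k}) :: (complex ^ 'n) set"
  have im: "?f ` topspace ?X = Gr k"
    using quotient_imp_surjective_map[OF quotient_map_quotient_topology[of ?X ?f]] topspace_Gr_top
    by (simp add: Gr_top_def)
  have "{f \<in> topspace ?X. ?f f \<in> hits k B}
      = (\<Union>c. {f \<in> topspace ?X. (\<Sum>i<k. c i *s f i) \<in> B})"
  proof (intro equalityI subsetI)
    fix f assume "f \<in> {f \<in> topspace ?X. ?f f \<in> hits k B}"
    then obtain v where v: "f \<in> topspace ?X" "v \<in> ?f f" "v \<in> B" by (auto simp: hits_def)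
    then obtain c where "v = (\<Sum>i<k. c i *s f i)" using span_family[of "{..<k}" v f] by blast
    with v show "f \<in> (\<Union>c. {f \<in> topspace ?X. (\<Sum>i<k. c i *s f i) \<in> B})" by blast
  next
    fix f assume "f \<in> (\<Union>c. {f \<in> topspace ?X. (\<Sum>i<k. c i *s f i) \<in> B})"
    then obtain c where c: "f \<in> topspace ?X" "(\<Sum>i<k. c i *s f i) \<in> B" by blast
    have "(\<Sum>i<k. c i *s f i) \<in> ?f f"
      by (rule lincomb_in_subspace) (auto intro: vec.span_base)
    moreover have "?f f \<in> Gr k" using im c(1) by blast
    ultimately show "f \<in> {f \<in> topspace ?X. ?f f \<in> hits k B}" using c by (auto simp: hits_def)
  qed
  moreover have "openin ?X (\<Union>c. {f \<in> topspace ?X. (\<Sum>i<k. c i *s f i) \<in> B})"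
  proof (rule openin_Union, clarify)
    fix c :: "nat \<Rightarrow> complex"
    have "continuous_map ?X euclidean (\<lambda>f. c i *s f i)" if "i < k" for i
    proof -
      have "continuous_map ?X euclidean (\<lambda>f. f i)"
        using that by (intro continuous_map_from_subtopology continuous_map_product_projection) (simp only: lessThan_iff)
      then have "limitin euclidean (\<lambda>f. f i) (x i) (atin ?X x)" if "x \<in> topspace ?X" for x
        using that unfolding continuous_map_atin by blast
      then have lim: "((\<lambda>f. f i) \<longlongrightarrow> x i) (atin ?X x)" if "x \<in> topspace ?X" for x
        using that by (simp only: limitin_canonical_iff)
      have "((\<lambda>f. c i *s f i) \<longlongrightarrow> c i *s x i) (atin ?X x)" if "x \<in> topspace ?X" for x
      proof (rule vec_tendstoI)
        fix j
        show "((\<lambda>f. (c i *s f i) $ j) \<longlongrightarrow> (c i *s x i) $ j) (atin ?X x)"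
          unfolding vector_smult_component
          by (intro tendsto_mult tendsto_const tendsto_vec_nth lim that)
      qed
      then show ?thesis unfolding continuous_map_atin limitin_canonical_iff by blast
    qed
    then have "continuous_map ?X euclidean (\<lambda>f. \<Sum>i<k. c i *s f i)"
      by (intro continuous_map_sum) simp_all
    from openin_continuous_map_preimage[OF this, of B] assms
    show "openin ?X {f \<in> topspace ?X. (\<Sum>i<k. c i *s f i) \<in> B}"
      by (simp only: open_openin[symmetric])
  qed
  moreover have "hits k B \<subseteq> ?f ` topspace ?X" unfolding im by (auto simp: hits_def)
  ultimately show ?thesis unfolding Gr_top_def openin_quotient_topology by simp
qed

text \<open>
  Families that are normalised on the coordinates in \<open>S\<close> are automatically independent, so they are
  frames and the quotient map carries their convergence to the Grassmannian.
\<close>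

lemma Gr_limit:
  fixes f :: "'b \<Rightarrow> nat \<Rightarrow> complex ^ 'n"
  assumes S: "finite S"
    and dual: "eventually (\<lambda>x. \<forall>i\<in>S. \<forall>j\<in>S. coord (f x i) j = (if i = j then 1 else 0)) F"
    and dual': "\<And>i j. i \<in> S \<Longrightarrow> j \<in> S \<Longrightarrow> coord (g i) j = (if i = j then 1 else 0)"
    and lim: "\<And>i. i \<in> S \<Longrightarrow> ((\<lambda>x. f x i) \<longlongrightarrow> g i) F"
  shows "limitin (Gr_top (card S)) (\<lambda>x. vec.span (f x ` S)) (vec.span (g ` S)) F"
proof -
  let ?k = "card S"
  let ?P = "product_topology (\<lambda>_. euclidean) {..<?k} :: (nat \<Rightarrow> complex ^ 'n) topology"
  let ?X = "subtopology ?P (frames ?k)"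
  let ?sp = "\<lambda>h. vec.span (h ` {..<?k}) :: (complex ^ 'n) set"
  obtain s where s: "bij_betw s {..<?k} S"
    using ex_bij_betw_nat_finite[OF S] by (auto simp: atLeast0LessThan)
  define \<Phi> where "\<Phi> h = (\<lambda>i\<in>{..<?k}. h (s i))" for h :: "nat \<Rightarrow> complex ^ 'n"
  have im: "\<Phi> h ` {..<?k} = h ` S" for h
  proof -
    have "\<Phi> h ` {..<?k} = h ` (s ` {..<?k})" unfolding image_image \<Phi>_def by (intro image_cong) auto
    then show ?thesis using s by (simp add: bij_betw_def)
  qed
  have frame: "\<Phi> h \<in> frames ?k"
    if "\<And>i j. i \<in> S \<Longrightarrow> j \<in> S \<Longrightarrow> coord (h i) j = (if i = j then 1 else 0)" for h
  proof -
    have "inj_on h S" "vec.independent (h ` S)" using dual_family[OF S that] by auto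
    moreover have "inj_on (\<Phi> h) {..<?k}"
    proof (rule inj_onI)
      fix x y assume "x \<in> {..<?k}" "y \<in> {..<?k}" "\<Phi> h x = \<Phi> h y"
      then show "x = y" using s \<open>inj_on h S\<close>
        by (simp add: \<Phi>_def bij_betw_def) (metis imageI inj_onD lessThan_iff)
    qed
    ultimately show ?thesis unfolding frames_def mem_Collect_eq im by (simp add: \<Phi>_def)
  qed
  have "limitin ?X (\<lambda>x. \<Phi> (f x)) (\<Phi> g) F"
  proof -
    have "eventually (\<lambda>x. \<Phi> (f x) \<in> frames ?k) F"
      using dual by eventually_elim (auto intro: frame)
    moreover have "limitin ?P (\<lambda>x. \<Phi> (f x)) (\<Phi> g) F"
      unfolding limitin_componentwise
      using lim s by (auto simp: \<Phi>_def bij_betw_def)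
    ultimately show ?thesis using frame dual' by (simp add: limitin_subtopology)
  qed
  moreover have "continuous_map ?X (Gr_top ?k) ?sp"
    unfolding Gr_top_def by (intro quotient_imp_continuous_map quotient_map_quotient_topology)
  ultimately have "limitin (Gr_top ?k) (?sp \<circ> (\<lambda>x. \<Phi> (f x))) (?sp (\<Phi> g)) F"
    by (rule continuous_map_limit[rotated])
  then show ?thesis by (simp add: o_def im)
qed

lemma limitin_in_closure:
  assumes "limitin X f l F" "F \<noteq> bot" "eventually (\<lambda>x. f x \<in> Q) F"
  shows "l \<in> X closure_of Q"
  unfolding in_closure_of
proof (intro conjI allI impI)
  show "l \<in> topspace X" using assms(1) by (rule limitin_topspace)
  fix T assume "l \<in> T \<and> openin X T"
  then have "eventually (\<lambda>x. f x \<in> T) F" using assms(1) by (auto simp: limitin_def)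
  with assms(3) have "eventually (\<lambda>x. f x \<in> Q \<and> f x \<in> T) F" by (rule eventually_conj)
  then show "\<exists>y. y \<in> Q \<and> y \<in> T" using assms(2) eventually_happens' by blast
qed

subsection \<open>Separating coordinate subspaces\<close>

text \<open>
  The bound is chosen so that vectors taken from different boxes always form a diagonally dominant
  matrix.
\<close>

definition box :: "nat \<Rightarrow> (complex ^ 'n) set" where
  "box l = {v. \<forall>m\<in>{1..n}. norm (coord v m - (if l = m then 1 else 0)) < 1 / (n + 1)}"

lemma open_box: "open (box l)"
proof -
  have "box l = (\<Inter>m\<in>{1..n}. {v. norm (coord v m - (if l = m then 1 else 0)) < 1 / (n + 1)})"
    unfolding box_def by blast
  then show ?thesis
    by (simp only:) (intro open_INT ballI finite_atLeastAtMost open_Collect_less continuous_intros)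
qed

lemma e_in_box: "l \<in> {1..n} \<Longrightarrow> e l \<in> box l"
  by (auto simp: box_def simp del: atLeastAtMost_iff)

text \<open>
  At an index \<open>m\<close> where \<open>c m\<close> is largest, the remaining terms of the \<open>m\<close>-th coordinate are too small to
  cancel \<open>c m\<close>.
\<close>

lemma box_dominant:
  assumes T: "T \<subseteq> {1..n}" and w: "\<And>l. l \<in> T \<Longrightarrow> w l \<in> box l"
    and zero: "\<And>m. m \<in> T \<Longrightarrow> coord (\<Sum>l\<in>T. c l *s w l) m = 0"
  shows "\<forall>l\<in>T. c l = 0"
proof (rule ccontr)
  assume "\<not> (\<forall>l\<in>T. c l = 0)"
  then obtain l0 where l0: "l0 \<in> T" "c l0 \<noteq> 0" by blast
  have fin: "finite T" using T finite_subset by blast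
  define M where "M = Max ((\<lambda>l. norm (c l)) ` T)"
  have le: "norm (c l) \<le> M" if "l \<in> T" for l unfolding M_def using that fin by (intro Max_ge) auto
  have "M \<in> (\<lambda>l. norm (c l)) ` T" unfolding M_def using l0 fin by (intro Max_in) auto
  then obtain m where m: "m \<in> T" "norm (c m) = M" by auto
  have "M > 0" using le[OF l0(1)] l0(2) by (meson less_le_trans zero_less_norm_iff)
  let ?d = "\<lambda>l. coord (w l) m - (if l = m then 1 else 0)"
  have "0 = (\<Sum>l\<in>T. c l * coord (w l) m)" using zero[OF m(1)] by (simp add: coord_lincomb)
  also have "\<dots> = (\<Sum>l\<in>T. c l * ?d l + (if l = m then c l else 0))"
    by (intro sum.cong) (auto simp: algebra_simps)
  also have "\<dots> = (\<Sum>l\<in>T. c l * ?d l) + c m" using m fin by (simp add: sum.distrib)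
  finally have "c m = - (\<Sum>l\<in>T. c l * ?d l)" by (metis add.inverse_inverse eq_neg_iff_add_eq_0 add.commute)
  then have "M = norm (\<Sum>l\<in>T. c l * ?d l)" using m(2) by (metis norm_minus_cancel)
  also have "\<dots> \<le> (\<Sum>l\<in>T. M * (1 / (n + 1)))"
  proof (rule sum_norm_le)
    fix l assume l: "l \<in> T"
    have "norm (?d l) < 1 / (n + 1)" using w[OF l] m T unfolding box_def by blast
    then show "norm (c l * ?d l) \<le> M * (1 / (n + 1))"
      unfolding norm_mult using le[OF l] \<open>M > 0\<close> by (intro mult_mono) auto
  qed
  also have "\<dots> = card T * M / (n + 1)" by simp
  also have "\<dots> < M"
  proof -
    have "card T \<le> n" using card_mono[OF _ T] by simp
    then have "card T * M < (n + 1) * M" using \<open>M > 0\<close> by (intro mult_strict_right_mono) auto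
    then show ?thesis by (simp add: field_simps)
  qed
  finally show False by simp
qed

lemma box_independent:
  assumes T: "T \<subseteq> {1..n}" and w: "\<And>l. l \<in> T \<Longrightarrow> w l \<in> box l"
  shows "inj_on w T" "vec.independent (w ` T)"
proof -
  have fin: "finite T" using T finite_subset by blast
  have ind: "\<forall>l\<in>T. c l = 0" if "(\<Sum>l\<in>T. c l *s w l) = 0" for c
    using that by (intro box_dominant[OF T w]) auto
  show "inj_on w T" "vec.independent (w ` T)"
    using independent_family[OF fin ind] by blast+
qed

text \<open>
  An open neighbourhood of the coordinate subspace of \<open>S\<close>, on which the Pluecker coordinate of \<open>S\<close> does
  not vanish (\<open>box_nbhd_inj\<close>). Neighbourhoods of different coordinate subspaces are disjoint, which
  makes limits at fixed points unique.
\<close>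

definition box_nbhd :: "nat \<Rightarrow> nat set \<Rightarrow> (complex ^ 'n) set set" where
  "box_nbhd k S = {V \<in> Gr k. \<forall>l\<in>S. V \<inter> box l \<noteq> {}}"

lemma openin_box_nbhd: "finite S \<Longrightarrow> openin (Gr_top k) (box_nbhd k S)"
proof (induction rule: finite_induct)
  case empty
  then show ?case using openin_topspace[of "Gr_top k :: (complex ^ 'n) set topology"]
    by (simp add: box_nbhd_def topspace_Gr_top)
next
  case (insert l S)
  have "box_nbhd k (insert l S) = hits k (box l) \<inter> box_nbhd k S"
    by (auto simp: box_nbhd_def hits_def)
  then show ?case using insert openin_hits[OF open_box] by (simp add: openin_Int)
qed

lemma box_nbhd_card:
  assumes "V \<in> box_nbhd k S" "S \<subseteq> {1..n}"
  shows "card S \<le> k"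
proof -
  have "\<forall>l\<in>S. \<exists>v. v \<in> V \<inter> box l" using assms by (auto simp: box_nbhd_def)
  then obtain w where w: "\<And>l. l \<in> S \<Longrightarrow> w l \<in> V \<inter> box l" by metis
  then have "inj_on w S" "vec.independent (w ` S)" using box_independent[OF assms(2), of w] by auto
  then have "card S \<le> vec.dim V"
    using vec.independent_card_le_dim[of "w ` S" V] w by (auto simp: card_image)
  then show ?thesis using assms by (simp add: box_nbhd_def Gr_def)
qed

lemma box_nbhd_disjoint:
  assumes V: "V \<in> box_nbhd k S" "V \<in> box_nbhd k S'" and S: "S \<subseteq> {1..n}" "S' \<subseteq> {1..n}"
    and card: "card S = k" "card S' = k"
  shows "S = S'"
proof -
  have fin: "finite (S \<union> S')" using S finite_subset by blast
  have "card (S \<union> S') \<le> k" using V S by (intro box_nbhd_card[of V]) (auto simp: box_nbhd_def)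
  then have "S = S \<union> S'" "S' = S \<union> S'" using card fin
    by (metis Un_upper1 card_mono card_subset_eq le_antisym, metis Un_upper2 card_mono card_subset_eq le_antisym)
  then show ?thesis by simp
qed

lemma box_nbhd_inj:
  assumes V: "V \<in> box_nbhd k S" and S: "S \<subseteq> {1..n}" "card S = k"
    and v: "v \<in> V" "\<And>m. m \<in> S \<Longrightarrow> coord v m = 0"
  shows "v = 0"
proof -
  have fin: "finite S" using S finite_subset by blast
  have "\<forall>l\<in>S. \<exists>v. v \<in> V \<inter> box l" using V by (auto simp: box_nbhd_def)
  then obtain w where w: "\<And>l. l \<in> S \<Longrightarrow> w l \<in> V \<inter> box l" by metis
  then have ind: "inj_on w S" "vec.independent (w ` S)" using box_independent[OF S(1), of w] by auto
  have "V \<subseteq> vec.span (w ` S)"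
    using vec.card_eq_dim[of "w ` S" V] w ind V S fin
    by (auto simp: card_image box_nbhd_def Gr_def)
  then obtain c where c: "v = (\<Sum>l\<in>S. c l *s w l)" using span_family[OF fin, of v w] v(1) by blast
  then have "\<forall>l\<in>S. c l = 0" using w v(2) by (intro box_dominant[OF S(1), of w]) auto
  then show ?thesis using c by simp
qed

lemma span_e_box_nbhd:
  assumes "S \<subseteq> {1..n}" "card S = k"
  shows "vec.span (e ` S) \<in> box_nbhd k S"
proof -
  have "e l \<in> vec.span (e ` S) \<inter> box l" if "l \<in> S" for l
    using that assms(1) e_in_box vec.span_base by blast
  then show ?thesis using span_e_Gr[OF assms(1)] assms(2) unfolding box_nbhd_def by blast
qed


section \<open>The variety\<close>

lemma topspace_X: "topspace (X_top k n e) = X_set k n e"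
  by (auto simp: X_top_def X_set_def topspace_Gr_top)

lemma openin_X:
  assumes "a \<in> {1..n}" "openin (Gr_top k) U"
  shows "openin (X_top k n e) {V \<in> X_set k n e. V a \<in> U}"
proof -
  have "continuous_map (X_top k n e) (Gr_top k) (\<lambda>V. V a)"
    unfolding X_top_def
    using assms(1) by (intro continuous_map_from_subtopology continuous_map_product_projection) simp
  from openin_continuous_map_preimage[OF this assms(2)] show ?thesis by (simp add: topspace_X)
qed

lemma X_setD:
  assumes "V \<in> X_set k n e" "a \<in> {1..n}"
  shows "V a \<in> Gr k" "vec.subspace (V a)" "\<And>v. v \<in> V a \<Longrightarrow> pr n e a v \<in> V (nxt n a)"
  using assms by (auto simp: X_set_def Gr_def PiE_iff simp del: atLeastAtMost_iff)

lemma X_limit: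
  assumes "l \<in> X_set k n e" "eventually (\<lambda>x. f x \<in> X_set k n e) F"
    and "\<And>a. a \<in> {1..n} \<Longrightarrow> limitin (Gr_top k) (\<lambda>x. f x a) (l a) F"
  shows "limitin (X_top k n e) f l F"
proof -
  have X: "V \<in> extensional {1..n}" "V \<in> topspace (product_topology (\<lambda>_. Gr_top k) {1..n})"
    if "V \<in> X_set k n e" for V
    using that by (auto simp: X_set_def topspace_Gr_top PiE_iff)
  have "eventually (\<lambda>x. f x \<in> topspace (product_topology (\<lambda>_. Gr_top k) {1..n})) F"
    using assms(2) by eventually_elim (rule X)
  then show ?thesis
    using assms X(1)[OF assms(1)] by (simp add: X_top_def limitin_subtopology limitin_componentwise del: topspace_product_topology)
qed


definition necklace_of :: "(nat \<Rightarrow> (complex ^ 'n) set) \<Rightarrow> nat \<Rightarrow> nat set" where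
  "necklace_of V = (\<lambda>a\<in>{1..n}. leads a (V a))"

lemma pos_nxt_less_iff:
  assumes "a \<in> {1..n}" "j \<in> {1..n}" "m \<in> {1..n}" "j \<noteq> a" "m \<noteq> a"
  shows "pos n (nxt n a) j < pos n (nxt n a) m \<longleftrightarrow> pos n a j < pos n a m"
  using pos_nxt[OF assms(1,2)] pos_nxt[OF assms(1,3)] pos_pos_iff[OF assms(1,2)]
    pos_pos_iff[OF assms(1,3)] assms(4,5) by auto

text \<open>
  A vector of \<open>V a\<close> with pivot \<open>j \<noteq> a\<close> keeps its pivot under the projection to \<open>V (a + 1)\<close>, because it
  loses the coordinate at \<open>a\<close> only.
\<close>

lemma necklace_of_necklace:
  assumes V: "V \<in> X_set k n e"
  shows "necklace_of V \<in> necklaces k n"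
proof -
  have "leads a (V a) \<subseteq> leads (nxt n a) (V (nxt n a)) \<union> {a}" if a: "a \<in> {1..n}" for a
  proof
    fix j assume j: "j \<in> leads a (V a)"
    then obtain v where v: "v \<in> V a" "coord v j \<noteq> 0" "j \<in> {1..n}"
      "\<And>m. m \<in> {1..n} \<Longrightarrow> pos n a j < pos n a m \<Longrightarrow> coord v m = 0"
      unfolding leads_def by blast
    show "j \<in> leads (nxt n a) (V (nxt n a)) \<union> {a}"
    proof (cases "j = a")
      case False
      have "j \<in> leads (nxt n a) (V (nxt n a))"
      proof (rule in_leadsI[OF v(3)])
        show "pr n e a v \<in> V (nxt n a)" using X_setD[OF V a] v(1) by blast
        show "coord (pr n e a v) j \<noteq> 0" using v False by simp
        fix m assume m: "m \<in> {1..n}" "pos n (nxt n a) j < pos n (nxt n a) m"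
        show "coord (pr n e a v) m = 0"
          using pos_nxt_less_iff[OF a v(3) m(1) False] m v(4) by (cases "m = a") simp_all
      qed
      then show ?thesis by blast
    qed simp
  qed
  moreover have "leads a (V a) \<subseteq> {1..n} \<and> card (leads a (V a)) = k" if "a \<in> {1..n}" for a
    using leads_sub card_leads X_setD(1)[OF V that] that by blast
  ultimately show ?thesis
    unfolding necklaces_def necklace_of_def by (auto simp del: atLeastAtMost_iff)
qed

subsection \<open>Torus actions\<close>

definition wt :: "(nat \<Rightarrow> complex) \<Rightarrow> nat \<Rightarrow> nat \<Rightarrow> complex" where
  "wt g a j = g 0 ^ hgt n a j * g j"

lemma torus_act_wt: "torus_act n e g V = (\<lambda>a\<in>{1..n}. diag n e (wt g a) ` V a)"
  by (simp add: torus_act_def tuple_act_def wt_def[abs_def])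

lemma torus_nz: "g \<in> torus n \<Longrightarrow> i \<le> n \<Longrightarrow> g i \<noteq> 0"
  by (auto simp: torus_def PiE_iff)

lemma nonzero_wt: "g \<in> torus n \<Longrightarrow> nonzero (wt g a)"
  by (auto simp: nonzero_def wt_def torus_nz)

text \<open>
  The actions at \<open>a\<close> and \<open>a + 1\<close> differ by the scalar \<open>g 0\<close> on the image of the projection, so they
  preserve the condition that defines the variety although they do not commute with the projection.
\<close>

lemma wt_nxt:
  assumes "a \<in> {1..n}" "j \<in> {1..n}" "j \<noteq> a"
  shows "wt g (nxt n a) j = g 0 * wt g a j"
proof -
  have "hgt n (nxt n a) j = Suc (hgt n a j)"
    using assms pos_nxt[OF assms(1,2)] pos_pos_iff[OF assms(1,2)] pos_less[OF assms(1,2)]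
    by (simp add: hgt_eq del: atLeastAtMost_iff)
  then show ?thesis by (simp add: wt_def)
qed

lemma torus_X:
  assumes g: "g \<in> torus n" and V: "V \<in> X_set k n e"
  shows "torus_act n e g V \<in> X_set k n e"
proof -
  have "diag n e (wt g a) ` V a \<in> Gr k" if "a \<in> {1..n}" for a
    using diag_Gr[OF nonzero_wt[OF g]] X_setD(1)[OF V that] by blast
  moreover have "pr n e a ` diag n e (wt g a) ` V a \<subseteq> diag n e (wt g (nxt n a)) ` V (nxt n a)"
    if a: "a \<in> {1..n}" for a
  proof clarify
    fix v assume v: "v \<in> V a"
    have g0: "g 0 \<noteq> 0" using torus_nz[OF g] by simp
    have "pr n e a (diag n e (wt g a) v) = diag n e (wt g (nxt n a)) (inverse (g 0) *s pr n e a v)"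
      by (rule coord_eqI) (use a g0 in \<open>simp add: wt_nxt del: atLeastAtMost_iff\<close>)
    moreover have "inverse (g 0) *s pr n e a v \<in> V (nxt n a)"
      using X_setD(3)[OF V a v] X_setD(2)[OF V nxt_in[OF a]] by (intro vec.subspace_scale)
    ultimately show "pr n e a (diag n e (wt g a) v) \<in> diag n e (wt g (nxt n a)) ` V (nxt n a)"
      by simp
  qed
  ultimately show ?thesis
    using nxt_in unfolding X_set_def torus_act_wt by (auto simp del: atLeastAtMost_iff)
qed

lemma torus_comp:
  assumes "g \<in> torus n" "g' \<in> torus n"
  shows "torus_act n e (torus_mult n g g') V = torus_act n e g (torus_act n e g' V)"
proof -
  have "diag n e (wt (torus_mult n g g') a) = diag n e (wt g a) \<circ> diag n e (wt g' a)" for a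
  proof
    fix v
    show "diag n e (wt (torus_mult n g g') a) v = (diag n e (wt g a) \<circ> diag n e (wt g' a)) v"
      by (rule coord_eqI) (simp add: wt_def torus_mult_def power_mult_distrib)
  qed
  then show ?thesis unfolding torus_act_wt by (intro ext) (simp add: image_comp)
qed

lemma torus_id:
  assumes "V \<in> X_set k n e"
  shows "torus_act n e (torus_one n) V = V"
proof
  fix a
  have "diag n e (wt (torus_one n) a) v = v" for v
    by (rule diag_one) (simp add: wt_def torus_one_def)
  then have "diag n e (wt (torus_one n) a) ` V a = V a" by simp
  then show "torus_act n e (torus_one n) V a = V a"
    using assms unfolding torus_act_wt X_set_def by (auto simp: PiE_iff extensional_def)
qed

lemma necklace_of_torus:
  assumes "g \<in> torus n"
  shows "necklace_of (torus_act n e g V) = necklace_of V"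
  unfolding necklace_of_def torus_act_wt
  by (intro restrict_ext) (simp add: leads_diag[OF nonzero_wt[OF assms]] del: atLeastAtMost_iff)

subsection \<open>Fixed points and cells\<close>

lemma coord_span_e:
  assumes "S \<subseteq> {1..n}" "v \<in> vec.span (e ` S)" "j \<in> {1..n}" "j \<notin> S"
  shows "coord v j = 0"
proof -
  have "finite S" using assms(1) finite_subset by blast
  then obtain c where "v = (\<Sum>i\<in>S. c i *s e i)" using span_family assms(2) by blast
  then show ?thesis using coord_sum_e[OF assms(1,3)] assms(4) by simp
qed

lemma p_pt_X:
  assumes I: "I \<in> necklaces k n"
  shows "p_pt n e I \<in> X_set k n e"
proof -
  have "pr n e a v \<in> vec.span (e ` I (nxt n a))" if a: "a \<in> {1..n}" and v: "v \<in> vec.span (e ` I a)" for a v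
  proof (rule in_span_e)
    show "I (nxt n a) \<subseteq> {1..n}" using necklace_comp[OF I nxt_in[OF a]] by blast
    fix j assume j: "j \<in> {1..n}" "j \<notin> I (nxt n a)"
    then have "j = a \<or> j \<notin> I a" using necklace_comp(4)[OF I a] by blast
    then show "coord (pr n e a v) j = 0"
      using coord_span_e[OF necklace_comp(1)[OF I a] v j(1)] j(1) by auto
  qed
  moreover have "vec.span (e ` I a) \<in> Gr k" if "a \<in> {1..n}" for a
    using span_e_Gr[of "I a"] necklace_comp[OF I that] by simp
  ultimately show ?thesis
    using nxt_in unfolding X_set_def p_pt_def by (auto simp del: atLeastAtMost_iff)
qed

lemma necklace_of_p_pt:
  assumes I: "I \<in> necklaces k n"
  shows "necklace_of (p_pt n e I) = I"
proof -
  have "leads a (vec.span (e ` I a)) = I a" if a: "a \<in> {1..n}" for a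
  proof (rule leads_eqI[OF _ a])
    note c = necklace_comp[OF I a]
    show "vec.span (e ` I a) \<in> Gr k" "card (I a) = k" using span_e_Gr[of "I a"] c by auto
    show "I a \<subseteq> leads a (vec.span (e ` I a))"
    proof
      fix j assume j: "j \<in> I a"
      then have jn: "j \<in> {1..n}" using c by blast
      show "j \<in> leads a (vec.span (e ` I a))"
      proof (rule in_leadsI[OF jn])
        show "e j \<in> vec.span (e ` I a)" using j by (simp add: vec.span_base)
        show "coord (e j) m = 0" if "m \<in> {1..n}" "pos n a j < pos n a m" for m
          using that jn by (cases "j = m") (simp_all del: atLeastAtMost_iff)
      qed (simp add: jn del: atLeastAtMost_iff)
    qed
  qed
  then show ?thesis
    using I unfolding necklace_of_def p_pt_def necklaces_def
    by (intro ext) (auto simp: PiE_iff extensional_def simp del: atLeastAtMost_iff)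
qed

lemma cstar_act_eq: "cstar_act n e l V = (\<lambda>a\<in>{1..n}. diag n e (\<lambda>j. l ^ hgt n a j) ` V a)"
  by (simp add: cstar_act_def tuple_act_def)

lemma cstar_torus:
  assumes "l \<noteq> 0"
  obtains g where "g \<in> torus n" "\<And>V. cstar_act n e l V = torus_act n e g V"
proof -
  let ?g = "\<lambda>i\<in>{0..n}. if i = 0 then l else 1"
  have "?g \<in> torus n" using assms by (auto simp: torus_def)
  moreover have "diag n e (\<lambda>j. l ^ hgt n a j) = diag n e (wt ?g a)" for a
    by (rule diag_cong) (auto simp: wt_def)
  then have "cstar_act n e l V = torus_act n e ?g V" for V
    unfolding cstar_act_eq torus_act_wt by simp
  ultimately show thesis using that by blast
qed

text \<open>
  The reduced row with pivot \<open>j\<close>, rescaled to have \<open>j\<close>-th coordinate one, tends to \<open>e j\<close>: its other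
  non-zero coordinates precede \<open>j\<close>, hence have larger height and are multiplied by positive powers
  of \<open>l\<close>.
\<close>

lemma cstar_limit:
  assumes V: "V \<in> X_set k n e"
  shows "limitin (X_top k n e) (\<lambda>l. cstar_act n e l V) (p_pt n e (necklace_of V)) (at 0)"
proof (rule X_limit)
  have nz: "\<forall>\<^sub>F l in at 0. l \<noteq> (0::complex)" by (simp add: eventually_at_filter)
  show "p_pt n e (necklace_of V) \<in> X_set k n e" by (intro p_pt_X necklace_of_necklace V)
  show "\<forall>\<^sub>F l in at 0. cstar_act n e l V \<in> X_set k n e"
    using nz
  proof eventually_elim
    case (elim l)
    then obtain g where "g \<in> torus n" "\<And>V. cstar_act n e l V = torus_act n e g V"
      using cstar_torus by blast
    then show ?case using torus_X[OF _ V] by simp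
  qed
  fix a assume a: "a \<in> {1..n}"
  note U = X_setD(2)[OF V a]
  let ?S = "leads a (V a)" and ?r = "rvec a (V a)"
  let ?f = "\<lambda>l j. inverse (l ^ hgt n a j) *s diag n e (\<lambda>j. l ^ hgt n a j) (?r j)"
  have "limitin (Gr_top (card ?S)) (\<lambda>l. vec.span (?f l ` ?S)) (vec.span (e ` ?S)) (at 0)"
  proof (rule Gr_limit[OF finite_leads])
    have d: "coord (?f l i) j = (if i = j then 1 else 0)" if "l \<noteq> 0" "i \<in> ?S" "j \<in> ?S" for l i j
      using that leads_sub[of a "V a"] rvec_dual[OF U a that(3), of i] by auto
    show "\<forall>\<^sub>F l in at 0. \<forall>i\<in>?S. \<forall>j\<in>?S. coord (?f l i) j = (if i = j then 1 else 0)"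
      by (rule eventually_mono[OF nz]) (intro ballI d)
    show "coord (e i) j = (if i = j then 1 else 0)" if "i \<in> ?S" "j \<in> ?S" for i j
      using that leads_sub by (intro coord_e) blast+
    fix i assume i: "i \<in> ?S"
    then have i': "i \<in> {1..n}" using leads_sub by blast
    show "((\<lambda>l. ?f l i) \<longlongrightarrow> e i) (at 0)"
    proof (rule tendsto_coI)
      fix m assume m: "m \<in> {1..n}"
      let ?c = "\<lambda>l. inverse (l ^ hgt n a i) * (l ^ hgt n a m * coord (?r i) m)"
      have "(?c \<longlongrightarrow> coord (e i) m) (at 0)"
      proof (cases "i = m")
        case True
        then have "coord (?r i) m = 1" using rvec_dual[OF U a i, of i] by simp
        then have "\<forall>\<^sub>F l in at 0. ?c l = coord (e i) m"
          using nz True m by (auto elim!: eventually_mono)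
        then show ?thesis by (rule tendsto_eventually)
      next
        case False
        show ?thesis
        proof (cases "coord (?r i) m = 0")
          case True
          then show ?thesis using False m i' by simp
        next
          case nz': False
          then have "pos n a m < pos n a i"
            using rvec_lead[OF U a i m] pos_eq_iff[OF a m i'] False by force
          then have lt: "hgt n a i < hgt n a m"
            using pos_less[OF a i'] hgt_eq[OF a m] hgt_eq[OF a i'] by simp
          have "((\<lambda>l. l ^ (hgt n a m - hgt n a i) * coord (?r i) m) \<longlongrightarrow> 0 ^ (hgt n a m - hgt n a i) * coord (?r i) m) (at 0)"
            by (intro tendsto_intros)
          moreover have "(0::complex) ^ (hgt n a m - hgt n a i) * coord (?r i) m = 0" using lt by simp
          ultimately have "((\<lambda>l. l ^ (hgt n a m - hgt n a i) * coord (?r i) m) \<longlongrightarrow> 0) (at 0)"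
            by simp
          moreover have "\<forall>\<^sub>F l in at 0. l ^ (hgt n a m - hgt n a i) * coord (?r i) m = ?c l"
            using nz
          proof eventually_elim
            case (elim l)
            have "l ^ hgt n a m = l ^ hgt n a i * l ^ (hgt n a m - hgt n a i)"
              using lt by (simp add: power_add[symmetric])
            then show ?case using elim by simp
          qed
          ultimately show ?thesis using False m i' by (simp add: Lim_transform_eventually)
        qed
      qed
      then show "((\<lambda>l. coord (?f l i) m) \<longlongrightarrow> coord (e i) m) (at 0)" using m by simp
    qed
  qed
  moreover have "card ?S = k" using card_leads X_setD(1)[OF V a] a by blast
  moreover have "\<forall>\<^sub>F l in at 0. vec.span (?f l ` ?S) = cstar_act n e l V a"
    using nz
  proof eventually_elim
    case (elim l)
    let ?w = "\<lambda>j. l ^ hgt n a j"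
    have w: "nonzero ?w" using elim by (simp add: nonzero_def)
    have "vec.subspace (diag n e ?w ` V a)" using U vec.linear_subspace_image[OF linear_diag] by blast
    then have "diag n e ?w ` V a = vec.span (rvec a (diag n e ?w ` V a) ` leads a (diag n e ?w ` V a))"
      by (rule span_rvec[OF _ a, symmetric])
    also have "rvec a (diag n e ?w ` V a) ` leads a (diag n e ?w ` V a) = ?f l ` ?S"
      unfolding leads_diag[OF w] using rvec_diag[OF w U a] by (intro image_cong) auto
    finally show ?case using a unfolding cstar_act_eq by simp
  qed
  ultimately show "limitin (Gr_top k) (\<lambda>l. cstar_act n e l V a) (p_pt n e (necklace_of V) a) (at 0)"
    using a unfolding p_pt_def necklace_of_def
    by (auto intro: limitin_transform_eventually simp del: atLeastAtMost_iff)
qed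

lemma box_nbhd_p_pt:
  assumes "I \<in> necklaces k n" "a \<in> {1..n}"
  shows "p_pt n e I a \<in> box_nbhd k (I a)"
  using span_e_box_nbhd[of "I a" k] necklace_comp[OF assms] assms(2) by (simp add: p_pt_def)

lemma necklace_ext:
  assumes "I \<in> necklaces k n" "J \<in> necklaces k n" "\<And>a. a \<in> {1..n} \<Longrightarrow> I a = J a"
  shows "I = J"
proof -
  have "K \<in> {1..n} \<rightarrow>\<^sub>E {S. S \<subseteq> {1..n} \<and> card S = k}" if "K \<in> necklaces k n" for K
    using that by (simp only: necklaces_def mem_Collect_eq)
  from PiE_ext[OF this[OF assms(1)] this[OF assms(2)] assms(3)] show ?thesis .
qed

text \<open>
  Every point flows to the coordinate point of its own pivots, and by the disjoint neighbourhoods of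
  coordinate points it has no other limit.
\<close>

lemma cell_eq:
  assumes I: "I \<in> necklaces k n"
  shows "cell k n e I = {V \<in> X_set k n e. necklace_of V = I}"
proof -
  have "necklace_of V = I" if V: "V \<in> X_set k n e"
    and lim: "limitin (X_top k n e) (\<lambda>l. cstar_act n e l V) (p_pt n e I) (at 0)" for V
  proof -
    let ?J = "necklace_of V"
    have J: "?J \<in> necklaces k n" by (rule necklace_of_necklace[OF V])
    have ev: "\<forall>\<^sub>F l in at 0. cstar_act n e l V a \<in> box_nbhd k (K a)"
      if K: "K \<in> necklaces k n" and a: "a \<in> {1..n}"
        and lim: "limitin (X_top k n e) (\<lambda>l. cstar_act n e l V) (p_pt n e K) (at 0)" for K a
    proof -
      let ?U = "{W \<in> X_set k n e. W a \<in> box_nbhd k (K a)}"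
      have "openin (X_top k n e) ?U"
        using necklace_comp(3)[OF K a] by (intro openin_X a openin_box_nbhd)
      moreover have "p_pt n e K \<in> ?U" using box_nbhd_p_pt[OF K a] p_pt_X[OF K] by simp
      ultimately have "\<forall>\<^sub>F l in at 0. cstar_act n e l V \<in> ?U" using lim by (auto simp: limitin_def)
      then show ?thesis by eventually_elim simp
    qed
    have "?J a = I a" if a: "a \<in> {1..n}" for a
    proof -
      have "\<forall>\<^sub>F l in at 0. cstar_act n e l V a \<in> box_nbhd k (?J a) \<and> cstar_act n e l V a \<in> box_nbhd k (I a)"
        using ev[OF J a cstar_limit[OF V]] ev[OF I a lim] by (rule eventually_conj)
      from eventually_happens'[OF trivial_limit_at this]
      obtain l where l: "cstar_act n e l V a \<in> box_nbhd k (?J a)" "cstar_act n e l V a \<in> box_nbhd k (I a)"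
        by (elim exE conjE)
      show ?thesis
        by (rule box_nbhd_disjoint[OF l necklace_comp(1)[OF J a] necklace_comp(1)[OF I a]
              necklace_comp(2)[OF J a] necklace_comp(2)[OF I a]])
    qed
    then show ?thesis by (rule necklace_ext[OF J I])
  qed
  then show ?thesis using cstar_limit unfolding cell_def by blast
qed

subsection \<open>The automorphism group\<close>

lemma AutD:
  assumes "E \<in> Aut_U n e" "a \<in> {1..n}"
  shows "Vector_Spaces.linear (*s) (*s) (E a)" "bij (E a)" "\<And>v. E (nxt n a) (pr n e a v) = pr n e a (E a v)"
proof -
  have "E a \<in> {F. Vector_Spaces.linear (*s) (*s) F \<and> bij F}"
    using assms unfolding Aut_U_def by (blast intro: PiE_mem)
  then show "Vector_Spaces.linear (*s) (*s) (E a)" "bij (E a)" by blast+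
  have "E (nxt n a) \<circ> pr n e a = pr n e a \<circ> E a" using assms unfolding Aut_U_def by blast
  then show "E (nxt n a) (pr n e a v) = pr n e a (E a v)" for v by (metis comp_apply)
qed

lemma AutI:
  assumes "\<And>a. a \<in> {1..n} \<Longrightarrow> Vector_Spaces.linear (*s) (*s) (E a)" "\<And>a. a \<in> {1..n} \<Longrightarrow> bij (E a)"
    and "\<And>a v. a \<in> {1..n} \<Longrightarrow> E (nxt n a) (pr n e a v) = pr n e a (E a v)"
  shows "(\<lambda>a\<in>{1..n}. E a) \<in> Aut_U n e"
proof -
  have "(\<lambda>a\<in>{1..n}. E a) \<in> {1..n} \<rightarrow>\<^sub>E {F. Vector_Spaces.linear (*s) (*s) F \<and> bij F}"
    using assms(1,2) by (intro restrict_PiE_iff[THEN iffD2]) blast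
  moreover have "(\<lambda>a\<in>{1..n}. E a) (nxt n a) \<circ> pr n e a = pr n e a \<circ> (\<lambda>a\<in>{1..n}. E a) a"
    if "a \<in> {1..n}" for a
    using assms(3)[OF that] that nxt_in[OF that] by (simp add: fun_eq_iff del: atLeastAtMost_iff)
  ultimately show ?thesis unfolding Aut_U_def by blast
qed

lemma linear_coord:
  assumes "Vector_Spaces.linear (*s) (*s) F"
  shows "coord (F v) m = (\<Sum>l\<in>{1..n}. coord v l * coord (F (e l)) m)"
proof -
  have "F v = F (\<Sum>l\<in>{1..n}. coord v l *s e l)" by (simp add: expand_e)
  also have "\<dots> = (\<Sum>l\<in>{1..n}. coord v l *s F (e l))"
    by (simp add: vec.linear_sum[OF assms] vec.linear_scale[OF assms])
  finally show ?thesis by (simp add: coord_lincomb)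
qed

text \<open>
  Unless \<open>a = j + 1\<close>, where \<open>j\<close> is the last index of all, \<open>e j\<close> at \<open>a\<close> is the projection of \<open>e j\<close> at the
  preceding index \<open>b\<close>. The image of \<open>e j\<close> at \<open>b\<close> is supported on the indices up to \<open>j\<close>, and the projection
  removes \<open>b\<close>, which has become the last one.
\<close>

lemma Aut_triangular:
  assumes E: "E \<in> Aut_U n e" and j: "j \<in> {1..n}"
  shows "a \<in> {1..n} \<Longrightarrow> m \<in> {1..n} \<Longrightarrow> pos n a j < pos n a m \<Longrightarrow> coord (E a (e j)) m = 0"
proof (induction "n - pos n a j" arbitrary: a m rule: less_induct)
  case less
  obtain b where b: "b \<in> {1..n}" "nxt n b = a" using ex_nxt[OF less.prems(1)] by blast
  have jb: "j \<noteq> b"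
  proof
    assume "j = b"
    then have "pos n a j = n - 1" using pos_nxt[OF b(1) j] b by simp
    then show False using less.prems pos_less[OF less.prems(1,2)] by simp
  qed
  have "pr n e b (e j) = e j" using j jb by (intro coord_eqI) (auto simp del: atLeastAtMost_iff)
  then have eq: "E a (e j) = pr n e b (E b (e j))" using AutD(3)[OF E b(1), of "e j"] b(2) by simp
  show ?case
  proof (cases "m = b")
    case True
    then show ?thesis using eq less.prems(2) by simp
  next
    case False
    have "pos n b j < pos n b m"
      using pos_nxt_less_iff[OF b(1) j less.prems(2) jb False] b(2) less.prems by simp
    moreover have "n - pos n b j < n - pos n a j"
      using pos_nxt[OF b(1) j] b jb pos_pos_iff[OF b(1) j] pos_less[OF b(1) j] by simp
    ultimately have "coord (E b (e j)) m = 0" using less.hyps b(1) less.prems(2) by blast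
    then show ?thesis using eq less.prems(2) by simp
  qed
qed

lemma Aut_inv:
  assumes E: "E \<in> Aut_U n e"
  shows "(\<lambda>a\<in>{1..n}. inv (E a)) \<in> Aut_U n e"
proof -
  have "inv (E (nxt n a)) (pr n e a v) = pr n e a (inv (E a) v)" if a: "a \<in> {1..n}" for a v
  proof -
    have "E (nxt n a) (pr n e a (inv (E a) v)) = pr n e a v"
      using AutD[OF E a] by (simp add: bij_is_surj surj_f_inv_f)
    then show ?thesis using AutD(2)[OF E nxt_in[OF a]] by (metis bij_inv_eq_iff)
  qed
  moreover have "Vector_Spaces.linear (*s) (*s) (inv (E a))" "bij (inv (E a))" if "a \<in> {1..n}" for a
  proof -
    note l = AutD(1,2)[OF E that]
    show "bij (inv (E a))" using l(2) by (rule bij_imp_bij_inv)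
    show "Vector_Spaces.linear (*s) (*s) (inv (E a))"
      using vec.linear_add[OF l(1)] vec.linear_scale[OF l(1)]
      by unfold_locales (metis bij_inv_eq_iff l(2))+
  qed
  ultimately show ?thesis by (intro AutI)
qed

lemma Aut_comp:
  assumes E: "E \<in> Aut_U n e" and F: "F \<in> Aut_U n e"
  shows "(\<lambda>a\<in>{1..n}. E a \<circ> F a) \<in> Aut_U n e"
proof -
  have "Vector_Spaces.linear (*s) (*s) (E a \<circ> F a)" "bij (E a \<circ> F a)" if "a \<in> {1..n}" for a
    using AutD(1,2)[OF E that] AutD(1,2)[OF F that]
    by (auto intro: Vector_Spaces.linear_compose bij_comp)
  then show ?thesis using AutD(3)[OF E] AutD(3)[OF F] by (intro AutI) simp_all
qed

text \<open>
  If the diagonal entry were zero, then \<open>e j\<close>, the image of \<open>E a (e j)\<close> under the inverse automorphism,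
  which is triangular as well, would be supported before \<open>j\<close>.
\<close>

lemma Aut_diagonal:
  assumes E: "E \<in> Aut_U n e" and a: "a \<in> {1..n}" and j: "j \<in> {1..n}"
  shows "coord (E a (e j)) j \<noteq> 0"
proof
  assume z: "coord (E a (e j)) j = 0"
  let ?F = "\<lambda>a\<in>{1..n}. inv (E a)"
  have F: "?F \<in> Aut_U n e" by (rule Aut_inv[OF E])
  have "?F a (E a (e j)) = e j" using AutD(2)[OF E a] a by (simp add: bij_is_inj)
  then have "1 = coord (?F a (E a (e j))) j" using j by (simp del: atLeastAtMost_iff)
  also have "\<dots> = (\<Sum>l\<in>{1..n}. coord (E a (e j)) l * coord (?F a (e l)) j)"
    by (rule linear_coord[OF AutD(1)[OF F a]])
  also have "\<dots> = 0"
  proof (rule sum.neutral, rule ballI)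
    fix l assume l: "l \<in> {1..n}"
    consider "l = j" | "pos n a j < pos n a l" | "pos n a l < pos n a j"
      using pos_eq_iff[OF a l j] by linarith
    then show "coord (E a (e j)) l * coord (?F a (e l)) j = 0"
    proof cases
      case 1
      then show ?thesis using z by simp
    next
      case 2
      then show ?thesis using Aut_triangular[OF E j a l] by simp
    next
      case 3
      then show ?thesis using Aut_triangular[OF F l a j] by simp
    qed
  qed
  finally show False by simp
qed

lemma Aut_X:
  assumes E: "E \<in> Aut_U n e" and V: "V \<in> X_set k n e"
  shows "tuple_act n E V \<in> X_set k n e" "necklace_of (tuple_act n E V) = necklace_of V"
proof -
  have Gr: "E a ` V a \<in> Gr k" if "a \<in> {1..n}" for a
    using Gr_image[OF AutD(1)[OF E that]] AutD(2)[OF E that] X_setD(1)[OF V that]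
    by (simp add: bij_is_inj)
  moreover have "pr n e a ` E a ` V a \<subseteq> E (nxt n a) ` V (nxt n a)" if a: "a \<in> {1..n}" for a
    using AutD(3)[OF E a] X_setD(3)[OF V a] by (auto simp: image_iff) (metis)
  ultimately show "tuple_act n E V \<in> X_set k n e"
    using nxt_in unfolding X_set_def tuple_act_def by (auto simp del: atLeastAtMost_iff)
  have "leads a (E a ` V a) = leads a (V a)" if a: "a \<in> {1..n}" for a
  proof (rule leads_eqI[OF Gr[OF a] a])
    show "card (leads a (V a)) = k" using card_leads X_setD(1)[OF V a] a by blast
    show "leads a (V a) \<subseteq> leads a (E a ` V a)"
    proof
      fix j assume "j \<in> leads a (V a)"
      then obtain v where v: "v \<in> V a" "coord v j \<noteq> 0" "j \<in> {1..n}"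
        "\<And>m. m \<in> {1..n} \<Longrightarrow> pos n a j < pos n a m \<Longrightarrow> coord v m = 0"
        unfolding leads_def by blast
      note lin = linear_coord[OF AutD(1)[OF E a], of v]
      show "j \<in> leads a (E a ` V a)"
      proof (rule in_leadsI[OF v(3)])
        show "E a v \<in> E a ` V a" using v(1) by simp
        have "coord v l * coord (E a (e l)) m = 0"
          if m: "m \<in> {1..n}" "pos n a j \<le> pos n a m" and l: "l \<in> {1..n}" "(l, m) \<noteq> (j, j)" for l m
        proof (cases "pos n a j < pos n a l")
          case True
          then show ?thesis using v(4) l(1) by simp
        next
          case False
          have "pos n a l \<noteq> pos n a m"
          proof
            assume "pos n a l = pos n a m"
            then have "pos n a l = pos n a j" "l = m" using False m(2) pos_eq_iff[OF a l(1) m(1)] by auto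
            then show False using pos_eq_iff[OF a l(1) v(3)] l(2) by simp
          qed
          then show ?thesis using Aut_triangular[OF E l(1) a m(1)] False m(2) by simp
        qed note zero = this
        have "coord (E a v) j = (\<Sum>l\<in>{1..n}. if l = j then coord v j * coord (E a (e j)) j else 0)"
          unfolding lin using zero[OF v(3)] by (intro sum.cong) auto
        then show "coord (E a v) j \<noteq> 0" using v(2,3) Aut_diagonal[OF E a v(3)] by simp
        show "coord (E a v) m = 0" if "m \<in> {1..n}" "pos n a j < pos n a m" for m
          unfolding lin
        proof (intro sum.neutral ballI)
          fix l assume "l \<in> {1..n}"
          moreover have "(l, m) \<noteq> (j, j)" using that by auto
          ultimately show "coord v l * coord (E a (e l)) m = 0" using zero[OF that(1)] that(2) by simp
        qed
      qed
    qed
  qed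
  then show "necklace_of (tuple_act n E V) = necklace_of V"
    unfolding necklace_of_def tuple_act_def by (intro restrict_ext) simp
qed

subsection \<open>Transitivity\<close>

definition trunc :: "nat \<Rightarrow> nat \<Rightarrow> complex ^ 'n \<Rightarrow> complex ^ 'n" where
  "trunc a j = diag n e (\<lambda>m. if pos n a m \<le> pos n a j then 1 else 0)"

lemma coord_trunc [simp]:
  "m \<in> {1..n} \<Longrightarrow> coord (trunc a j v) m = (if pos n a m \<le> pos n a j then coord v m else 0)"
  by (simp add: trunc_def)

text \<open>
  The endomorphism that maps the generator \<open>e j\<close>, at index \<open>j + 1\<close>, to \<open>w j\<close>.
\<close>

definition tri :: "(nat \<Rightarrow> complex ^ 'n) \<Rightarrow> nat \<Rightarrow> complex ^ 'n \<Rightarrow> complex ^ 'n" where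
  "tri w a v = (\<Sum>l\<in>{1..n}. coord v l *s trunc a l (w l))"

lemma coord_tri:
  "m \<in> {1..n} \<Longrightarrow>
   coord (tri w a v) m = (\<Sum>l\<in>{1..n}. coord v l * (if pos n a m \<le> pos n a l then coord (w l) m else 0))"
  by (simp add: tri_def coord_lincomb)

lemma tri_e: "j \<in> {1..n} \<Longrightarrow> tri w a (e j) = trunc a j (w j)"
proof -
  assume j: "j \<in> {1..n}"
  have "tri w a (e j) = (\<Sum>l\<in>{1..n}. if l = j then trunc a j (w j) else 0)"
    unfolding tri_def using j by (intro sum.cong) (auto simp del: atLeastAtMost_iff)
  then show ?thesis using j by simp
qed

lemma linear_tri: "Vector_Spaces.linear (*s) (*s) (tri w a)"
  by (rule linearI) (simp_all add: coord_tri sum.distrib sum_distrib_left algebra_simps)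

lemma tri_Aut:
  assumes w: "\<And>j. j \<in> {1..n} \<Longrightarrow> coord (w j) j \<noteq> 0"
  shows "(\<lambda>a\<in>{1..n}. tri w a) \<in> Aut_U n e"
proof -
  have bij: "bij (tri w a)" if a: "a \<in> {1..n}" for a
  proof -
    have "v = 0" if v: "tri w a v = 0" for v
    proof (rule ccontr)
      assume "v \<noteq> 0"
      then obtain j where j: "j \<in> {1..n}" "coord v j \<noteq> 0"
        "\<And>m. m \<in> {1..n} \<Longrightarrow> pos n a j < pos n a m \<Longrightarrow> coord v m = 0"
        using lead_exists[of v a] by blast
      have "coord (tri w a v) j = (\<Sum>l\<in>{1..n}. if l = j then coord v j * coord (w j) j else 0)"
        unfolding coord_tri[OF j(1)]
      proof (rule sum.cong)
        fix l assume l: "l \<in> {1..n}"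
        show "coord v l * (if pos n a j \<le> pos n a l then coord (w l) j else 0)
            = (if l = j then coord v j * coord (w j) j else 0)"
          using j(3)[OF l] pos_eq_iff[OF a j(1) l] by (cases "pos n a j < pos n a l") auto
      qed simp
      then show False using v j w[OF j(1)] by simp
    qed
    then have "inj (tri w a)" using vec.linear_inj_iff_eq_0[OF linear_tri] by blast
    then show ?thesis using vec.linear_inj_imp_surj[OF linear_tri] by (simp add: bij_def)
  qed
  have "tri w (nxt n a) (pr n e a v) = pr n e a (tri w a v)" if a: "a \<in> {1..n}" for a v
  proof (rule coord_eqI)
    fix m assume m: "m \<in> {1..n}"
    have "coord (tri w (nxt n a) (pr n e a v)) m
        = (\<Sum>l\<in>{1..n}. if m = a then 0 else coord v l * (if pos n a m \<le> pos n a l then coord (w l) m else 0))"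
      unfolding coord_tri[OF m]
    proof (rule sum.cong)
      fix l assume l: "l \<in> {1..n}"
      show "coord (pr n e a v) l * (if pos n (nxt n a) m \<le> pos n (nxt n a) l then coord (w l) m else 0)
          = (if m = a then 0 else coord v l * (if pos n a m \<le> pos n a l then coord (w l) m else 0))"
      proof (cases "l = a")
        case True
        then show ?thesis using pos_pos_iff[OF a m] l by (cases "m = a") auto
      next
        case la: False
        show ?thesis
        proof (cases "m = a")
          case True
          then show ?thesis
            using pos_nxt[OF a l] pos_nxt[OF a a] la pos_less[OF a l] pos_pos_iff[OF a l] by simp
        next
          case False
          then show ?thesis using pos_nxt_less_iff[OF a l m la] la l by (auto simp: not_less[symmetric])
        qed
      qed
    qed simp
    also have "\<dots> = coord (pr n e a (tri w a v)) m" using m by (simp add: coord_tri)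
    finally show "coord (tri w (nxt n a) (pr n e a v)) m = coord (pr n e a (tri w a v)) m" .
  qed
  then show ?thesis using bij linear_tri by (intro AutI)
qed

text \<open>
  The positions of the non-zero entries off the pivots in the reduced echelon forms of all components
  of \<open>V\<close>.
\<close>

definition entries :: "(nat \<Rightarrow> (complex ^ 'n) set) \<Rightarrow> (nat \<times> nat) set" where
  "entries V = {(i, j). i \<in> {1..n} \<and> j \<in> {1..n} \<and> i \<noteq> j \<and>
     (\<exists>a\<in>{1..n}. j \<in> leads a (V a) \<and> coord (rvec a (V a) j) i \<noteq> 0)}"

text \<open>
  Let \<open>s\<close> be the first index after \<open>j\<close> at which \<open>j\<close> is a pivot, and \<open>w j\<close> the reduced row of \<open>V s\<close> with
  this pivot. Its support lies between \<open>s\<close> and \<open>j\<close>, so each projection on the way from \<open>s\<close> to \<open>j\<close>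
  truncates it, and the truncations stay in \<open>V\<close>. If \<open>j\<close> is never a pivot, then \<open>e j\<close> serves.
\<close>

lemma generating_vectors:
  assumes V: "V \<in> X_set k n e"
  shows "\<exists>w. \<forall>j\<in>{1..n}. coord (w j) j = 1 \<and>
      (\<forall>i\<in>{1..n}. i \<noteq> j \<longrightarrow> coord (w j) i \<noteq> 0 \<longrightarrow> (i, j) \<in> entries V) \<and>
      (\<forall>a\<in>{1..n}. j \<in> leads a (V a) \<longrightarrow> trunc a j (w j) \<in> V a)"
proof -
  have "\<exists>w. coord w j = 1 \<and> (\<forall>i\<in>{1..n}. i \<noteq> j \<longrightarrow> coord w i \<noteq> 0 \<longrightarrow> (i, j) \<in> entries V) \<and>
      (\<forall>a\<in>{1..n}. j \<in> leads a (V a) \<longrightarrow> trunc a j w \<in> V a)" if j: "j \<in> {1..n}" for j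
  proof (cases "\<exists>a\<in>{1..n}. j \<in> leads a (V a)")
    case False
    then show ?thesis using j by (intro exI[of _ "e j"]) (auto simp del: atLeastAtMost_iff)
  next
    case True
    let ?P = "{a \<in> {1..n}. j \<in> leads a (V a)}"
    \<comment> \<open>Going around from \<open>j + 1\<close> to \<open>j\<close>, \<open>pos n a j\<close> decreases from \<open>n - 1\<close> to \<open>0\<close>; so the
      first index has the largest position.\<close>
    have fin: "finite ((\<lambda>a. pos n a j) ` ?P)" by simp
    then have "Max ((\<lambda>a. pos n a j) ` ?P) \<in> (\<lambda>a. pos n a j) ` ?P"
      using True by (intro Max_in) blast+
    then obtain s where smax: "Max ((\<lambda>a. pos n a j) ` ?P) = pos n s j" and "s \<in> ?P" by (rule imageE)
    then have s: "s \<in> {1..n}" "j \<in> leads s (V s)" by auto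
    have le: "pos n a j \<le> pos n s j" if "a \<in> {1..n}" "j \<in> leads a (V a)" for a
      unfolding smax[symmetric] using that by (intro Max_ge fin) blast
    note U = X_setD(2)[OF V s(1)]
    let ?w = "rvec s (V s) j"
    have "trunc a j ?w \<in> V a" if "a \<in> {1..n}" "pos n a j \<le> pos n s j" for a
      using that
    proof (induction "pos n s j - pos n a j" arbitrary: a)
      case 0
      then have "a = s" using pos_left_inj[OF 0(2) s(1) j] by simp
      moreover have "trunc s j ?w = ?w"
        using rvec_lead[OF U s(1,2)] by (intro coord_eqI) (auto simp: not_le simp del: atLeastAtMost_iff)
      ultimately show ?case using rvec_in[OF U s(1)] by simp
    next
      case (Suc t)
      obtain b where b: "b \<in> {1..n}" "nxt n b = a" using ex_nxt[OF Suc(3)] by blast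
      have jb: "j \<noteq> b"
      proof
        assume "j = b"
        then have "pos n a j = n - 1" using pos_nxt[OF b(1) j] b by simp
        then show False using Suc(2) pos_less[OF s(1) j] by simp
      qed
      then have p: "pos n b j = Suc (pos n a j)" using pos_nxt[OF b(1) j] b pos_pos_iff[OF b(1) j] by simp
      then have "trunc b j ?w \<in> V b" using Suc by (intro Suc(1)[of b] b(1)) auto
      then have "pr n e b (trunc b j ?w) \<in> V a" using X_setD(3)[OF V b(1)] b(2) by blast
      moreover have "pr n e b (trunc b j ?w) = trunc a j ?w"
      proof (rule coord_eqI)
        fix m assume m: "m \<in> {1..n}"
        show "coord (pr n e b (trunc b j ?w)) m = coord (trunc a j ?w) m"
        proof (cases "m = b")
          case True
          then show ?thesis using m p pos_nxt[OF b(1) b(1)] b(2) pos_less[OF b(1) j] by simp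
        next
          case False
          then show ?thesis
            using m pos_nxt_less_iff[OF b(1) j m jb] b(2) by (auto simp: not_less[symmetric])
        qed
      qed
      ultimately show ?case by simp
    qed
    moreover have "coord ?w j = 1" using rvec_dual[OF U s] by simp
    ultimately show ?thesis
      using le s j unfolding entries_def by (intro exI[of _ ?w]) blast
  qed
  then show ?thesis by (intro bchoice) blast
qed

text \<open>
  The automorphism with the generating vectors of \<open>V\<close> maps each \<open>e j\<close> with \<open>j\<close> a pivot of \<open>V a\<close> into \<open>V a\<close>,
  and the dimensions agree.
\<close>

lemma Aut_transitive:
  assumes V: "V \<in> X_set k n e"
  shows "\<exists>E\<in>Aut_U n e. V = tuple_act n E (p_pt n e (necklace_of V))"
proof -
  obtain w where h: "\<forall>j\<in>{1..n}. coord (w j) j = 1 \<and>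
      (\<forall>i\<in>{1..n}. i \<noteq> j \<longrightarrow> coord (w j) i \<noteq> 0 \<longrightarrow> (i, j) \<in> entries V) \<and>
      (\<forall>a\<in>{1..n}. j \<in> leads a (V a) \<longrightarrow> trunc a j (w j) \<in> V a)"
    using generating_vectors[OF V] by (rule exE)
  have w: "\<And>j. j \<in> {1..n} \<Longrightarrow> coord (w j) j = 1"
    "\<And>a j. a \<in> {1..n} \<Longrightarrow> j \<in> leads a (V a) \<Longrightarrow> trunc a j (w j) \<in> V a"
    using h leads_sub by blast+
  let ?E = "\<lambda>a\<in>{1..n}. tri w a"
  have E: "?E \<in> Aut_U n e" using w(1) by (intro tri_Aut) simp
  let ?p = "p_pt n e (necklace_of V)"
  have p: "?p \<in> X_set k n e" by (intro p_pt_X necklace_of_necklace V)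
  have "tuple_act n ?E ?p a = V a" if a: "a \<in> {1..n}" for a
  proof (rule Gr_eqI)
    show "tuple_act n ?E ?p a \<in> Gr k" "V a \<in> Gr k"
      using X_setD(1)[OF Aut_X(1)[OF E p] a] X_setD(1)[OF V a] by auto
    have "tuple_act n ?E ?p a = vec.span (tri w a ` e ` leads a (V a))"
      using a by (simp add: tuple_act_def p_pt_def necklace_of_def vec.linear_span_image[OF linear_tri])
    moreover have "tri w a ` e ` leads a (V a) \<subseteq> V a"
      using w(2)[OF a] leads_sub by (auto simp: tri_e subset_iff simp del: atLeastAtMost_iff)
    ultimately show "tuple_act n ?E ?p a \<subseteq> V a"
      using X_setD(2)[OF V a] by (simp add: vec.span_minimal)
  qed
  then have "V = tuple_act n ?E ?p"
    using V unfolding X_set_def tuple_act_def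
    by (intro ext) (auto simp: PiE_iff extensional_def simp del: atLeastAtMost_iff)
  then show ?thesis using E by blast
qed

lemma tuple_act_comp: "tuple_act n E (tuple_act n F V) = tuple_act n (\<lambda>a\<in>{1..n}. E a \<circ> F a) V"
  unfolding tuple_act_def by (intro restrict_ext) (simp add: image_comp)

lemma orbit_eq_cell:
  assumes V: "V \<in> X_set k n e"
  shows "act_orbit (Aut_U n e) (tuple_act n) V = cell k n e (necklace_of V)"
proof -
  let ?p = "p_pt n e (necklace_of V)"
  obtain E where E: "E \<in> Aut_U n e" "V = tuple_act n E ?p" using Aut_transitive[OF V] by blast
  let ?E' = "\<lambda>a\<in>{1..n}. inv (E a)"
  have inv: "tuple_act n ?E' V = ?p"
  proof
    fix a
    have "inv (E a) ` E a ` ?p a = ?p a" if "a \<in> {1..n}"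
      using AutD(2)[OF E(1) that] by (simp add: bij_is_inj)
    then show "tuple_act n ?E' V a = ?p a"
      by (subst E(2)) (auto simp: tuple_act_def p_pt_def simp del: atLeastAtMost_iff)
  qed
  have "W \<in> act_orbit (Aut_U n e) (tuple_act n) V"
    if W: "W \<in> X_set k n e" "necklace_of W = necklace_of V" for W
  proof -
    obtain F where F: "F \<in> Aut_U n e" "W = tuple_act n F ?p"
      using Aut_transitive[OF W(1)] W(2) by auto
    then have "W = tuple_act n (\<lambda>a\<in>{1..n}. F a \<circ> ?E' a) V"
      using tuple_act_comp[of F ?E' V] inv by simp
    moreover have "(\<lambda>a\<in>{1..n}. F a \<circ> ?E' a) \<in> Aut_U n e"
      by (intro Aut_comp Aut_inv F(1) E(1))
    ultimately show ?thesis unfolding act_orbit_def by blast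
  qed
  then show ?thesis
    unfolding cell_eq[OF necklace_of_necklace[OF V]] using Aut_X[OF _ V]
    by (auto simp: act_orbit_def)
qed

lemma cells_eq_orbits:
  "cell k n e ` necklaces k n = act_orbit (Aut_U n e) (tuple_act n) ` X_set k n e"
proof (intro equalityI subsetI)
  fix C assume "C \<in> cell k n e ` necklaces k n"
  then obtain I where I: "I \<in> necklaces k n" "C = cell k n e I" by blast
  then have "C = act_orbit (Aut_U n e) (tuple_act n) (p_pt n e I)"
    using orbit_eq_cell[OF p_pt_X[OF I(1)]] necklace_of_p_pt[OF I(1)] by simp
  then show "C \<in> act_orbit (Aut_U n e) (tuple_act n) ` X_set k n e" using p_pt_X[OF I(1)] by blast
next
  fix C assume "C \<in> act_orbit (Aut_U n e) (tuple_act n) ` X_set k n e"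
  then show "C \<in> cell k n e ` necklaces k n"
    using orbit_eq_cell necklace_of_necklace by blast
qed

end


section \<open>Stabilizers and orbit dimensions\<close>

text \<open>
  A basis of the kernel of \<open>l\<close> becomes a basis of \<open>S\<close> when a vector outside the kernel is added. That
  the kernel lies in a finite span has to be assumed, because \<open>dim\<close> is zero for spaces without
  a finite basis.
\<close>

lemma cfun_codim_one:
  assumes S: "cfun.subspace S"
    and add: "\<And>x y. l (x + y) = l x + l y" and scale: "\<And>c x. l (\<lambda>i. c * x i) = c * l x"
    and u: "u \<in> S" "l u \<noteq> 0"
    and fin: "\<exists>B. finite B \<and> {x \<in> S. l x = 0} \<subseteq> cfun.span B"
  shows "cfun.dim S = Suc (cfun.dim {x \<in> S. l x = 0}) \<and> (\<exists>B. finite B \<and> S \<subseteq> cfun.span B)"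
proof -
  let ?K = "{x \<in> S. l x = (0::complex)}"
  have l0: "l 0 = 0" using add[of 0 0] by simp
  have K: "cfun.subspace ?K"
    using S add scale l0 unfolding cfun.subspace_def by auto
  obtain C where C: "C \<subseteq> ?K" "cfun.independent C" "?K \<subseteq> cfun.span C" "card C = cfun.dim ?K"
    using cfun.basis_exists[of ?K] by blast
  have finC: "finite C"
    using fin C cfun.independent_span_bound[of _ C] by (meson subset_trans)
  have spanC: "cfun.span C \<subseteq> ?K" using C(1) K by (rule cfun.span_minimal)
  then have un: "u \<notin> cfun.span C" using u by auto
  have sub: "S \<subseteq> cfun.span (insert u C)"
  proof
    fix x assume x: "x \<in> S"
    let ?k = "l x / l u"
    have "x = (x - (\<lambda>i. ?k * u i)) + (\<lambda>i. ?k * u i)" by simp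
    then have "l x = l (x - (\<lambda>i. ?k * u i)) + ?k * l u" by (metis add scale)
    then have "l (x - (\<lambda>i. ?k * u i)) = 0" using u(2) by simp
    moreover have "x - (\<lambda>i. ?k * u i) \<in> S"
      using x u(1) by (intro cfun.subspace_diff[OF S] cfun.subspace_scale[OF S])
    ultimately have "x - (\<lambda>i. ?k * u i) \<in> cfun.span C" using C(3) by blast
    then show "x \<in> cfun.span (insert u C)" unfolding cfun.span_breakdown_eq by blast
  qed
  have "cfun.dim S = card (insert u C)"
    using sub C(1) u(1) cfun.independent_insertI[OF un C(2)] by (intro cfun.dim_unique) auto
  moreover have "u \<notin> C" using un cfun.span_base by blast
  ultimately show ?thesis using finC C(4) sub by (metis card_insert_disjoint finite_insert)
qed

lemma cfun_dim_mono:
  assumes "A \<subseteq> B" "\<exists>F. finite F \<and> B \<subseteq> cfun.span F"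
  shows "cfun.dim A \<le> cfun.dim B"
proof -
  obtain F where F: "finite F" "B \<subseteq> cfun.span F" using assms(2) by blast
  obtain D where D: "D \<subseteq> B" "cfun.independent D" "B \<subseteq> cfun.span D" "card D = cfun.dim B"
    using cfun.basis_exists[of B] by blast
  have "finite D" using cfun.independent_span_bound[OF F(1) D(2)] D(1) F(2) by blast
  then have "cfun.dim A \<le> card D" using assms(1) D(3) by (intro cfun.dim_le_card) auto
  then show ?thesis using D(4) by simp
qed

text \<open>
  Functions supported on \<open>{..<m}\<close>; for \<open>m = n + 1\<close> this is the Lie algebra of the torus.
\<close>

definition supported :: "nat \<Rightarrow> (nat \<Rightarrow> complex) set" where
  "supported m = {\<xi>. \<forall>i\<ge>m. \<xi> i = 0}"

lemma subspace_supported: "cfun.subspace (supported m)"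
  by (auto simp: cfun.subspace_def supported_def)

lemma dim_supported:
  "cfun.dim (supported m) = m \<and> (\<exists>B. finite B \<and> supported m \<subseteq> cfun.span B)"
proof (induction m)
  case 0
  have "supported 0 = {0}" by (auto simp: supported_def)
  moreover have "cfun.dim {0} = 0" by (rule cfun.dim_unique[OF _ _ cfun.independent_empty]) auto
  moreover have "finite {} \<and> {0} \<subseteq> cfun.span {}" by auto
  ultimately show ?case by metis
next
  case (Suc m)
  have eq: "{\<xi> \<in> supported (Suc m). \<xi> m = 0} = supported m"
    by (auto simp: supported_def) (metis le_antisym not_less_eq_eq)
  have "(\<lambda>i. if i = m then 1 else 0) \<in> supported (Suc m)" by (auto simp: supported_def)
  then have "cfun.dim (supported (Suc m)) = Suc (cfun.dim {\<xi> \<in> supported (Suc m). \<xi> m = 0})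
      \<and> (\<exists>B. finite B \<and> supported (Suc m) \<subseteq> cfun.span B)"
    using Suc by (intro cfun_codim_one[OF subspace_supported]) (auto simp: eq)
  then show ?case using Suc eq by simp
qed

text \<open>
  The character by which the torus acts on an echelon entry in column \<open>i\<close> and in the row with pivot
  \<open>j\<close> (\<open>wt_ratio\<close>), and, below, its differential.
\<close>

definition chi :: "nat \<Rightarrow> nat \<Rightarrow> nat \<Rightarrow> nat \<Rightarrow> int" where
  "chi n i j = eps i - eps j + of_nat (pos n i j) * delta"

definition dchi :: "nat \<Rightarrow> nat \<times> nat \<Rightarrow> (nat \<Rightarrow> complex) \<Rightarrow> complex" where
  "dchi n p \<xi> = \<xi> (fst p) - \<xi> (snd p) + of_nat (pos n (fst p) (snd p)) * \<xi> 0"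

lemma dchi_add: "dchi n p (x + y) = dchi n p x + dchi n p y"
  and dchi_scale: "dchi n p (\<lambda>i. c * x i) = c * dchi n p x"
  and dchi_0: "dchi n p 0 = 0"
  by (simp_all add: dchi_def algebra_simps)

definition root_pairs :: "nat \<Rightarrow> (nat \<times> nat) set" where
  "root_pairs n = {(i, j). i \<in> {1..n} \<and> j \<in> {1..n} \<and> i \<noteq> j}"

lemma dim_ker_dchi:
  assumes "p \<in> root_pairs n"
  shows "cfun.dim {\<xi> \<in> supported (n + 1). dchi n p \<xi> = 0} = n"
    and "\<exists>B. finite B \<and> {\<xi> \<in> supported (n + 1). dchi n p \<xi> = 0} \<subseteq> cfun.span B"
proof -
  let ?u = "(\<lambda>l. if l = fst p then 1 else 0) :: nat \<Rightarrow> complex"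
  let ?K = "{\<xi> \<in> supported (n + 1). dchi n p \<xi> = 0}"
  have u: "?u \<in> supported (n + 1)" "dchi n p ?u \<noteq> 0"
    using assms by (auto simp: supported_def dchi_def root_pairs_def)
  have "?K \<subseteq> supported (n + 1)" by blast
  then show fin: "\<exists>B. finite B \<and> ?K \<subseteq> cfun.span B" using dim_supported[of "n + 1"] by blast
  have "cfun.dim (supported (n + 1)) = Suc (cfun.dim ?K)"
    using cfun_codim_one[OF subspace_supported dchi_add dchi_scale u fin] by blast
  then show "cfun.dim ?K = n" using dim_supported[of "n + 1"] by simp
qed

text \<open>
  If \<open>q\<close> involves an index \<open>m\<close> that does not occur in \<open>p\<close>, then the coordinate vector of \<open>m\<close> separates
  the two differentials. Otherwise \<open>q\<close> is \<open>p\<close> reversed, and the two differentials add up to \<open>n\<close> times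
  the zeroth coordinate.
\<close>

lemma dim_ker_two_dchi:
  assumes p: "p \<in> root_pairs n" and q: "q \<in> root_pairs n" and ne: "p \<noteq> q"
  shows "cfun.dim {\<xi> \<in> supported (n + 1). dchi n p \<xi> = 0 \<and> dchi n q \<xi> = 0} < n"
proof -
  let ?K = "{\<xi> \<in> supported (n + 1). dchi n p \<xi> = 0}"
  have K: "cfun.subspace ?K"
    using subspace_supported[of "n + 1"]
    unfolding cfun.subspace_def by (auto simp: dchi_add dchi_scale dchi_0)
  obtain i j i' j' where ij: "p = (i, j)" "q = (i', j')" by fastforce
  have "\<exists>u\<in>?K. dchi n q u \<noteq> 0"
  proof (cases "i' = j \<and> j' = i")
    case True
    let ?u = "(\<lambda>l. if l = 0 then 1 else if l = j then of_nat (pos n i j) else 0) :: nat \<Rightarrow> complex"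
    have "of_nat (pos n i j) + of_nat (pos n j i) = (of_nat n :: complex)"
      using pos_swap[of i n j] p ij by (simp add: root_pairs_def flip: of_nat_add)
    then have "dchi n q ?u = of_nat n"
      using True p ij by (auto simp: dchi_def root_pairs_def)
    moreover have "?u \<in> ?K" using p ij by (auto simp: supported_def dchi_def root_pairs_def)
    ultimately show ?thesis using p ij by (intro bexI[of _ ?u]) (auto simp: root_pairs_def)
  next
    case False
    have "i' \<notin> {i, j} \<or> j' \<notin> {i, j}" using False ne ij p q by (auto simp: root_pairs_def)
    then obtain m where m: "m \<in> {i', j'}" "m \<noteq> i" "m \<noteq> j" by blast
    let ?u = "(\<lambda>l. if l = m then 1 else 0) :: nat \<Rightarrow> complex"
    have "?u \<in> ?K" "dchi n q ?u \<noteq> 0"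
      using m p q ij by (auto simp: supported_def dchi_def root_pairs_def)
    then show ?thesis by blast
  qed
  then obtain u where u: "u \<in> ?K" "dchi n q u \<noteq> 0" by blast
  have sub: "{\<xi> \<in> ?K. dchi n q \<xi> = 0} \<subseteq> ?K" by blast
  then have "\<exists>B. finite B \<and> {\<xi> \<in> ?K. dchi n q \<xi> = 0} \<subseteq> cfun.span B"
    using dim_ker_dchi(2)[OF p] by (meson subset_trans)
  then have "cfun.dim ?K = Suc (cfun.dim {\<xi> \<in> ?K. dchi n q \<xi> = 0})"
    using cfun_codim_one[OF K dchi_add dchi_scale u] by blast
  moreover have "{\<xi> \<in> ?K. dchi n q \<xi> = 0}
      = {\<xi> \<in> supported (n + 1). dchi n p \<xi> = 0 \<and> dchi n q \<xi> = 0}" by blast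
  ultimately show ?thesis using dim_ker_dchi(1)[OF p] by simp
qed

lemma char_eval_restrict:
  assumes "S \<subseteq> {0..n}"
  shows "char_eval n m (\<lambda>l\<in>{0..n}. if l \<in> S then h l else 1) = (\<Prod>l\<in>S. h l powi m l)"
proof -
  have "char_eval n m (\<lambda>l\<in>{0..n}. if l \<in> S then h l else 1) = (\<Prod>l\<in>{0..n}. if l \<in> S then h l powi m l else 1)"
    unfolding char_eval_def by (intro prod.cong) auto
  also have "\<dots> = (\<Prod>l\<in>{0..n} \<inter> S. h l powi m l)" by (simp add: prod.inter_restrict)
  finally show ?thesis using assms by (simp add: Int_absorb1)
qed

lemma chi_apply: "chi n i j l = (if l = i then 1 else 0) - (if l = j then 1 else 0)
    + (if l = 0 then int (pos n i j) else 0)"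
  by (simp add: chi_def eps_def delta_def)

lemma char_eval_chi:
  assumes "(i, j) \<in> root_pairs n"
  shows "char_eval n (chi n i j) g = g i * inverse (g j) * g 0 ^ pos n i j"
proof -
  have ij: "i \<in> {1..n}" "j \<in> {1..n}" "i \<noteq> j" using assms by (auto simp: root_pairs_def)
  have "char_eval n (chi n i j) g = (\<Prod>l\<in>{0, i, j}. g l powi chi n i j l)"
    unfolding char_eval_def using ij by (intro prod.mono_neutral_right) (auto simp: chi_apply)
  also have "\<dots> = g i * inverse (g j) * g 0 ^ pos n i j"
    using ij by (simp add: chi_apply power_int_minus)
  finally show ?thesis .
qed

text \<open>
  If \<open>w\<close> is a non-zero multiple of \<open>\<i>\<close>, then some real multiple of it is \<open>\<i> * pi\<close>.
\<close>

lemma exp_real_multiples_one: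
  fixes w :: complex
  assumes "\<And>t::real. exp (complex_of_real t * w) = 1"
  shows "w = 0"
proof (rule ccontr)
  assume "w \<noteq> 0"
  have re: "Re w = 0" using assms[of 1] by (simp add: exp_eq_1)
  then have im: "Im w \<noteq> 0" using \<open>w \<noteq> 0\<close> by (simp add: complex_eq_iff)
  have "complex_of_real (pi / Im w) * w = \<i> * complex_of_real pi"
    using re im by (simp add: complex_eq_iff)
  then show False using assms[of "pi / Im w"] by simp
qed

lemma lie_common_kernel:
  assumes N: "N \<subseteq> root_pairs n"
  shows "lie n {g \<in> torus n. \<forall>(i, j)\<in>N. char_eval n (chi n i j) g = 1}
    = {\<xi> \<in> supported (n + 1). \<forall>p\<in>N. dchi n p \<xi> = 0}"
proof -
  let ?g = "\<lambda>\<xi> (t::real). \<lambda>i\<in>{0..n}. exp (complex_of_real t * \<xi> i)"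
  have tor: "?g \<xi> t \<in> torus n" for \<xi> t by (auto simp: torus_def)
  have ev: "char_eval n (chi n i j) (?g \<xi> t) = exp (complex_of_real t * dchi n (i, j) \<xi>)"
    if ij: "(i, j) \<in> root_pairs n" for i j \<xi> t
  proof -
    have "char_eval n (chi n i j) (?g \<xi> t)
        = exp (complex_of_real t * \<xi> i) * inverse (exp (complex_of_real t * \<xi> j)) * exp (complex_of_real t * \<xi> 0) ^ pos n i j"
      using ij by (simp add: char_eval_chi root_pairs_def)
    also have "\<dots> = exp (complex_of_real t * \<xi> i + - (complex_of_real t * \<xi> j) + of_nat (pos n i j) * (complex_of_real t * \<xi> 0))"
      by (simp only: exp_add exp_minus exp_of_nat_mult)
    finally show ?thesis by (simp add: dchi_def algebra_simps)
  qed
  have "(\<forall>t. \<forall>(i, j)\<in>N. char_eval n (chi n i j) (?g \<xi> t) = 1) \<longleftrightarrow> (\<forall>p\<in>N. dchi n p \<xi> = 0)" for \<xi>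
  proof
    assume h: "\<forall>t. \<forall>(i, j)\<in>N. char_eval n (chi n i j) (?g \<xi> t) = 1"
    show "\<forall>p\<in>N. dchi n p \<xi> = 0"
    proof
      fix p assume p: "p \<in> N"
      obtain i j where ij: "p = (i, j)" by fastforce
      have "(i, j) \<in> root_pairs n" using p ij N by blast
      note e = ev[OF this]
      have h': "\<forall>(i, j)\<in>N. char_eval n (chi n i j) (?g \<xi> t) = 1" for t using h by (rule spec)
      have "exp (complex_of_real t * dchi n p \<xi>) = 1" for t
        using bspec[OF h'[of t] p] e[where \<xi> = \<xi> and t = t] unfolding ij by (simp only: prod.case)
      then show "dchi n p \<xi> = 0" by (rule exp_real_multiples_one)
    qed
  next
    assume h: "\<forall>p\<in>N. dchi n p \<xi> = 0"
    show "\<forall>t. \<forall>(i, j)\<in>N. char_eval n (chi n i j) (?g \<xi> t) = 1"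
    proof (intro allI ballI, clarify)
      fix t i j assume "(i, j) \<in> N"
      then have "(i, j) \<in> root_pairs n" "dchi n (i, j) \<xi> = 0" using h N by blast+
      with ev[OF this(1), where \<xi> = \<xi> and t = t] show "char_eval n (chi n i j) (?g \<xi> t) = 1"
        by (simp only: mult_zero_right exp_zero)
    qed
  qed
  then show ?thesis
    using tor unfolding lie_def supported_def by (auto simp: Suc_le_eq)
qed

text \<open>
  The Lie algebra of the stabilizer is the common kernel of the differentials in \<open>N\<close>, and two distinct
  differentials are linearly independent.
\<close>

lemma orbit_dim_one_iff:
  assumes stab: "stabilizer n act x = {g \<in> torus n. \<forall>(i, j)\<in>N. char_eval n (chi n i j) g = 1}"
    and N: "N \<subseteq> root_pairs n"
  shows "orbit_dim n act x = 1 \<longleftrightarrow> (\<exists>p. N = {p})"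
proof -
  let ?L = "{\<xi> \<in> supported (n + 1). \<forall>p\<in>N. dchi n p \<xi> = 0}"
  have od: "orbit_dim n act x = n + 1 - cfun.dim ?L"
    unfolding orbit_dim_def stab lie_common_kernel[OF N] ..
  consider "N = {}" | p where "N = {p}" | p q where "p \<in> N" "q \<in> N" "p \<noteq> q" by blast
  then show ?thesis
  proof cases
    case 1
    then show ?thesis using od dim_supported[of "n + 1"] by simp
  next
    case (2 p)
    then have "cfun.dim ?L = n" using dim_ker_dchi(1)[of p n] N by simp
    then show ?thesis using od 2 by simp
  next
    case (3 p q)
    have pq: "p \<in> root_pairs n" "q \<in> root_pairs n" using 3 N by auto
    let ?K = "{\<xi> \<in> supported (n + 1). dchi n p \<xi> = 0 \<and> dchi n q \<xi> = 0}"
    have "?L \<subseteq> ?K" using 3 by blast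
    moreover have "\<exists>F. finite F \<and> ?K \<subseteq> cfun.span F" using dim_ker_dchi(2)[OF pq(1)] by blast
    ultimately have "cfun.dim ?L \<le> cfun.dim ?K" by (rule cfun_dim_mono)
    then have "cfun.dim ?L < n" using dim_ker_two_dchi[OF pq 3(3)] by simp
    then show ?thesis using od 3 by auto
  qed
qed

subsection \<open>Characters are determined up to sign by their kernels\<close>

lemma two_powi_eq_1: "(2::complex) powi c = 1 \<longleftrightarrow> c = 0"
proof
  assume h: "(2::complex) powi c = 1"
  have "norm ((2::complex) powi c) = 2 powi c" by (simp add: norm_power_int)
  then have "(2::real) powi c = 1" using h by simp
  then show "c = 0"
    using one_less_power[of "2::real" "nat c"] power_strict_decreasing[of 0 "nat (- c)" "1 / 2 :: real"]
    by (cases c "0::int" rule: linorder_cases) (auto simp: power_int_def)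
qed simp

text \<open>
  Test elements of the torus with one or two coordinates different from one show that \<open>m\<close> is a multiple
  of \<open>chi n i j\<close>. The factor is a unit, because \<open>chi n i j\<close> maps the one-parameter subgroup of the
  coordinate \<open>i\<close> isomorphically, so that a factor \<open>c\<close> with \<open>\<bar>c\<bar> \<noteq> 1\<close> would enlarge the kernel by roots
  of unity or by everything.
\<close>

lemma character_kernel_chi:
  assumes ij: "(i, j) \<in> root_pairs n" and m: "m \<in> characters n"
    and ker: "\<And>g. g \<in> torus n \<Longrightarrow> char_eval n m g = 1 \<longleftrightarrow> char_eval n (chi n i j) g = 1"
  shows "m = chi n i j \<or> m = - chi n i j"
proof -
  have ijn: "i \<in> {1..n}" "j \<in> {1..n}" "i \<noteq> j" "i \<noteq> 0" "j \<noteq> 0" using ij by (auto simp: root_pairs_def)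
  let ?d = "pos n i j"
  define G where "G S h = (\<lambda>l\<in>{0..n}. if l \<in> S then h l else 1 :: complex)" for S h
  have G: "G S h \<in> torus n" if "\<And>l. l \<in> S \<Longrightarrow> h l \<noteq> 0" for S h
    using that by (auto simp: G_def torus_def)
  have ev: "char_eval n m' (G S h) = (\<Prod>l\<in>S. h l powi m' l)" if "S \<subseteq> {0..n}" for S h m'
    unfolding G_def using that by (rule char_eval_restrict)
  have other: "m l = 0" if l: "l \<notin> {0, i, j}" for l
  proof (cases "l \<le> n")
    case True
    then have s: "{l} \<subseteq> {0..n}" by simp
    have "char_eval n (chi n i j) (G {l} (\<lambda>_. 2)) = 1" using l by (simp add: ev[OF s] chi_apply)
    then have "char_eval n m (G {l} (\<lambda>_. 2)) = 1" using ker[OF G] by simp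
    then show ?thesis by (simp add: ev[OF s] two_powi_eq_1)
  next
    case False
    then show ?thesis using m by (simp add: characters_def)
  qed
  have mj: "m j = - m i"
  proof -
    have s: "{i, j} \<subseteq> {0..n}" using ijn by auto
    have "char_eval n (chi n i j) (G {i, j} (\<lambda>_. 2)) = 1"
      using ijn by (simp add: ev[OF s] chi_apply power_int_minus)
    then have "char_eval n m (G {i, j} (\<lambda>_. 2)) = 1" using ker[OF G] by simp
    then have "(2::complex) powi (m i + m j) = 1" using ijn by (simp add: ev[OF s] power_int_add)
    then show ?thesis by (simp add: two_powi_eq_1)
  qed
  have m0: "m 0 = int ?d * m i"
  proof -
    have s: "{0, j} \<subseteq> {0..n}" using ijn by auto
    let ?h = "\<lambda>l. if l = 0 then 2 else (2::complex) ^ ?d"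
    have "char_eval n (chi n i j) (G {0, j} ?h) = 1"
      using ijn by (simp add: ev[OF s] chi_apply power_int_minus)
    then have "char_eval n m (G {0, j} ?h) = 1" using ker[OF G[of "{0, j}" ?h]] by simp
    then have "(2::complex) powi (m 0 + int ?d * m j) = 1"
      using ijn by (simp add: ev[OF s] power_int_add power_int_power)
    then show ?thesis using mj by (simp add: two_powi_eq_1)
  qed
  have s: "{i} \<subseteq> {0..n}" using ijn by auto
  have unit: "y powi m i = 1 \<longleftrightarrow> y = 1" if "y \<noteq> 0" for y :: complex
    using ker[OF G[of "{i}" "\<lambda>_. y"]] that ijn by (simp add: ev[OF s] chi_apply)
  have "\<bar>m i\<bar> = 1"
  proof (rule ccontr)
    assume ne: "\<bar>m i\<bar> \<noteq> 1"
    have "m i \<noteq> 0" using unit[of 2] by auto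
    define N where "N = nat \<bar>m i\<bar>"
    have N: "N \<ge> 2" using ne \<open>m i \<noteq> 0\<close> by (simp add: N_def)
    let ?y = "exp (2 * of_real pi * \<i> * of_nat 1 / of_nat N) :: complex"
    have "?y \<noteq> 1" using complex_root_unity_eq_1[of N 1] N by simp
    moreover have "?y ^ N = 1" using complex_root_unity[of N 1] N by simp
    then have "?y powi m i = 1"
      unfolding N_def by (auto simp: power_int_def power_inverse abs_if split: if_splits)
    ultimately show False using unit[of ?y] by simp
  qed
  then have "m i = 1 \<or> m i = -1" by linarith
  moreover have eq: "m l = m i * chi n i j l" for l
    using other[of l] mj m0 ijn by (auto simp: chi_apply)
  have "m = chi n i j" if "m i = 1" by (rule ext) (use eq that in simp)
  moreover have "m = - chi n i j" if "m i = -1"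
  proof
    fix l show "m l = (- chi n i j) l" using eq[of l] that by simp
  qed
  ultimately show ?thesis by blast
qed


lemma closure_of_meets:
  assumes "x \<in> X closure_of S" "openin X T" "x \<in> T"
  obtains y where "y \<in> S" "y \<in> T"
  using assms unfolding in_closure_of by blast

context based_space begin

lemma restrict_eq_iff:
  assumes "V \<in> X_set k n e"
  shows "(\<lambda>a\<in>{1..n}. F a) = V \<longleftrightarrow> (\<forall>a\<in>{1..n}. F a = V a)"
proof
  have ext: "V \<in> extensional {1..n}" using assms by (simp add: X_set_def PiE_iff)
  assume h: "\<forall>a\<in>{1..n}. F a = V a"
  show "(\<lambda>a\<in>{1..n}. F a) = V"
  proof (rule extensionalityI[OF restrict_extensional ext])
    fix a assume "a \<in> {1..n}"
    then show "(\<lambda>a\<in>{1..n}. F a) a = V a" using bspec[OF h] by (simp only: restrict_apply')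
  qed
next
  assume "(\<lambda>a\<in>{1..n}. F a) = V"
  then show "\<forall>a\<in>{1..n}. F a = V a" by (metis restrict_apply')
qed

lemma X_set_ext:
  assumes "V \<in> X_set k n e" "W \<in> X_set k n e" "\<And>a. a \<in> {1..n} \<Longrightarrow> V a = W a"
  shows "V = W"
  using assms by (intro extensionalityI[of V "{1..n}"]) (simp_all add: X_set_def PiE_iff)

lemma lead_neighbour:
  assumes V: "V \<in> X_set k n e" and a: "a \<in> {1..n}" and j: "j \<in> leads a (V a)"
    and i: "i \<in> {1..n}" "i \<noteq> j" "coord (rvec a (V a) j) i \<noteq> 0"
  shows "pos n a i < pos n a j" "i \<notin> leads a (V a)"
proof -
  note U = X_setD(2)[OF V a]
  have "j \<in> {1..n}" using j leads_sub by blast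
  then show "pos n a i < pos n a j"
    using rvec_lead[OF U a j i(1)] i pos_eq_iff[OF a i(1), of j] by fastforce
  show "i \<notin> leads a (V a)" using rvec_dual[OF U a, of i j] i by auto
qed

text \<open>
  The heights of \<open>i\<close> and \<open>j\<close> at \<open>a\<close> differ by the length of the arc from \<open>i\<close> to \<open>j\<close>, for all \<open>a\<close> from which
  \<open>i\<close> precedes \<open>j\<close>.
\<close>

lemma wt_ratio:
  assumes g: "g \<in> torus n" and a: "a \<in> {1..n}" and ij: "i \<in> {1..n}" "j \<in> {1..n}"
    and lt: "pos n a i < pos n a j"
  shows "wt g a i = char_eval n (chi n i j) g * wt g a j"
proof -
  have "(i, j) \<in> root_pairs n" using ij lt by (auto simp: root_pairs_def)
  moreover have "hgt n a i = hgt n a j + pos n i j"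
    using pos_add[OF a ij] lt pos_less[OF a ij(2)] hgt_eq[OF a ij(1)] hgt_eq[OF a ij(2)] by simp
  moreover have "g j \<noteq> 0" using torus_nz[OF g] ij by simp
  ultimately show ?thesis by (simp add: char_eval_chi wt_def power_add)
qed

lemma entries_sub: "entries V \<subseteq> root_pairs n"
  by (auto simp: entries_def root_pairs_def)

lemma stabilizer_entries:
  assumes V: "V \<in> X_set k n e"
  shows "stabilizer n (torus_act n e) V
    = {g \<in> torus n. \<forall>(i, j)\<in>entries V. char_eval n (chi n i j) g = 1}"
proof -
  have "torus_act n e g V = V \<longleftrightarrow> (\<forall>(i, j)\<in>entries V. char_eval n (chi n i j) g = 1)"
    if g: "g \<in> torus n" for g
  proof -
    have "torus_act n e g V = V \<longleftrightarrow> (\<forall>a\<in>{1..n}. diag n e (wt g a) ` V a = V a)"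
      unfolding torus_act_wt by (rule restrict_eq_iff[OF V])
    also have "\<dots> \<longleftrightarrow> (\<forall>a\<in>{1..n}. \<forall>j\<in>leads a (V a). \<forall>i\<in>{1..n}.
        coord (rvec a (V a) j) i \<noteq> 0 \<longrightarrow> wt g a i = wt g a j)"
      using diag_fixes_iff[OF nonzero_wt[OF g] X_setD(2)[OF V]] by (intro ball_cong) auto
    also have "\<dots> \<longleftrightarrow> (\<forall>a\<in>{1..n}. \<forall>j\<in>leads a (V a). \<forall>i\<in>{1..n}.
        i \<noteq> j \<longrightarrow> coord (rvec a (V a) j) i \<noteq> 0 \<longrightarrow> char_eval n (chi n i j) g = 1)"
    proof (intro ball_cong refl)
      fix a j i assume h: "a \<in> {1..n}" "j \<in> leads a (V a)" "i \<in> {1..n}"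
      then have j: "j \<in> {1..n}" using leads_sub by blast
      have "wt g a j \<noteq> 0" using nonzero_wt[OF g] j by (simp add: nonzero_def)
      then show "(coord (rvec a (V a) j) i \<noteq> 0 \<longrightarrow> wt g a i = wt g a j) =
          (i \<noteq> j \<longrightarrow> coord (rvec a (V a) j) i \<noteq> 0 \<longrightarrow> char_eval n (chi n i j) g = 1)"
        using wt_ratio[OF g h(1,3) j] lead_neighbour(1)[OF V h] by (cases "i = j") auto
    qed
    also have "\<dots> \<longleftrightarrow> (\<forall>(i, j)\<in>entries V. char_eval n (chi n i j) g = 1)"
      using leads_sub unfolding entries_def by blast
    finally show ?thesis .
  qed
  then show ?thesis unfolding stabilizer_def by blast
qed

section \<open>Torus-invariant curves\<close>

text \<open>
  The images of the \<open>e l\<close> under the one-parameter group \<open>e j \<mapsto> e j + x *s e i\<close>, left out at the indices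
  where it is not triangular or does not change the span.
\<close>

definition curve_vec :: "(nat \<Rightarrow> nat set) \<Rightarrow> nat \<Rightarrow> nat \<Rightarrow> complex \<Rightarrow> nat \<Rightarrow> nat \<Rightarrow> complex ^ 'n" where
  "curve_vec I i j x a l = (if l = j \<and> a \<in> exch_range n I i j then e j + x *s e i else e l)"

definition curve :: "(nat \<Rightarrow> nat set) \<Rightarrow> nat \<Rightarrow> nat \<Rightarrow> complex \<Rightarrow> nat \<Rightarrow> (complex ^ 'n) set" where
  "curve I i j x = (\<lambda>a\<in>{1..n}. vec.span (curve_vec I i j x a ` I a))"

context
  fixes k :: nat and I :: "nat \<Rightarrow> nat set" and i j :: nat
  assumes I: "I \<in> necklaces k n" and i: "i \<in> {1..n}" and j: "j \<in> {1..n}"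
begin

lemma exch_rangeD:
  assumes "a \<in> exch_range n I i j"
  shows "a \<in> {1..n}" "pos n a i < pos n a j" "j \<in> I a" "i \<notin> I a" "i \<noteq> j"
  using assms by (auto simp: exch_range_def)

lemma curve_vec_dual:
  assumes "a \<in> {1..n}" "l \<in> I a" "m \<in> I a"
  shows "coord (curve_vec I i j x a l) m = (if l = m then 1 else 0)"
proof -
  have "l \<in> {1..n}" "m \<in> {1..n}" using necklace_comp(1)[OF I assms(1)] assms by auto
  then show ?thesis
    using exch_rangeD[of a] i j assms(3) by (auto simp: curve_vec_def simp del: atLeastAtMost_iff)
qed

lemma curve_Gr: "a \<in> {1..n} \<Longrightarrow> curve I i j x a \<in> Gr k"
  using dual_family(3)[of "I a" "curve_vec I i j x a"] curve_vec_dual[of a] necklace_comp[OF I, of a]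
  by (simp add: curve_def del: atLeastAtMost_iff)

lemma curve_vec_in: "a \<in> {1..n} \<Longrightarrow> l \<in> I a \<Longrightarrow> curve_vec I i j x a l \<in> curve I i j x a"
  by (simp add: curve_def vec.span_base del: atLeastAtMost_iff)

lemma curve_subspace: "a \<in> {1..n} \<Longrightarrow> vec.subspace (curve I i j x a)"
  using curve_Gr by (simp add: Gr_def del: atLeastAtMost_iff)

lemma curve_span: "a \<in> {1..n} \<Longrightarrow> curve I i j x a = vec.span (curve_vec I i j x a ` I a)"
  by (simp add: curve_def)

lemma curve_eq:
  assumes "a \<in> {1..n}" "a \<notin> exch_range n I i j"
  shows "curve I i j x a = vec.span (e ` I a)"
  using assms unfolding curve_def curve_vec_def by (auto cong: image_cong)

lemma curve_0: "curve I i j 0 = p_pt n e I"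
proof -
  have "curve_vec I i j 0 a ` I a = e ` I a" for a
    by (intro image_cong) (auto simp: curve_vec_def)
  then show ?thesis unfolding curve_def p_pt_def by simp
qed

text \<open>
  At a step out of the range of the exchange \<open>e i\<close> is either projected away or contained in the next
  component; at a step into the range \<open>e j\<close> is either projected away or absent before.
\<close>

lemma curve_X: "curve I i j x \<in> X_set k n e"
proof -
  have vec: "pr n e a (curve_vec I i j x a l) \<in> curve I i j x (nxt n a)"
    if a: "a \<in> {1..n}" and l: "l \<in> I a" for a l
  proof -
    let ?b = "nxt n a"
    have b: "?b \<in> {1..n}" using nxt_in[OF a] .
    have ln: "l \<in> {1..n}" using necklace_comp(1)[OF I a] l by blast
    note sub = curve_subspace[OF b]
    have step: "m \<in> I ?b" if "m \<in> I a" "m \<noteq> a" for m using necklace_comp(4)[OF I a] that by blast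
    have pre: "pr n e a (e m) = (if m = a then 0 else e m)" if "m \<in> {1..n}" for m
      using that by (intro coord_eqI) auto
    have ein: "e m \<in> curve I i j x ?b" if "m \<in> I ?b" "m \<noteq> j \<or> ?b \<notin> exch_range n I i j" for m
      using curve_vec_in[OF b that(1), of x] that(2) by (auto simp: curve_vec_def)
    show ?thesis
    proof (cases "l = j \<and> a \<in> exch_range n I i j")
      case False
      then have eq: "curve_vec I i j x a l = e l" by (auto simp: curve_vec_def)
      show ?thesis
      proof (cases "l = a")
        case True
        then show ?thesis using eq pre[OF ln] vec.subspace_0[OF sub] by simp
      next
        case la: False
        have "l \<noteq> j \<or> ?b \<notin> exch_range n I i j"
        proof (rule ccontr)
          assume h: "\<not> (l \<noteq> j \<or> ?b \<notin> exch_range n I i j)"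
          then have hb: "pos n ?b i < pos n ?b j" "i \<notin> I ?b" "l = j" by (auto simp: exch_range_def)
          have "i \<noteq> a"
            using hb(1) pos_nxt[OF a i] pos_less[OF b j] by auto
          then have "pos n a i < pos n a j" "i \<notin> I a"
            using pos_nxt_less_iff[OF a i j] hb la step by auto
          then have "a \<in> exch_range n I i j" using l hb a by (simp add: exch_range_def)
          then show False using False hb by simp
        qed
        then show ?thesis using eq pre[OF ln] la ein[OF step[OF l la]] by simp
      qed
    next
      case True
      then have r: "pos n a i < pos n a j" "j \<in> I a" "i \<notin> I a" "i \<noteq> j" using exch_rangeD[of a] by auto
      then have ja: "j \<noteq> a" by auto
      then have jb: "j \<in> I ?b" using step r by blast
      have eq: "pr n e a (curve_vec I i j x a l) = e j + (if i = a then 0 else x *s e i)"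
        using True ja i j by (intro coord_eqI) (auto simp: curve_vec_def)
      show ?thesis
      proof (cases "i = a")
        case True
        then have "?b \<notin> exch_range n I i j"
          using pos_nxt[OF a i] pos_less[OF b j] by (auto simp: exch_range_def)
        then show ?thesis using eq True ein[OF jb] by simp
      next
        case ia: False
        have lt: "pos n ?b i < pos n ?b j" using pos_nxt_less_iff[OF a i j ia ja] r(1) by simp
        show ?thesis
        proof (cases "i \<in> I ?b")
          case False
          then have "?b \<in> exch_range n I i j" using lt jb b by (simp add: exch_range_def)
          then have "e j + x *s e i \<in> curve I i j x ?b"
            using curve_vec_in[OF b jb, of x] by (simp add: curve_vec_def)
          then show ?thesis using eq ia by simp
        next
          case ib: True
          then have nb: "?b \<notin> exch_range n I i j" by (simp add: exch_range_def)
          have "e j \<in> curve I i j x ?b" "e i \<in> curve I i j x ?b" using ein jb ib nb by blast+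
          then have "e j + x *s e i \<in> curve I i j x ?b"
            using vec.subspace_add[OF sub] vec.subspace_scale[OF sub] by blast
          then show ?thesis using eq ia by simp
        qed
      qed
    qed
  qed
  have "pr n e a ` curve I i j x a \<subseteq> curve I i j x (nxt n a)" if a: "a \<in> {1..n}" for a
  proof -
    have "pr n e a ` curve I i j x a = vec.span (pr n e a ` curve_vec I i j x a ` I a)"
      using curve_span[OF a] vec.linear_span_image[OF linear_pr] by simp
    also have "\<dots> \<subseteq> curve I i j x (nxt n a)"
      using vec[OF a] by (intro vec.span_minimal curve_subspace nxt_in a) blast
    finally show ?thesis .
  qed
  moreover have "curve I i j x \<in> {1..n} \<rightarrow>\<^sub>E Gr k"
    using curve_Gr[of _ x] by (intro PiE_I) (auto simp: curve_def)
  ultimately show ?thesis unfolding X_set_def by blast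
qed

lemma necklace_of_curve: "necklace_of (curve I i j x) = I"
proof (rule necklace_ext[OF necklace_of_necklace[OF curve_X] I])
  fix a assume a: "a \<in> {1..n}"
  have "leads a (curve I i j x a) = I a"
  proof (rule leads_eqI[OF curve_Gr[OF a] a necklace_comp(2)[OF I a]], rule subsetI)
    fix l assume l: "l \<in> I a"
    have ln: "l \<in> {1..n}" using l necklace_comp(1)[OF I a] by blast
    show "l \<in> leads a (curve I i j x a)"
    proof (rule in_leadsI[OF ln curve_vec_in[OF a l]])
      show "coord (curve_vec I i j x a l) l \<noteq> 0" using curve_vec_dual[OF a l l] by simp
      fix m assume m: "m \<in> {1..n}" "pos n a l < pos n a m"
      then have "m \<noteq> l" "l = j \<and> a \<in> exch_range n I i j \<longrightarrow> m \<noteq> i"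
        using exch_rangeD(2)[of a] by auto
      then show "coord (curve_vec I i j x a l) m = 0"
        using m(1) ln i j by (auto simp: curve_vec_def simp del: atLeastAtMost_iff)
    qed
  qed
  then show "necklace_of (curve I i j x) a = I a" using a by (simp add: necklace_of_def)
qed

lemma curve_coord:
  assumes a: "a \<in> exch_range n I i j" and v: "v \<in> curve I i j x a"
  shows "coord v i = x * coord v j" "\<And>m. m \<in> {1..n} \<Longrightarrow> m \<notin> I a \<Longrightarrow> m \<noteq> i \<Longrightarrow> coord v m = 0"
proof -
  note r = exch_rangeD[OF a]
  obtain c where c: "v = (\<Sum>l\<in>I a. c l *s curve_vec I i j x a l)"
    using span_family[OF necklace_comp(3)[OF I r(1)]] v curve_span[OF r(1)] by blast
  have coord_m: "coord v m = (\<Sum>l\<in>I a. c l * coord (curve_vec I i j x a l) m)" for m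
    unfolding c by (rule coord_lincomb)
  have cv: "coord (curve_vec I i j x a l) m
      = (if l = m then 1 else if l = j \<and> m = i then x else 0)"
    if "l \<in> I a" "m \<in> {1..n}" for l m
  proof -
    have "l \<in> {1..n}" using necklace_comp(1)[OF I r(1)] that by blast
    then show ?thesis using that r i j a by (auto simp: curve_vec_def simp del: atLeastAtMost_iff)
  qed
  have "coord v i = (\<Sum>l\<in>I a. if l = j then c j * x else 0)"
    unfolding coord_m using cv i r by (intro sum.cong) auto
  then have 1: "coord v i = c j * x" using r(3) necklace_comp(3)[OF I r(1)] by simp
  have "coord v j = (\<Sum>l\<in>I a. if l = j then c j else 0)"
    unfolding coord_m using cv j r by (intro sum.cong) auto
  then have 2: "coord v j = c j" using r(3) necklace_comp(3)[OF I r(1)] by simp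
  show "coord v i = x * coord v j" using 1 2 by simp
  fix m assume m: "m \<in> {1..n}" "m \<notin> I a" "m \<noteq> i"
  show "coord v m = 0" unfolding coord_m using cv m by (intro sum.neutral) auto
qed

lemma curve_torus:
  assumes g: "g \<in> torus n"
  shows "torus_act n e g (curve I i j x) = curve I i j (char_eval n (chi n i j) g * x)"
proof -
  let ?y = "char_eval n (chi n i j) g * x"
  have "diag n e (wt g a) ` curve I i j x a = curve I i j ?y a" if a: "a \<in> {1..n}" for a
  proof (rule Gr_eqI)
    show "diag n e (wt g a) ` curve I i j x a \<in> Gr k" by (intro diag_Gr nonzero_wt g curve_Gr a)
    show "curve I i j ?y a \<in> Gr k" by (rule curve_Gr[OF a])
    have "diag n e (wt g a) (curve_vec I i j x a l) \<in> curve I i j ?y a" if l: "l \<in> I a" for l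
    proof -
      have ln: "l \<in> {1..n}" using necklace_comp(1)[OF I a] l by blast
      have "diag n e (wt g a) (curve_vec I i j x a l) = wt g a l *s curve_vec I i j ?y a l"
      proof (rule coord_eqI)
        fix m assume m: "m \<in> {1..n}"
        show "coord (diag n e (wt g a) (curve_vec I i j x a l)) m = coord (wt g a l *s curve_vec I i j ?y a l) m"
        proof (cases "l = j \<and> a \<in> exch_range n I i j")
          case True
          then have "wt g a i = char_eval n (chi n i j) g * wt g a j" "i \<noteq> j"
            using wt_ratio[OF g a i j] exch_rangeD[of a] by auto
          then show ?thesis using True m i j by (auto simp: curve_vec_def)
        next
          case False
          then have "curve_vec I i j z a l = e l" for z by (auto simp: curve_vec_def)
          then show ?thesis using m ln by auto
        qed
      qed
      then show ?thesis
        using vec.subspace_scale[OF curve_subspace[OF a] curve_vec_in[OF a l]] by simp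
    qed
    then have "vec.span (diag n e (wt g a) ` curve_vec I i j x a ` I a) \<subseteq> curve I i j ?y a"
      by (intro vec.span_minimal curve_subspace a) blast
    then show "diag n e (wt g a) ` curve I i j x a \<subseteq> curve I i j ?y a"
      using curve_span[OF a] vec.linear_span_image[OF linear_diag] by simp
  qed
  then show ?thesis unfolding torus_act_wt by (intro ext) (auto simp: curve_def)
qed

lemma curve_inj:
  assumes "exch_range n I i j \<noteq> {}" "curve I i j x = curve I i j y"
  shows "x = y"
proof -
  obtain a where a: "a \<in> exch_range n I i j" using assms(1) by blast
  note r = exch_rangeD[OF a]
  have "e j + x *s e i \<in> curve I i j y a"
    using curve_vec_in[OF r(1,3), of x] a assms(2) by (simp add: curve_vec_def)
  then have "coord (e j + x *s e i) i = y * coord (e j + x *s e i) j" by (rule curve_coord(1)[OF a])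
  then show ?thesis using i j r(5) by simp
qed

lemma curve_limit:
  assumes "(f \<longlongrightarrow> x) F"
  shows "limitin (X_top k n e) (\<lambda>t. curve I i j (f t)) (curve I i j x) F"
proof (rule X_limit[OF curve_X])
  show "\<forall>\<^sub>F t in F. curve I i j (f t) \<in> X_set k n e" using curve_X by simp
  fix a assume a: "a \<in> {1..n}"
  have "limitin (Gr_top (card (I a))) (\<lambda>t. vec.span (curve_vec I i j (f t) a ` I a))
      (vec.span (curve_vec I i j x a ` I a)) F"
  proof (rule Gr_limit[OF necklace_comp(3)[OF I a]])
    show "\<forall>\<^sub>F t in F. \<forall>l\<in>I a. \<forall>m\<in>I a. coord (curve_vec I i j (f t) a l) m = (if l = m then 1 else 0)"
      using curve_vec_dual[OF a] by (intro always_eventually) blast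
    show "coord (curve_vec I i j x a l) m = (if l = m then 1 else 0)" if "l \<in> I a" "m \<in> I a" for l m
      using curve_vec_dual[OF a] that by blast
    show "((\<lambda>t. curve_vec I i j (f t) a l) \<longlongrightarrow> curve_vec I i j x a l) F" for l
    proof (cases "l = j \<and> a \<in> exch_range n I i j")
      case True
      then have "curve_vec I i j z a l = e j + z *s e i" for z by (simp add: curve_vec_def)
      then show ?thesis
        using tendsto_add[OF tendsto_const tendsto_scale_vec[OF assms]] by simp
    next
      case False
      then have "curve_vec I i j z a l = e l" for z by (auto simp: curve_vec_def)
      then show ?thesis by simp
    qed
  qed
  then show "limitin (Gr_top k) (\<lambda>t. curve I i j (f t) a) (curve I i j x a) F"
    using necklace_comp(2)[OF I a] curve_span[OF a] by simp
qed

text \<open>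
  The vector \<open>e j + inverse z *s e i\<close> spans the same line as \<open>e i + z *s e j\<close>, which converges as
  \<open>z\<close> tends to zero.
\<close>

lemma curve_limit_infinity:
  assumes I': "exch n I i j \<in> necklaces k n"
  shows "limitin (X_top k n e) (\<lambda>z. curve I i j (inverse z)) (p_pt n e (exch n I i j)) (at 0)"
proof (rule X_limit[OF p_pt_X[OF I']])
  have nz: "\<forall>\<^sub>F z in at 0. z \<noteq> (0::complex)" by (simp add: eventually_at_filter)
  show "\<forall>\<^sub>F z in at 0. curve I i j (inverse z) \<in> X_set k n e" using curve_X by simp
  fix a assume a: "a \<in> {1..n}"
  show "limitin (Gr_top k) (\<lambda>z. curve I i j (inverse z) a) (p_pt n e (exch n I i j) a) (at 0)"
  proof (cases "a \<in> exch_range n I i j")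
    case False
    then have "curve I i j z a = p_pt n e (exch n I i j) a" for z
      using curve_eq[OF a] a by (simp add: p_pt_def exch_def)
    moreover have "p_pt n e (exch n I i j) a \<in> topspace (Gr_top k)"
      using X_setD(1)[OF p_pt_X[OF I'] a] by (simp add: topspace_Gr_top)
    ultimately show ?thesis by (intro limitin_eventually) simp_all
  next
    case True
    note r = exch_rangeD[OF True]
    let ?S = "exch n I i j a"
    have S: "?S = insert i (I a - {j})" using True a by (simp add: exch_def)
    note cS = necklace_comp[OF I' a]
    define f where "f z l = (if l = i then e i + z *s e j else e l)" for z l
    have dual: "coord (f z l) m = (if l = m then 1 else 0)" if "l \<in> ?S" "m \<in> ?S" for z l m
    proof -
      have "l \<in> {1..n}" "m \<in> {1..n}" using that cS(1) by blast+
      moreover have "m \<noteq> j" using that(2) r(5) unfolding S by blast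
      ultimately show ?thesis using i j by (simp add: f_def)
    qed
    have "limitin (Gr_top (card ?S)) (\<lambda>z. vec.span (f z ` ?S)) (vec.span (e ` ?S)) (at 0)"
    proof (rule Gr_limit[OF cS(3)])
      show "\<forall>\<^sub>F z in at 0. \<forall>l\<in>?S. \<forall>m\<in>?S. coord (f z l) m = (if l = m then 1 else 0)"
        by (intro always_eventually allI ballI dual)
      show "coord (e l) m = (if l = m then 1 else 0)" if "l \<in> ?S" "m \<in> ?S" for l m
        using that cS(1) by (intro coord_e) blast+
      show "((\<lambda>z. f z l) \<longlongrightarrow> e l) (at 0)" for l
      proof (cases "l = i")
        case True
        have "((\<lambda>z. e i + z *s e j) \<longlongrightarrow> e i + 0 *s e j) (at 0)"
          by (intro tendsto_add tendsto_const tendsto_scale_vec tendsto_ident_at)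
        then show ?thesis using True by (simp add: f_def)
      qed (simp add: f_def)
    qed
    moreover have "\<forall>\<^sub>F z in at 0. vec.span (f z ` ?S) = curve I i j (inverse z) a"
      using nz
    proof eventually_elim
      case (elim z)
      show ?case
      proof (rule Gr_eqI)
        show "vec.span (f z ` ?S) \<in> Gr k"
          using dual_family(3)[of ?S "f z", OF cS(3) dual] cS(2) by simp
        show "curve I i j (inverse z) a \<in> Gr k" by (rule curve_Gr[OF a])
        have "f z l \<in> curve I i j (inverse z) a" if l: "l \<in> ?S" for l
        proof (cases "l = i")
          case True': True
          have "e j + inverse z *s e i \<in> curve I i j (inverse z) a"
            using curve_vec_in[OF a r(3), of "inverse z"] True by (simp add: curve_vec_def)
          then have "z *s (e j + inverse z *s e i) \<in> curve I i j (inverse z) a"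
            using vec.subspace_scale[OF curve_subspace[OF a]] by blast
          moreover have "z *s (e j + inverse z *s e i) = e i + z *s e j"
            using elim by (simp add: vec.scale_right_distrib)
          ultimately show ?thesis using True' by (simp add: f_def add.commute)
        next
          case False
          then have "l \<in> I a" "l \<noteq> j" using l S by auto
          then show ?thesis
            using curve_vec_in[OF a, of l "inverse z"] False by (simp add: curve_vec_def f_def)
        qed
        then show "vec.span (f z ` ?S) \<subseteq> curve I i j (inverse z) a"
          by (intro vec.span_minimal curve_subspace a) blast
      qed
    qed
    ultimately show ?thesis
      using cS(2) a unfolding p_pt_def by (auto intro: limitin_transform_eventually)
  qed
qed

lemma curve_orbit:
  assumes "i \<noteq> j" "x \<noteq> 0"
  shows "act_orbit (torus n) (torus_act n e) (curve I i j x) = curve I i j ` (- {0})"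
proof -
  have ij: "(i, j) \<in> root_pairs n" using assms(1) i j by (simp add: root_pairs_def)
  have nz: "char_eval n (chi n i j) g \<noteq> 0" if "g \<in> torus n" for g
    using torus_nz[OF that] i j by (simp add: char_eval_chi[OF ij])
  have "\<exists>g\<in>torus n. char_eval n (chi n i j) g * x = y" if "y \<noteq> 0" for y
  proof -
    let ?g = "\<lambda>l\<in>{0..n}. if l = i then y / x else 1"
    have "?g \<in> torus n" using that assms(2) by (auto simp: torus_def)
    moreover have "char_eval n (chi n i j) ?g * x = y"
      using assms i j by (auto simp: char_eval_chi[OF ij])
    ultimately show ?thesis by blast
  qed
  then show ?thesis
    using nz assms(2) unfolding act_orbit_def by (auto simp: curve_torus image_iff)
qed

lemma curve_stabilizer:
  assumes "exch_range n I i j \<noteq> {}" "x \<noteq> 0"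
  shows "stabilizer n (torus_act n e) (curve I i j x)
    = {g \<in> torus n. \<forall>(i, j)\<in>{(i, j)}. char_eval n (chi n i j) g = 1}"
proof -
  have "curve I i j (c * x) = curve I i j x \<longleftrightarrow> c = 1" for c
    using curve_inj[OF assms(1), of "c * x" x] assms(2) by auto
  then show ?thesis unfolding stabilizer_def using curve_torus[of _ x] by auto
qed

lemma curve_one_dim:
  assumes ne: "exch_range n I i j \<noteq> {}"
  shows "curve I i j ` (- {0}) \<in> one_dim_orbits n (X_top k n e) (torus_act n e)"
proof -
  have "i \<noteq> j" using ne exch_rangeD(5) by blast
  then have "{(i, j)} \<subseteq> root_pairs n" using i j by (simp add: root_pairs_def)
  then have "orbit_dim n (torus_act n e) (curve I i j 1) = 1"
    using orbit_dim_one_iff[OF curve_stabilizer[OF ne]] by simp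
  moreover have "curve I i j 1 \<in> topspace (X_top k n e)" using curve_X by (simp add: topspace_X)
  ultimately show ?thesis
    unfolding one_dim_orbits_def using curve_orbit[OF \<open>i \<noteq> j\<close>, of 1] by force
qed

lemma curve_cell: "curve I i j x \<in> cell k n e I"
  using cell_eq[OF I] curve_X necklace_of_curve by simp

lemma curve_closure_0: "p_pt n e I \<in> X_top k n e closure_of (curve I i j ` (- {0}))"
proof (rule limitin_in_closure)
  show "limitin (X_top k n e) (curve I i j) (p_pt n e I) (at 0)"
    using curve_limit[OF tendsto_ident_at, of 0 UNIV] by (simp add: curve_0)
qed (auto simp: eventually_at_filter)

lemma curve_closure_infinity:
  assumes "exch n I i j \<in> necklaces k n"
  shows "p_pt n e (exch n I i j) \<in> X_top k n e closure_of (curve I i j ` (- {0}))"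
  by (rule limitin_in_closure[OF curve_limit_infinity[OF assms]]) (auto simp: eventually_at_filter)

text \<open>
  Outside the range the components are constant on the curve. Within the range the box neighbourhoods
  leave only the two sets \<open>I a\<close> and \<open>exch n I i j a\<close>. If different choices were made at two indices \<open>a\<close>
  and \<open>b\<close>, then there would be points on the curve close to the limit in both components, with
  \<open>\<bar>x\<bar> < 1\<close> because of \<open>a\<close> and \<open>\<bar>x\<bar> > 1\<close> because of \<open>b\<close>.
\<close>

lemma curve_closure_fixed:
  assumes J: "J \<in> necklaces k n"
    and cl: "p_pt n e J \<in> X_top k n e closure_of (curve I i j ` (- {0}))"
  shows "J = I \<or> J = exch n I i j"
proof -
  have meet: "\<exists>x. x \<noteq> 0 \<and> curve I i j x \<in> W" if "openin (X_top k n e) W" "p_pt n e J \<in> W" for W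
    using cl that unfolding in_closure_of by blast
  have out: "J a = I a" if a: "a \<in> {1..n}" "a \<notin> exch_range n I i j" for a
  proof -
    let ?W = "{V \<in> X_set k n e. V a \<in> box_nbhd k (J a)}"
    have "openin (X_top k n e) ?W" using necklace_comp(3)[OF J a(1)] by (intro openin_X a openin_box_nbhd)
    moreover have "p_pt n e J \<in> ?W" using p_pt_X[OF J] box_nbhd_p_pt[OF J a(1)] by simp
    ultimately obtain x where "curve I i j x \<in> ?W" using meet by blast
    then have "p_pt n e I a \<in> box_nbhd k (J a)"
      using curve_eq[OF a] a by (simp add: p_pt_def)
    from box_nbhd_disjoint[OF this box_nbhd_p_pt[OF I a(1)] necklace_comp(1)[OF J a(1)]
        necklace_comp(1)[OF I a(1)] necklace_comp(2)[OF J a(1)] necklace_comp(2)[OF I a(1)]]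
    show ?thesis .
  qed
  have inr: "J a = I a \<or> J a = insert i (I a - {j})" if a: "a \<in> exch_range n I i j" for a
  proof -
    note r = exch_rangeD[OF a]
    note cI = necklace_comp[OF I r(1)] and cJ = necklace_comp[OF J r(1)]
    let ?W = "{V \<in> X_set k n e. V a \<in> box_nbhd k (J a)}"
    have "openin (X_top k n e) ?W" using cJ(3) by (intro openin_X r openin_box_nbhd)
    moreover have "p_pt n e J \<in> ?W" using p_pt_X[OF J] box_nbhd_p_pt[OF J r(1)] by simp
    ultimately obtain x where "curve I i j x \<in> ?W" using meet by blast
    then have N: "curve I i j x a \<in> box_nbhd k (J a)" by simp
    have sub: "J a \<subseteq> insert i (I a)"
    proof
      fix l assume l: "l \<in> J a"
      then have ln: "l \<in> {1..n}" using cJ(1) by blast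
      obtain v where v: "v \<in> curve I i j x a" "v \<in> box l" using N l unfolding box_nbhd_def by blast
      have "norm (coord v l - (if l = l then 1 else 0)) < 1 / (n + 1)"
        using v(2) ln unfolding box_def by blast
      moreover have "1 / real (n + 1) \<le> 1" by simp
      ultimately have "norm (coord v l - 1) < 1" by (simp only: if_True simp_thms)
      then have "coord v l \<noteq> 0" by auto
      then show "l \<in> insert i (I a)" using curve_coord(2)[OF a v(1) ln] by blast
    qed
    have "card (insert i (I a) - J a) = 1"
      using card_Diff_subset[OF cJ(3) sub] cI cJ(2) r(4) by simp
    then obtain q where q: "insert i (I a) - J a = {q}" by (rule card_1_singletonE)
    have Jq: "J a = insert i (I a) - {q}" using q sub by blast
    have "q = i \<or> q = j"
    proof (rule ccontr)
      assume nq: "\<not> (q = i \<or> q = j)"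
      then have qI: "q \<in> I a" using q by blast
      then have qn: "q \<in> {1..n}" using cI(1) by blast
      have "e q \<in> curve I i j x a" using curve_vec_in[OF r(1) qI, of x] nq by (simp add: curve_vec_def)
      moreover have "coord (e q) m = 0" if "m \<in> J a" for m
      proof -
        have "m \<in> {1..n}" "q \<noteq> m" using that cJ(1) q by blast+
        then show ?thesis using qn by simp
      qed
      ultimately have "e q = 0" by (rule box_nbhd_inj[OF N cJ(1,2)])
      then show False using qn coord_e[of q q] by simp
    qed
    then show ?thesis using Jq r(4,5) by blast
  qed
  have mix: False
    if a: "a \<in> exch_range n I i j" "J a = I a" and b: "b \<in> exch_range n I i j" "J b = insert i (I b - {j})"
    for a b
  proof -
    note ra = exch_rangeD[OF a(1)] and rb = exch_rangeD[OF b(1)]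
    let ?A = "{v. norm (coord v i) < norm (coord v j)}" and ?B = "{v. norm (coord v j) < norm (coord v i)}"
    have "open ?A" "open ?B" by (intro open_Collect_less continuous_intros)+
    then have "openin (X_top k n e) ({V \<in> X_set k n e. V a \<in> hits k ?A} \<inter> {V \<in> X_set k n e. V b \<in> hits k ?B})"
      (is "openin _ ?W")
      by (intro openin_Int openin_X ra(1) rb(1) openin_hits)
    moreover have "p_pt n e J \<in> ?W"
    proof -
      have "e j \<in> p_pt n e J a" using a(2) ra by (simp add: p_pt_def vec.span_base)
      moreover have "e j \<in> ?A" using i j ra(5) by simp
      moreover have "e i \<in> p_pt n e J b" using b(2) rb by (simp add: p_pt_def vec.span_base)
      moreover have "e i \<in> ?B" using i j ra(5) by simp
      moreover have "p_pt n e J a \<in> Gr k" "p_pt n e J b \<in> Gr k"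
        using X_setD(1)[OF p_pt_X[OF J]] ra(1) rb(1) by blast+
      ultimately show ?thesis using p_pt_X[OF J] unfolding hits_def by blast
    qed
    ultimately obtain x where x: "curve I i j x \<in> ?W" using meet by blast
    then obtain v w where v: "v \<in> curve I i j x a" "norm (coord v i) < norm (coord v j)"
      and w: "w \<in> curve I i j x b" "norm (coord w j) < norm (coord w i)" unfolding hits_def by blast
    have "norm x * norm (coord v j) < norm (coord v j)" using curve_coord(1)[OF a(1) v(1)] v(2) by (simp add: norm_mult)
    then have "norm x < 1" using mult_right_less_imp_less[of "norm x" "norm (coord v j)" 1] by simp
    moreover have "norm (coord w j) < norm x * norm (coord w j)" using curve_coord(1)[OF b(1) w(1)] w(2) by (simp add: norm_mult)
    then have "1 < norm x" using mult_right_less_imp_less[of 1 "norm (coord w j)" "norm x"] by simp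
    ultimately show False by simp
  qed
  show ?thesis
  proof (cases "\<exists>a\<in>exch_range n I i j. J a = I a")
    case True
    then have "J a = I a" if "a \<in> {1..n}" for a using out[OF that] inr[of a] mix by blast
    then have "J = I" by (rule necklace_ext[OF J I])
    then show ?thesis ..
  next
    case False
    have "J a = exch n I i j a" for a
    proof (cases "a \<in> {1..n}")
      case True
      then show ?thesis using out[of a] inr[of a] False by (auto simp: exch_def)
    next
      case False
      then show ?thesis using J by (auto simp: exch_def necklaces_def PiE_iff extensional_def)
    qed
    then show ?thesis by blast
  qed
qed

text \<open>
  At an index \<open>a\<close> of the range consider a point of the lower cell, with pivots \<open>insert i (I a - {j})\<close>. Its
  reduced row with pivot \<open>i\<close> vanishes at the other pivots, and at \<open>j\<close> since \<open>j\<close> comes after \<open>i\<close>; so it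
  vanishes on all of \<open>I a\<close>. This cannot happen near the coordinate subspace of \<open>I a\<close>.
\<close>

lemma exch_cell_closure:
  assumes I': "exch n I i j \<in> necklaces k n" and ne: "exch_range n I i j \<noteq> {}"
  shows "p_pt n e I \<notin> X_top k n e closure_of (cell k n e (exch n I i j))"
proof
  assume cl: "p_pt n e I \<in> X_top k n e closure_of (cell k n e (exch n I i j))"
  obtain a where a: "a \<in> exch_range n I i j" using ne by blast
  note r = exch_rangeD[OF a]
  let ?W = "{V \<in> X_set k n e. V a \<in> box_nbhd k (I a)}"
  have "openin (X_top k n e) ?W" using necklace_comp(3)[OF I r(1)] by (intro openin_X r openin_box_nbhd)
  moreover have "p_pt n e I \<in> ?W" using p_pt_X[OF I] box_nbhd_p_pt[OF I r(1)] by simp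
  ultimately obtain V where V: "V \<in> cell k n e (exch n I i j)" "V \<in> ?W"
    by (rule closure_of_meets[OF cl])
  then have VX: "V \<in> X_set k n e" "necklace_of V = exch n I i j" unfolding cell_eq[OF I'] by blast+
  have "leads a (V a) = necklace_of V a" using r(1) by (simp add: necklace_of_def)
  also have "\<dots> = insert i (I a - {j})" unfolding VX(2) using r(1) a by (simp add: exch_def)
  finally have L: "leads a (V a) = insert i (I a - {j})" .
  note U = X_setD(2)[OF VX(1) r(1)]
  let ?r = "rvec a (V a) i"
  have "coord ?r m = 0" if m: "m \<in> I a" for m
  proof (cases "m = j")
    case True
    then show ?thesis using rvec_lead[OF U r(1) _ j r(2)] L by simp
  next
    case False
    then show ?thesis using rvec_dual[OF U r(1), of m i] m L r(4) by auto
  qed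
  then have "?r = 0"
    using V(2) rvec_in[OF U r(1)] necklace_comp[OF I r(1)] by (intro box_nbhd_inj[of "V a" k "I a"]) auto
  then show False using rvec_dual[OF U r(1), of i i] L by simp
qed

text \<open>
  The parametrisation is a homeomorphism onto the curve because the parameter can be read off as the
  quotient of the coordinates \<open>i\<close> and \<open>j\<close> of a vector in the component at an index of the range; so the
  points with parameter in an open set \<open>D\<close> are those whose component meets an open set of vectors.
\<close>

lemma curve_acts:
  assumes ne: "exch_range n I i j \<noteq> {}"
  shows "acts_by_character n (X_top k n e) (torus_act n e) (curve I i j ` (- {0})) (chi n i j)"
proof -
  let ?X = "X_top k n e" and ?Q = "curve I i j ` (- {0})" and ?C = "top_of_set (- {0::complex})"
  obtain a where a: "a \<in> exch_range n I i j" using ne by blast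
  note r = exch_rangeD[OF a]
  have QX: "?Q \<subseteq> topspace ?X" using curve_X by (auto simp: topspace_X)
  have "continuous_map ?C ?X (curve I i j)"
    unfolding continuous_map_atin
  proof
    fix z assume z: "z \<in> topspace ?C"
    have "limitin euclidean (\<lambda>x. x) z (atin ?C z)"
      using z by (intro limitin_continuous_map[where f = "\<lambda>x. x"]) auto
    then show "limitin ?X (curve I i j) (curve I i j z) (atin ?C z)"
      using curve_limit[of "\<lambda>x. x" z "atin ?C z"] by simp
  qed
  then have cont: "continuous_map ?C (subtopology ?X ?Q) (curve I i j)"
    by (simp add: continuous_map_in_subtopology Pi_iff)
  have op: "open_map ?C (subtopology ?X ?Q) (curve I i j)"
    unfolding open_map_def
  proof (intro allI impI)
    fix D assume "openin ?C D"
    then have D: "open D" "D \<subseteq> - {0}"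
      using openin_open_eq[OF open_Compl[OF closed_singleton[of "0::complex"]]] by blast+
    let ?B = "{v. coord v j \<noteq> 0} \<inter> (\<lambda>v. coord v i / coord v j) -` D"
    have "open {v. coord v j \<noteq> 0}" by (intro open_Collect_neq continuous_intros)
    then have "open ?B" using D(1)
      by (intro continuous_open_preimage) (auto intro!: continuous_intros)
    then have "openin ?X {V \<in> X_set k n e. V a \<in> hits k ?B}" by (intro openin_X r openin_hits)
    moreover have "curve I i j ` D = {V \<in> X_set k n e. V a \<in> hits k ?B} \<inter> ?Q"
    proof (intro equalityI subsetI)
      fix V assume "V \<in> curve I i j ` D"
      then obtain z where z: "z \<in> D" "V = curve I i j z" by blast
      have "e j + z *s e i \<in> V a"
        using curve_vec_in[OF r(1,3), of z] a z by (simp add: curve_vec_def)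
      moreover have "e j + z *s e i \<in> ?B" using i j r(5) z by simp
      ultimately show "V \<in> {V \<in> X_set k n e. V a \<in> hits k ?B} \<inter> ?Q"
        using z D(2) curve_X curve_Gr[OF r(1)] unfolding hits_def by blast
    next
      fix V assume "V \<in> {V \<in> X_set k n e. V a \<in> hits k ?B} \<inter> ?Q"
      then obtain z v where z: "V = curve I i j z" "v \<in> V a" "coord v j \<noteq> 0" "coord v i / coord v j \<in> D"
        unfolding hits_def by blast
      then have "z \<in> D" using curve_coord(1)[OF a, of v z] by simp
      then show "V \<in> curve I i j ` D" using z by blast
    qed
    ultimately show "openin (subtopology ?X ?Q) (curve I i j ` D)" by (auto simp: openin_subtopology)
  qed
  have "homeomorphic_map ?C (subtopology ?X ?Q) (curve I i j)"
  proof (rule bijective_open_imp_homeomorphic_map[OF cont op])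
    show "curve I i j ` topspace ?C = topspace (subtopology ?X ?Q)" using QX by auto
    show "inj_on (curve I i j) (topspace ?C)" using curve_inj[OF ne] by (blast intro: inj_onI)
  qed
  moreover have "chi n i j \<in> characters n" using i j by (auto simp: characters_def chi_apply)
  ultimately show ?thesis unfolding acts_by_character_def using curve_torus by blast
qed

end

lemma acts_by_inverse_character:
  assumes "acts_by_character n X act Q m"
  shows "acts_by_character n X act Q (- m)"
proof -
  let ?C = "top_of_set (- {0::complex})"
  obtain \<phi> where \<phi>: "m \<in> characters n" "homeomorphic_map ?C (subtopology X Q) \<phi>"
    "\<And>g z. g \<in> torus n \<Longrightarrow> z \<in> - {0} \<Longrightarrow> act g (\<phi> z) = \<phi> (char_eval n m g * z)"
    using assms unfolding acts_by_character_def by blast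
  have "continuous_map ?C ?C inverse"
    by (auto simp: continuous_map_in_subtopology intro!: continuous_intros)
  then have "homeomorphic_map ?C ?C inverse" by (rule homeomorphic_map_involution) simp
  then have "homeomorphic_map ?C (subtopology X Q) (\<phi> \<circ> inverse)"
    using \<phi>(2) by (rule homeomorphic_map_compose)
  moreover have "act g ((\<phi> \<circ> inverse) z) = (\<phi> \<circ> inverse) (char_eval n (- m) g * z)"
    if "g \<in> torus n" "z \<in> - {0}" for g z
  proof -
    have "char_eval n (- m) g = inverse (char_eval n m g)"
      by (simp add: char_eval_def power_int_minus prod_inversef flip: prod_inversef)
    then show ?thesis using \<phi>(3)[of g "inverse z"] that by simp
  qed
  moreover have "- m \<in> characters n" using \<phi>(1) by (simp add: characters_def)
  ultimately show ?thesis unfolding acts_by_character_def by blast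
qed

text \<open>
  The character of an orbit that is equivariantly isomorphic to \<open>\<complex>\<^sup>*\<close> has the stabilizer of a point as
  its kernel.
\<close>

lemma acts_by_character_unique:
  assumes m: "acts_by_character n X act Q m" and c: "acts_by_character n X act Q (chi n i j)"
    and ij: "(i, j) \<in> root_pairs n"
  shows "m = chi n i j \<or> m = - chi n i j"
proof (rule character_kernel_chi[OF ij])
  let ?C = "top_of_set (- {0::complex})"
  obtain \<psi> where \<psi>: "m \<in> characters n" "homeomorphic_map ?C (subtopology X Q) \<psi>"
    "\<And>g z. g \<in> torus n \<Longrightarrow> z \<in> - {0} \<Longrightarrow> act g (\<psi> z) = \<psi> (char_eval n m g * z)"
    using m unfolding acts_by_character_def by blast
  obtain \<phi> where \<phi>: "homeomorphic_map ?C (subtopology X Q) \<phi>"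
    "\<And>g z. g \<in> torus n \<Longrightarrow> z \<in> - {0} \<Longrightarrow> act g (\<phi> z) = \<phi> (char_eval n (chi n i j) g * z)"
    using c unfolding acts_by_character_def by blast
  show "m \<in> characters n" by (rule \<psi>(1))
  have im: "\<psi> ` (- {0}) = \<phi> ` (- {0})"
    using homeomorphic_imp_surjective_map[OF \<psi>(2)] homeomorphic_imp_surjective_map[OF \<phi>(1)] by simp
  have inj: "inj_on \<psi> (- {0})" "inj_on \<phi> (- {0})"
    using homeomorphic_imp_injective_map[OF \<psi>(2)] homeomorphic_imp_injective_map[OF \<phi>(1)] by simp_all
  have "\<psi> 1 \<in> \<phi> ` (- {0})" unfolding im[symmetric] by simp
  then obtain z where z: "z \<noteq> 0" "\<psi> 1 = \<phi> z" by auto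
  fix g assume g: "g \<in> torus n"
  have nz: "char_eval n m' g \<noteq> 0" for m'
    using torus_nz[OF g] by (auto simp: char_eval_def)
  have eq: "\<psi> (char_eval n m g) = \<phi> (char_eval n (chi n i j) g * z)"
    using \<psi>(3)[OF g, of 1] \<phi>(2)[OF g, of z] z by simp
  have "char_eval n m g = 1 \<longleftrightarrow> \<psi> (char_eval n m g) = \<psi> 1"
    using inj_on_eq_iff[OF inj(1), of "char_eval n m g" 1] nz by simp
  also have "\<dots> \<longleftrightarrow> \<phi> (char_eval n (chi n i j) g * z) = \<phi> z" unfolding eq z(2) ..
  also have "\<dots> \<longleftrightarrow> char_eval n (chi n i j) g * z = z"
    using inj_on_eq_iff[OF inj(2), of "char_eval n (chi n i j) g * z" z] nz z(1) by simp
  also have "\<dots> \<longleftrightarrow> char_eval n (chi n i j) g = 1" using z(1) by simp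
  finally show "char_eval n m g = 1 \<longleftrightarrow> char_eval n (chi n i j) g = 1" .
qed

section \<open>Classification of fixed points and one-dimensional orbits\<close>

lemma entries_empty:
  assumes V: "V \<in> X_set k n e" and N: "entries V = {}"
  shows "V = p_pt n e (necklace_of V)"
proof -
  obtain w where h: "\<forall>j\<in>{1..n}. coord (w j) j = 1 \<and>
      (\<forall>i\<in>{1..n}. i \<noteq> j \<longrightarrow> coord (w j) i \<noteq> 0 \<longrightarrow> (i, j) \<in> entries V) \<and>
      (\<forall>a\<in>{1..n}. j \<in> leads a (V a) \<longrightarrow> trunc a j (w j) \<in> V a)"
    using generating_vectors[OF V] by (rule exE)
  have w: "\<And>j. j \<in> {1..n} \<Longrightarrow> coord (w j) j = 1"
    "\<And>i j. i \<in> {1..n} \<Longrightarrow> j \<in> {1..n} \<Longrightarrow> i \<noteq> j \<Longrightarrow> coord (w j) i \<noteq> 0 \<Longrightarrow> (i, j) \<in> entries V"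
    "\<And>a j. a \<in> {1..n} \<Longrightarrow> j \<in> leads a (V a) \<Longrightarrow> trunc a j (w j) \<in> V a"
    using h leads_sub by blast+
  have P: "p_pt n e (necklace_of V) \<in> X_set k n e" by (intro p_pt_X necklace_of_necklace V)
  have "p_pt n e (necklace_of V) a = V a" if a: "a \<in> {1..n}" for a
  proof (rule Gr_eqI[OF _ X_setD(1)[OF P a] X_setD(1)[OF V a]])
    have "e l \<in> V a" if l: "l \<in> leads a (V a)" for l
    proof -
      have ln: "l \<in> {1..n}" using l leads_sub by blast
      have "trunc a l (w l) = e l"
        using w(1)[OF ln] w(2)[OF _ ln] N ln by (intro coord_eqI) auto
      then show ?thesis using w(3)[OF a l] by simp
    qed
    then have "vec.span (e ` leads a (V a)) \<subseteq> V a"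
      by (intro vec.span_minimal X_setD(2)[OF V a]) blast
    then show "p_pt n e (necklace_of V) a \<subseteq> V a" using a by (simp add: p_pt_def necklace_of_def)
  qed
  then show ?thesis using X_set_ext[OF P V] by simp
qed

text \<open>
  With only the pair \<open>(i, j)\<close> available, the generating vectors of \<open>V\<close> are \<open>e l\<close> for \<open>l \<noteq> j\<close> and
  \<open>e j + x *s e i\<close>. One and the same \<open>x\<close> serves at all indices, so \<open>V\<close> is a point of the curve.
\<close>

lemma entries_singleton:
  assumes V: "V \<in> X_set k n e" and N: "entries V = {(i, j)}"
  obtains x where "x \<noteq> 0" "V = curve (necklace_of V) i j x" "exch_range n (necklace_of V) i j \<noteq> {}"
proof -
  let ?I = "necklace_of V"
  have I: "?I \<in> necklaces k n" by (rule necklace_of_necklace[OF V])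
  have "(i, j) \<in> entries V" using N by simp
  then obtain s where ij: "i \<in> {1..n}" "j \<in> {1..n}" "i \<noteq> j"
    and s: "s \<in> {1..n}" "j \<in> leads s (V s)" "coord (rvec s (V s) j) i \<noteq> 0"
    unfolding entries_def by blast
  have sr: "s \<in> exch_range n ?I i j"
    using lead_neighbour[OF V s(1,2) ij(1,3) s(3)] s by (simp add: exch_range_def necklace_of_def)
  obtain w where h: "\<forall>j\<in>{1..n}. coord (w j) j = 1 \<and>
      (\<forall>i\<in>{1..n}. i \<noteq> j \<longrightarrow> coord (w j) i \<noteq> 0 \<longrightarrow> (i, j) \<in> entries V) \<and>
      (\<forall>a\<in>{1..n}. j \<in> leads a (V a) \<longrightarrow> trunc a j (w j) \<in> V a)"
    using generating_vectors[OF V] by (rule exE)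
  have w: "\<And>j. j \<in> {1..n} \<Longrightarrow> coord (w j) j = 1"
    "\<And>i j. i \<in> {1..n} \<Longrightarrow> j \<in> {1..n} \<Longrightarrow> i \<noteq> j \<Longrightarrow> coord (w j) i \<noteq> 0 \<Longrightarrow> (i, j) \<in> entries V"
    "\<And>a j. a \<in> {1..n} \<Longrightarrow> j \<in> leads a (V a) \<Longrightarrow> trunc a j (w j) \<in> V a"
    using h leads_sub by blast+
  define x where "x = coord (w j) i"
  have cw: "coord (w l) m = (if m = l then 1 else if l = j \<and> m = i then x else 0)"
    if "l \<in> {1..n}" "m \<in> {1..n}" for l m
  proof -
    consider "m = l" | "l = j" "m = i" "m \<noteq> l" | "m \<noteq> l" "(m, l) \<notin> entries V" using N by blast
    then show ?thesis
    proof cases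
      case 3
      then have "coord (w l) m = 0" using w(2)[OF that(2,1)] by blast
      then show ?thesis using 3 N by auto
    qed (use w(1)[OF that(1)] in \<open>simp_all add: x_def\<close>)
  qed
  have C: "curve ?I i j x \<in> X_set k n e" by (rule curve_X[OF I ij(1,2)])
  have sub: "curve_vec ?I i j x a l \<in> V a" if a: "a \<in> {1..n}" and l: "l \<in> leads a (V a)" for a l
  proof -
    note U = X_setD(2)[OF V a]
    have ln: "l \<in> {1..n}" using l leads_sub by blast
    have t: "trunc a l (w l) = (if l = j \<and> pos n a i < pos n a j then e j + x *s e i else e l)"
    proof (rule coord_eqI)
      fix m assume m: "m \<in> {1..n}"
      have ne: "pos n a i \<noteq> pos n a j" using pos_eq_iff[OF a ij(1,2)] ij(3) by simp
      show "coord (trunc a l (w l)) m = coord (if l = j \<and> pos n a i < pos n a j then e j + x *s e i else e l) m"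
        using cw[OF ln m] ij ln m ne by (cases "m = l"; cases "m = i"; cases "l = j") auto
    qed
    show ?thesis
    proof (cases "l = j \<and> pos n a i < pos n a j \<and> i \<in> leads a (V a)")
      case False
      then have "curve_vec ?I i j x a l = trunc a l (w l)"
        unfolding t using l a by (auto simp: curve_vec_def exch_range_def necklace_of_def)
      then show ?thesis using w(3)[OF a l] by simp
    next
      case True
      have "trunc a i (w i) = e i" using cw[OF ij(1)] ij by (intro coord_eqI) auto
      then have "e i \<in> V a" using w(3)[OF a, of i] True by simp
      moreover have "e j + x *s e i \<in> V a" using w(3)[OF a l] t True by simp
      ultimately have "e j + x *s e i - x *s e i \<in> V a"
        using vec.subspace_diff[OF U] vec.subspace_scale[OF U] by blast
      then have "e j \<in> V a" by simp
      moreover have "curve_vec ?I i j x a l = e j"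
        using True a by (simp add: curve_vec_def exch_range_def necklace_of_def)
      ultimately show ?thesis by simp
    qed
  qed
  have "curve ?I i j x a = V a" if a: "a \<in> {1..n}" for a
  proof (rule Gr_eqI[OF _ X_setD(1)[OF C a] X_setD(1)[OF V a]])
    show "curve ?I i j x a \<subseteq> V a"
    proof -
      have "curve_vec ?I i j x a ` leads a (V a) \<subseteq> V a" using sub[OF a] by blast
      then have "vec.span (curve_vec ?I i j x a ` leads a (V a)) \<subseteq> V a"
        by (rule vec.span_minimal[OF _ X_setD(2)[OF V a]])
      then show ?thesis using a by (simp add: curve_def necklace_of_def)
    qed
  qed
  then have VC: "V = curve ?I i j x"
    using X_set_ext[OF C V] by simp
  have "x \<noteq> 0"
  proof
    assume "x = 0"
    note U = X_setD(2)[OF V s(1)]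
    have "curve_vec ?I i j x s j = e j" using \<open>x = 0\<close> by (simp add: curve_vec_def)
    then have "e j \<in> V s" using sub[OF s(1,2)] by simp
    moreover have "coord (e j) m = (if j = m then 1 else 0)" if "m \<in> leads s (V s)" for m
      using that leads_sub by (intro coord_e ij(2)) blast
    ultimately have "rvec s (V s) j = e j" by (rule rvec_unique[OF U s(1)])
    then show False using s(3) ij by simp
  qed
  with VC sr that show thesis by blast
qed

lemma one_dim_orbitsD:
  assumes "Q \<in> one_dim_orbits n (X_top k n e) (torus_act n e)"
  obtains I i j where "I \<in> necklaces k n" "i \<in> {1..n}" "j \<in> {1..n}" "exch_range n I i j \<noteq> {}"
    "Q = curve I i j ` (- {0})"
proof -
  obtain V where V: "V \<in> X_set k n e" "orbit_dim n (torus_act n e) V = 1"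
    and Q: "Q = act_orbit (torus n) (torus_act n e) V"
    using assms unfolding one_dim_orbits_def topspace_X by blast
  obtain p where p: "entries V = {p}"
    using orbit_dim_one_iff[OF stabilizer_entries[OF V(1)] entries_sub] V(2) by blast
  obtain i j where ij: "p = (i, j)" by fastforce
  then have "(i, j) \<in> root_pairs n" using p entries_sub by blast
  then have ijn: "i \<in> {1..n}" "j \<in> {1..n}" "i \<noteq> j" by (auto simp: root_pairs_def)
  obtain x where x: "x \<noteq> 0" "V = curve (necklace_of V) i j x" "exch_range n (necklace_of V) i j \<noteq> {}"
    using entries_singleton[OF V(1)] p ij by metis
  have I: "necklace_of V \<in> necklaces k n" by (rule necklace_of_necklace[OF V(1)])
  have "Q = curve (necklace_of V) i j ` (- {0})"
    using curve_orbit[OF I ijn x(1)] Q x(2) by simp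
  with that I ijn x(3) show thesis by blast
qed

lemma finite_one_dim_orbits: "finite (one_dim_orbits n (X_top k n e) (torus_act n e))"
proof (rule finite_subset)
  show "one_dim_orbits n (X_top k n e) (torus_act n e)
      \<subseteq> (\<lambda>(I, i, j). curve I i j ` (- {0})) ` (necklaces k n \<times> {1..n} \<times> {1..n})"
  proof
    fix Q assume "Q \<in> one_dim_orbits n (X_top k n e) (torus_act n e)"
    then obtain I i j where "I \<in> necklaces k n" "i \<in> {1..n}" "j \<in> {1..n}" "Q = curve I i j ` (- {0})"
      by (rule one_dim_orbitsD)
    then show "Q \<in> (\<lambda>(I, i, j). curve I i j ` (- {0})) ` (necklaces k n \<times> {1..n} \<times> {1..n})"
      by (intro image_eqI[of _ _ "(I, i, j)"]) auto
  qed
  show "finite ((\<lambda>(I, i, j). curve I i j ` (- {0})) ` (necklaces k n \<times> {1..n} \<times> {1..n}))"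
    by (intro finite_imageI finite_cartesian_product finite_necklaces finite_atLeastAtMost)
qed

lemma torus_p_pt:
  assumes g: "g \<in> torus n" and I: "I \<in> necklaces k n"
  shows "torus_act n e g (p_pt n e I) = p_pt n e I"
proof -
  have "diag n e (wt g a) ` vec.span (e ` I a) = vec.span (e ` I a)" if a: "a \<in> {1..n}" for a
  proof (rule Gr_eqI)
    show "vec.span (e ` I a) \<in> Gr (card (I a))" using span_e_Gr necklace_comp(1)[OF I a] by blast
    then show "diag n e (wt g a) ` vec.span (e ` I a) \<in> Gr (card (I a))"
      by (intro diag_Gr nonzero_wt g)
    show "diag n e (wt g a) ` vec.span (e ` I a) \<subseteq> vec.span (e ` I a)"
      using coord_span_e[OF necklace_comp(1)[OF I a]] necklace_comp(1)[OF I a] by (auto intro!: in_span_e)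
  qed
  then show ?thesis unfolding torus_act_wt p_pt_def by (intro restrict_ext) simp
qed

text \<open>
  No character \<open>chi n i j\<close> is trivial, so a fixed point has no echelon entries off the pivots.
\<close>

lemma fixed_points_eq: "fixed_points n (X_top k n e) (torus_act n e) = p_pt n e ` necklaces k n"
proof (intro equalityI subsetI)
  fix V assume "V \<in> fixed_points n (X_top k n e) (torus_act n e)"
  then have V: "V \<in> X_set k n e" "\<And>g. g \<in> torus n \<Longrightarrow> torus_act n e g V = V"
    by (auto simp: fixed_points_def topspace_X)
  have "entries V = {}"
  proof (rule ccontr)
    assume "entries V \<noteq> {}"
    then obtain i j where ij: "(i, j) \<in> entries V" by fastforce
    then have r: "(i, j) \<in> root_pairs n" using entries_sub by blast
    then have ijn: "i \<in> {1..n}" "j \<in> {1..n}" "i \<noteq> j" by (auto simp: root_pairs_def)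
    let ?g = "\<lambda>l\<in>{0..n}. if l = i then 2 else (1::complex)"
    have g: "?g \<in> torus n" by (auto simp: torus_def)
    then have "?g \<in> stabilizer n (torus_act n e) V" using V(2) by (simp add: stabilizer_def)
    then have "char_eval n (chi n i j) ?g = 1" using ij unfolding stabilizer_entries[OF V(1)] by blast
    then show False using ijn by (auto simp: char_eval_chi[OF r])
  qed
  then show "V \<in> p_pt n e ` necklaces k n"
    using entries_empty[OF V(1)] necklace_of_necklace[OF V(1)] by blast
next
  fix V assume "V \<in> p_pt n e ` necklaces k n"
  then show "V \<in> fixed_points n (X_top k n e) (torus_act n e)"
    using p_pt_X torus_p_pt by (auto simp: fixed_points_def topspace_X)
qed

lemma p_pt_cell: "I \<in> necklaces k n \<Longrightarrow> J \<in> necklaces k n \<Longrightarrow> p_pt n e I \<in> cell k n e J \<longleftrightarrow> I = J"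
  by (simp add: cell_eq p_pt_X necklace_of_p_pt)

lemma p_pt_inj: "inj_on (p_pt n e) (necklaces k n)"
  by (rule inj_on_inverseI) (rule necklace_of_p_pt)

lemma torus_cell:
  assumes I: "I \<in> necklaces k n" and g: "g \<in> torus n"
  shows "torus_act n e g ` cell k n e I = cell k n e I"
proof -
  have sub: "torus_act n e h V \<in> cell k n e I" if "h \<in> torus n" "V \<in> cell k n e I" for h V
    using that torus_X necklace_of_torus unfolding cell_eq[OF I] by auto
  let ?h = "\<lambda>i\<in>{0..n}. inverse (g i)"
  have h: "?h \<in> torus n" using torus_nz[OF g] by (auto simp: torus_def)
  have "torus_mult n g ?h = torus_one n"
    using torus_nz[OF g] by (auto simp: torus_mult_def torus_one_def)
  then have "torus_act n e g (torus_act n e ?h V) = V" if "V \<in> cell k n e I" for V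
    using torus_comp[OF g h, of V] torus_id[of V k] that unfolding cell_eq[OF I] by simp
  then show ?thesis using sub[OF g] sub[OF h] by (auto simp: image_iff) metis
qed

section \<open>The moment graph\<close>

text \<open>
  A one-dimensional orbit has exactly its two end points as fixed points in its closure, hence they are
  the given ones in one of the two orders.
\<close>

lemma connecting_orbitsD:
  assumes I: "I \<in> necklaces k n" and I': "I' \<in> necklaces k n" and ne: "I \<noteq> I'"
    and Q: "Q \<in> connecting_orbits n (X_top k n e) (torus_act n e) (p_pt n e I) (p_pt n e I')"
  obtains K i j where "K \<in> necklaces k n" "i \<in> {1..n}" "j \<in> {1..n}" "exch_range n K i j \<noteq> {}"
    "Q = curve K i j ` (- {0})" "I = K \<and> I' = exch n K i j \<or> I = exch n K i j \<and> I' = K"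
proof -
  have Q1: "Q \<in> one_dim_orbits n (X_top k n e) (torus_act n e)"
    and cl: "p_pt n e I \<in> X_top k n e closure_of Q" "p_pt n e I' \<in> X_top k n e closure_of Q"
    using Q by (auto simp: connecting_orbits_def)
  obtain K i j where K: "K \<in> necklaces k n" "i \<in> {1..n}" "j \<in> {1..n}" "exch_range n K i j \<noteq> {}"
    "Q = curve K i j ` (- {0})" using Q1 by (rule one_dim_orbitsD)
  have "I = K \<or> I = exch n K i j" "I' = K \<or> I' = exch n K i j"
    using curve_closure_fixed[OF K(1-3) I] curve_closure_fixed[OF K(1-3) I'] cl K(5) by auto
  then show thesis using that K ne by blast
qed

text \<open>
  The order of the end points of an orbit is decided by the cells: the point at \<open>x = \<infinity>\<close> lies in the
  closure of the cell of the point at \<open>x = 0\<close>, but not conversely.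
\<close>

lemma moment_edge_iff:
  assumes I: "I \<in> necklaces k n" and I': "I' \<in> necklaces k n"
  shows "moment_edge n (X_top k n e) (torus_act n e) (cell k n e ` necklaces k n) (p_pt n e I) (p_pt n e I')
    \<longleftrightarrow> necklace_less n I' I \<and> (\<exists>a b j j'. necklace_move n I I' a b j j')"
proof
  assume edge: "moment_edge n (X_top k n e) (torus_act n e) (cell k n e ` necklaces k n) (p_pt n e I) (p_pt n e I')"
  then obtain Q where Q: "Q \<in> connecting_orbits n (X_top k n e) (torus_act n e) (p_pt n e I) (p_pt n e I')"
    and ne: "I \<noteq> I'" unfolding moment_edge_def by blast
  obtain J where J: "J \<in> necklaces k n" "p_pt n e I \<in> cell k n e J"
    "p_pt n e I' \<in> X_top k n e closure_of (cell k n e J)"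
    using edge unfolding moment_edge_def by blast
  then have cl: "p_pt n e I' \<in> X_top k n e closure_of (cell k n e I)" using p_pt_cell[OF I] by blast
  obtain K i j where K: "K \<in> necklaces k n" "i \<in> {1..n}" "j \<in> {1..n}" "exch_range n K i j \<noteq> {}"
    "I = K \<and> I' = exch n K i j \<or> I = exch n K i j \<and> I' = K"
    using connecting_orbitsD[OF I I' ne Q] by metis
  have "I = K \<and> I' = exch n K i j"
    using K(5) exch_cell_closure[OF K(1-3) _ K(4)] cl I by blast
  then show "necklace_less n I' I \<and> (\<exists>a b j j'. necklace_move n I I' a b j j')"
    using exch_less[OF K(1-4)] exch_necklace_move[OF K(1-4)] by blast
next
  assume h: "necklace_less n I' I \<and> (\<exists>a b j j'. necklace_move n I I' a b j j')"
  then obtain a b j i where less: "necklace_less n I' I" and move: "necklace_move n I I' a b j i" by blast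
  note m = necklace_move_exch[OF I I' less move]
  have ne: "exch_range n I i j \<noteq> {}" using m(2) by blast
  let ?Q = "curve I i j ` (- {0})"
  have cl: "p_pt n e I \<in> X_top k n e closure_of ?Q" "p_pt n e I' \<in> X_top k n e closure_of ?Q"
    using curve_closure_0[OF I m(4,3)] curve_closure_infinity[OF I m(4,3)] I' m(1) by auto
  then have "?Q \<in> connecting_orbits n (X_top k n e) (torus_act n e) (p_pt n e I) (p_pt n e I')"
    using curve_one_dim[OF I m(4,3) ne] by (simp add: connecting_orbits_def)
  moreover have "?Q \<subseteq> cell k n e I" using curve_cell[OF I m(4,3)] by blast
  then have "p_pt n e I' \<in> X_top k n e closure_of (cell k n e I)"
    using cl(2) closure_of_mono by blast
  moreover have "p_pt n e I \<in> cell k n e I" using p_pt_cell[OF I I] by simp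
  moreover have "p_pt n e I \<noteq> p_pt n e I'"
    using less inj_onD[OF p_pt_inj _ I I'] by (auto simp: necklace_less_def)
  ultimately show "moment_edge n (X_top k n e) (torus_act n e) (cell k n e ` necklaces k n) (p_pt n e I) (p_pt n e I')"
    using I I' unfolding moment_edge_def fixed_points_eq by blast
qed

text \<open>
  Since \<open>I' < I\<close>, the necklace \<open>I\<close> is the end \<open>x = 0\<close> of the orbit, and the move determines the pair
  of exchanged elements.
\<close>

lemma moment_label:
  assumes I: "I \<in> necklaces k n" and I': "I' \<in> necklaces k n"
    and less: "necklace_less n I' I" and move: "necklace_move n I I' a b j j'"
    and Q: "Q \<in> connecting_orbits n (X_top k n e) (torus_act n e) (p_pt n e I) (p_pt n e I')"
  shows "{m. acts_by_character n (X_top k n e) (torus_act n e) Q m}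
    = {eps j - eps j' - of_nat (card (cyc_halfopen n a j' j)) * delta,
       - (eps j - eps j' - of_nat (card (cyc_halfopen n a j' j)) * delta)}"
proof -
  note m = necklace_move_exch[OF I I' less move]
  note r = exch_rangeD[OF I m(4,3,2)]
  have ne: "I \<noteq> I'" using less by (auto simp: necklace_less_def)
  obtain K i l where K: "K \<in> necklaces k n" "i \<in> {1..n}" "l \<in> {1..n}" "exch_range n K i l \<noteq> {}"
    "Q = curve K i l ` (- {0})" "I = K \<and> I' = exch n K i l \<or> I = exch n K i l \<and> I' = K"
    using connecting_orbitsD[OF I I' ne Q] by metis
  have "\<not> (I = exch n K i l \<and> I' = K)"
  proof
    assume "I = exch n K i l \<and> I' = K"
    then have "necklace_less n I I'" using exch_less[OF K(1-4)] by simp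
    then have "I c = I' c" if "c \<in> {1..n}" for c
      using subset_le_antisym[OF that necklace_comp(1)[OF I that] necklace_comp(1)[OF I' that]] less that
      by (simp add: necklace_less_def necklace_le_def)
    then show False using necklace_ext[OF I I'] ne by blast
  qed
  then have KI: "K = I" "I' = exch n I i l" using K(6) by auto
  have e1: "I' a = insert j' (I a - {j})" using m(1,2) r(1) by (simp add: exch_def)
  have "a \<in> exch_range n I i l"
  proof (rule ccontr)
    assume "a \<notin> exch_range n I i l"
    then have "I' a = I a" using KI(2) r(1) by (simp add: exch_def)
    then show False using e1 r by blast
  qed
  then have e2: "I' a = insert i (I a - {l})" "i \<notin> I a"
    using KI(2) r(1) by (auto simp: exch_def exch_range_def)
  have "j \<notin> I' a" unfolding e1 using r(5) by blast
  then have il: "i = j'" "l = j" using e1 e2 r(3) by blast+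
  have Qc: "Q = curve I j' j ` (- {0})" and ne': "exch_range n I j' j \<noteq> {}" using K il KI by auto
  note acts = curve_acts[OF I m(4,3) ne', folded Qc]
  have rp: "(j', j) \<in> root_pairs n" using m r(5) by (simp add: root_pairs_def)
  have "{m. acts_by_character n (X_top k n e) (torus_act n e) Q m} = {chi n j' j, - chi n j' j}"
    using acts acts_by_inverse_character[OF acts] acts_by_character_unique[OF _ acts rp] by blast
  moreover have "card (cyc_halfopen n a j' j) = pos n j' j"
    using r(1,2) m(3,4) by (intro card_cyc_halfopen) auto
  then have "eps j - eps j' - of_nat (card (cyc_halfopen n a j' j)) * delta = - chi n j' j"
    by (simp add: chi_def)
  ultimately show ?thesis by auto
qed

end

theorem theorem2:
  fixes k n :: nat and e :: "nat \<Rightarrow> complex ^ 'n"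
  assumes "k < n" and "is_basis n e"
  shows
    "cell k n e ` necklaces k n
       = act_orbit (Aut_U n e) (tuple_act n) ` X_set k n e
   \<and> (\<forall>g\<in>torus n. \<forall>V\<in>X_set k n e. torus_act n e g V \<in> X_set k n e)
   \<and> (\<forall>V\<in>X_set k n e. torus_act n e (torus_one n) V = V)
   \<and> (\<forall>g\<in>torus n. \<forall>g'\<in>torus n. \<forall>V\<in>X_set k n e.
        torus_act n e (torus_mult n g g') V = torus_act n e g (torus_act n e g' V))
   \<and> (\<forall>I\<in>necklaces k n. \<forall>g\<in>torus n. torus_act n e g ` cell k n e I = cell k n e I)
   \<and> finite (fixed_points n (X_top k n e) (torus_act n e))
   \<and> finite (one_dim_orbits n (X_top k n e) (torus_act n e))
   \<and> (\<forall>I\<in>necklaces k n.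
        cell k n e I \<inter> fixed_points n (X_top k n e) (torus_act n e) = {p_pt n e I})
   \<and> bij_betw (p_pt n e) (necklaces k n) (fixed_points n (X_top k n e) (torus_act n e))
   \<and> (\<forall>I\<in>necklaces k n. \<forall>I'\<in>necklaces k n.
        moment_edge n (X_top k n e) (torus_act n e) (cell k n e ` necklaces k n)
          (p_pt n e I) (p_pt n e I')
        \<longleftrightarrow> necklace_less n I' I \<and> (\<exists>a b j j'. necklace_move n I I' a b j j'))
   \<and> (\<forall>I\<in>necklaces k n. \<forall>I'\<in>necklaces k n. \<forall>a b j j'.
        necklace_less n I' I \<and> necklace_move n I I' a b j j' \<longrightarrow>
        (\<forall>Q\<in>connecting_orbits n (X_top k n e) (torus_act n e) (p_pt n e I) (p_pt n e I').
           {m. acts_by_character n (X_top k n e) (torus_act n e) Q m}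
           = {eps j - eps j' - of_nat (card (cyc_halfopen n a j' j)) * delta,
              - (eps j - eps j' - of_nat (card (cyc_halfopen n a j' j)) * delta)}))"
proof -
  interpret based_space n e by unfold_locales (rule assms(2))
  have cell_fixed: "cell k n e I \<inter> fixed_points n (X_top k n e) (torus_act n e) = {p_pt n e I}"
    if "I \<in> necklaces k n" for I
    unfolding fixed_points_eq using p_pt_cell[OF _ that] that by blast
  have fin: "finite (fixed_points n (X_top k n e) (torus_act n e))"
    by (simp add: fixed_points_eq finite_necklaces)
  have bij: "bij_betw (p_pt n e) (necklaces k n) (fixed_points n (X_top k n e) (torus_act n e))"
    by (simp add: fixed_points_eq bij_betw_def p_pt_inj)
  show ?thesis
    by (intro conjI ballI allI impI; (elim conjE)?)
      (rule cells_eq_orbits torus_X torus_id torus_comp torus_cell fin finite_one_dim_orbits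
        cell_fixed bij moment_edge_iff moment_label; assumption)+
qed

end
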